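(* For large $x$ put $\lambda'=\lambda'(x)=\exp\left(\frac{1}{\sqrt7}\sqrt{\log_2 x\,\log_3 x}\right)$. Assume that $\mathcal{A}\subset\mathbb{N}$ satisfies $\mathbf{HL}[\phi,\psi]$ with $\phi(x)=\lambda'(x)\log x$ and $\psi(x)=\exp\left(\sqrt{\log_2 x\,\log_3 x}\right)$. Then, for all sufficiently large $x$, $$N_{\mathcal{A}}(x;\lambda\log x,k)=x\,\frac{e^{-\lambda}\lambda^k}{k!}\left(1+\mathcal{O}\left((\log_2 x)^{-10}\right)\right),$$ uniformly for $1/\sqrt{\log x}\le\lambda\le\lambda'$ and non-negative integers $k$ such that $$\max\{k,\;k\log(k/\lambda)\}\le\exp\left(\frac1{\sqrt{15}}\sqrt{\log_2 x\,\log_3 x}\right).$$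
   Context: $\log_1 x=\max\{0,\log x\}$ and $\log_k x=\max\{0,\log(\log_{k-1}x)\}$ for $k\ge2$ (iterated logarithms). For $k=0$ the expression $k\log(k/\lambda)$ is read as $0$. For $\mathcal{A}\subset\mathbb{N}$ (a set of positive integers), $N_{\mathcal{A}}(x;y,k)=|\{n\le x: |[n+1,n+y]\cap\mathcal{A}|=k\}|$, where $n$ runs over positive integers. For a finite set $\mathcal{H}\subset\mathbb{Z}$ the singular series is $\mathfrak{S}(\mathcal{H})=\prod_p\left(1-\frac{|\mathcal{H}\bmod p|}{p}\right)\left(1-\frac1p\right)^{-|\mathcal{H}|}$, the product over all primes $p$, where $|\mathcal H\bmod p|$ is the number of residue classes mod $p$ occupied by $\mathcal H$. Let $\phi,\psi$ be positive real-valued functions. $\mathcal{A}\subset\mathbb{N}$ satisfies $\mathbf{HL}[\phi,\psi]$ if there is a constant $x_0$ such that for all $x\ge x_0$ and all finite sets of integers $\mathcal{H}\subset[0,\phi(x)]$ with $|\mathcal{H}|\le\psi(x)$ (with $x_0$ independent of $\mathcal{H}$), $$|\{n\le x: n+h\in\mathcal{A}\text{ for all }h\in\mathcal{H}\}|=\mathfrak{S}(\mathcal{H})\int_2^x\frac{dt}{\log^{|\mathcal{H}|}t}+E(x,\mathcal{H}),\qquad |E(x,\mathcal{H})|\le x e^{-\psi(x)\log_2 x}.$$ The implied constant in $\mathcal{O}$ is absolute; "sufficiently large" may depend on $\mathcal{A}$. *)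

theory Defs
  imports "HOL-Analysis.Analysis" "HOL-Computational_Algebra.Primes"
begin

text \<open>Clipped iterated logarithms. The library's convention \<open>ln 0 = 0\<close> agrees with
  \<open>max {0, log 0} = 0\<close>; in particular all \<open>log_iter k x\<close> with \<open>k \<ge> 1\<close> are nonnegative.\<close>

primrec log_iter :: "nat \<Rightarrow> real \<Rightarrow> real" where
  "log_iter 0 x = x"
| "log_iter (Suc k) x = max 0 (ln (log_iter k x))"

definition num_intervals :: "nat set \<Rightarrow> real \<Rightarrow> real \<Rightarrow> nat \<Rightarrow> nat" where
  "num_intervals A x y k =
     card {n :: nat. 1 \<le> n \<and> real n \<le> x \<and>
       card {a \<in> A. real n + 1 \<le> real a \<and> real a \<le> real n + y} = k}"

text \<open>The product over primes is written as a product over all naturals, in increasing order,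
  with factor 1 at the non-primes. \<^const>\<open>prodinf\<close> allows finitely many vanishing factors, so
  it is 0 for a set \<open>H\<close> that covers every residue class modulo some prime.\<close>

definition singular_series :: "int set \<Rightarrow> real" where
  "singular_series H =
     (\<Prod>p. if prime p
           then (1 - real (card ((\<lambda>h. h mod int p) ` H)) / real p)
                  * (1 - 1 / real p) powi (- int (card H))
           else 1)"

text \<open>Only the values of \<open>\<phi>\<close> and \<open>\<psi>\<close> at large arguments matter, so they are total functions here.\<close>

definition HL :: "(real \<Rightarrow> real) \<Rightarrow> (real \<Rightarrow> real) \<Rightarrow> nat set \<Rightarrow> bool" where
  "HL \<phi> \<psi> A \<longleftrightarrow>
     (\<exists>x0. \<forall>x\<ge>x0. \<forall>H :: int set.
        finite H \<longrightarrow> (\<forall>h\<in>H. 0 \<le> h \<and> real_of_int h \<le> \<phi> x) \<longrightarrow> real (card H) \<le> \<psi> x \<longrightarrow>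
        \<bar>real (card {n :: nat. 1 \<le> n \<and> real n \<le> x \<and> (\<forall>h\<in>H. int n + h \<in> int ` A)})
           - singular_series H * integral {2..x} (\<lambda>t. 1 / ln t ^ card H)\<bar>
        \<le> x * exp (- \<psi> x * log_iter 2 x))"

definition lambda_max :: "real \<Rightarrow> real" where
  "lambda_max x = exp (1 / sqrt 7 * sqrt (log_iter 2 x * log_iter 3 x))"

end

theory Submission
  imports Defs "HOL-Number_Theory.Cong" "HOL-Real_Asymp.Real_Asymp"
begin

text \<open>The singular series of \<open>H\<close> divided by \<open>ln t ^ card H\<close> is, up to a negligible factor, the
  probability that \<open>H\<close> survives when one random residue class is removed modulo every prime
  \<open>p \<le> z\<close>, where \<open>ln z\<close> is a small power of \<open>ln x\<close>, and the remaining integers are thinned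
  independently. By truncated inclusion-exclusion, applied both to the integers \<open>n \<le> x\<close> and to
  this random model, the proportion of \<open>n\<close> with exactly \<open>k\<close> elements of \<open>A\<close> in the interval
  agrees, up to an error smaller than any possible Poisson weight, with the average over
  \<open>t \<le> x\<close> of the probability that exactly \<open>k\<close> points remain in the model. Averaging the singular
  series directly could not give this, since an alternating sum of size \<open>exp (2 * l)\<close> would
  amplify the errors; the probabilistic form keeps everything positive.

  As the thinning keeps only a tiny proportion, the number of remaining points is nearly Poisson as soon as the
  size of the sieved set is concentrated. For primes up to \<open>w\<close> this holds for every choice of the
  residue classes, by Brun's pure sieve; for primes between \<open>w\<close> and \<open>z\<close> it follows from a bound for
  exponential moments.\<close>

subsection \<open>Truncated inclusion-exclusion\<close>

text \<open>With \<open>m\<close> steps the pure sieve has relative error about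
  \<open>m ^ (- m)\<close>, while \<open>w ^ m\<close> must stay below the window length. Balancing
  the two makes \<open>m\<close> of order \<open>sqrt (u / ln u)\<close>, where
  \<open>u = ln (ln x)\<close>, and puts both \<open>ln w\<close> and \<open>- ln \<delta>\<close>
  at the order \<open>sqrt (u * ln u)\<close>; this is the origin of the unusual ranges in the
  theorem. Suppose \<open>w = exp (a * h)\<close>, \<open>m = b * q * sqrt (u / ln u)\<close>,
  \<open>\<delta> = exp (- c * h)\<close> and \<open>T = exp (d * h)\<close>. The requirements
  \<open>a * b < 1\<close>, \<open>c < b / 2\<close>, \<open>d < c\<close> and
  \<open>d < a - 2 * c\<close> can be met if and only if \<open>d\<close> is below both
  \<open>a / 3\<close> and \<open>1 / (2 * a)\<close>. The best choice
  \<open>a = sqrt (3 / 2)\<close> would allow every \<open>d < 1 / sqrt 6\<close>, so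
  \<open>1 / sqrt 7\<close> leaves room for simple decimals. A variance bound for the size of the
  sieved set would not do. A Poisson weight can be as small as \<open>exp (- 2 * T)\<close>, and the
  exceptional choices of residue classes must be rarer than that; hence the exponential
  moments.\<close>

definition elem_sym :: "nat \<Rightarrow> ('a \<Rightarrow> real) \<Rightarrow> 'a set \<Rightarrow> real" where
  "elem_sym i f P = (\<Sum>D | D \<subseteq> P \<and> card D = i. \<Prod>p\<in>D. f p)"

lemma elem_sym_0:
  assumes "finite P"
  shows "elem_sym 0 f P = 1"
proof -
  have "{D. D \<subseteq> P \<and> card D = 0} = {{}}"
    using assms by (auto dest: finite_subset)
  then show ?thesis by (simp add: elem_sym_def)
qed

lemma elem_sym_empty_Suc: "elem_sym (Suc i) f {} = 0"
proof -
  have "{D :: 'a set. D \<subseteq> {} \<and> card D = Suc i} = {}" by auto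
  then show ?thesis unfolding elem_sym_def by (metis sum.empty)
qed

lemma elem_sym_insert_Suc:
  assumes "finite P" "q \<notin> P"
  shows "elem_sym (Suc i) f (insert q P) = elem_sym (Suc i) f P + f q * elem_sym i f P"
proof -
  let ?A = "{D. D \<subseteq> P \<and> card D = Suc i}" and ?B = "insert q ` {D. D \<subseteq> P \<and> card D = i}"
  have split: "{D. D \<subseteq> insert q P \<and> card D = Suc i} = ?A \<union> ?B"
  proof (intro subset_antisym subsetI)
    fix D assume D: "D \<in> {D. D \<subseteq> insert q P \<and> card D = Suc i}"
    show "D \<in> ?A \<union> ?B"
    proof (cases "q \<in> D")
      case True
      then have "D = insert q (D - {q})" "D - {q} \<subseteq> P" "card (D - {q}) = i"
        using D by (auto simp: card_Diff_singleton)
      then show ?thesis by blast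
    next
      case False
      then show ?thesis using D by auto
    qed
  next
    fix D assume "D \<in> ?A \<union> ?B"
    then show "D \<in> {D. D \<subseteq> insert q P \<and> card D = Suc i}"
      using assms by (auto dest: finite_subset intro!: card_insert_disjoint)
  qed
  have disj: "?A \<inter> ?B = {}" using assms(2) by auto
  have inj: "inj_on (insert q) {D. D \<subseteq> P \<and> card D = i}"
    using assms(2) by (auto intro!: inj_onI)
  have "elem_sym (Suc i) f (insert q P) = elem_sym (Suc i) f P + (\<Sum>D\<in>?B. prod f D)"
    unfolding elem_sym_def split using assms(1) disj by (subst sum.union_disjoint) auto
  also have "(\<Sum>D\<in>?B. prod f D) = (\<Sum>D | D \<subseteq> P \<and> card D = i. prod f (insert q D))"
    using inj by (simp add: sum.reindex)
  also have "\<dots> = (\<Sum>D | D \<subseteq> P \<and> card D = i. f q * prod f D)"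
    using assms by (intro sum.cong refl prod.insert) (auto dest: finite_subset)
  finally show ?thesis by (simp add: elem_sym_def sum_distrib_left)
qed

lemma elem_sym_const: "elem_sym i (\<lambda>_. c) P = real (card P choose i) * c ^ i" if "finite P"
  unfolding elem_sym_def using that by (simp add: n_subsets)

text \<open>Weights in [0, 1] replace indicators because the same bound serves events, reciprocals
  of primes and a constant thinning probability. Adding \<open>q\<close> turns the remainder
  \<open>r m\<close> into \<open>r m - f q * r (m - 1)\<close>, which matches the recursion of
  \<open>elem_sym\<close>. Only absolute values are tracked, so there is no case distinction by the
  parity of \<open>m\<close>.\<close>

lemma bonferroni_prod:
  assumes "finite P" "\<And>p. p \<in> P \<Longrightarrow> 0 \<le> f p \<and> f p \<le> 1"
  shows "\<bar>(\<Prod>p\<in>P. 1 - f p) - (\<Sum>i<m. (-1) ^ i * elem_sym i f P)\<bar> \<le> elem_sym m f P"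
  using assms
proof (induction P arbitrary: m rule: finite_induct)
  case empty
  show ?case
  proof (cases m)
    case 0
    then show ?thesis by (simp add: elem_sym_0)
  next
    case (Suc n)
    show ?thesis unfolding Suc by (subst sum.lessThan_Suc_shift) (simp add: elem_sym_0 elem_sym_empty_Suc)
  qed
next
  case (insert q P)
  show ?case
  proof (cases m)
    case 0
    have "(\<Prod>p\<in>insert q P. 1 - f p) \<le> 1" "(\<Prod>p\<in>insert q P. 1 - f p) \<ge> 0"
      by (rule prod_le_1; use insert.prems in force) (rule prod_nonneg; use insert.prems in force)
    then show ?thesis using 0 insert.hyps by (simp add: elem_sym_0)
  next
    case (Suc n)
    have IH: "\<bar>(\<Prod>p\<in>P. 1 - f p) - (\<Sum>i<m. (-1) ^ i * elem_sym i f P)\<bar> \<le> elem_sym m f P" for m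
      using insert by auto
    let ?r = "\<lambda>m. (\<Prod>p\<in>P. 1 - f p) - (\<Sum>i<m. (-1) ^ i * elem_sym i f P)"
    have "(\<Sum>i<Suc n. (-1) ^ i * elem_sym i f (insert q P))
        = 1 + (\<Sum>i<n. (-1) ^ Suc i * elem_sym (Suc i) f (insert q P))"
      using insert.hyps by (subst sum.lessThan_Suc_shift) (simp add: elem_sym_0)
    also have "\<dots> = 1 + (\<Sum>i<n. (-1) ^ Suc i * elem_sym (Suc i) f P)
        - f q * (\<Sum>i<n. (-1) ^ i * elem_sym i f P)"
      using insert.hyps by (simp add: elem_sym_insert_Suc sum_distrib_left sum_subtractf
          sum_negf sum.distrib algebra_simps)
    also have "1 + (\<Sum>i<n. (-1) ^ Suc i * elem_sym (Suc i) f P) = (\<Sum>i<Suc n. (-1) ^ i * elem_sym i f P)"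
      using insert.hyps by (simp only: sum.lessThan_Suc_shift elem_sym_0) simp
    finally have "(\<Prod>p\<in>insert q P. 1 - f p) - (\<Sum>i<m. (-1) ^ i * elem_sym i f (insert q P))
        = ?r (Suc n) - f q * ?r n"
      using insert.hyps Suc by (simp add: algebra_simps)
    moreover have "\<bar>a - c * b\<bar> \<le> a' + c * b'" if "\<bar>a\<bar> \<le> a'" "\<bar>b\<bar> \<le> b'" "0 \<le> c" for a b c a' b' :: real
    proof -
      have "\<bar>c * b\<bar> \<le> c * b'" using that by (simp add: abs_mult mult_left_mono)
      then show ?thesis using that by linarith
    qed
    from this[OF IH IH, of "f q" "Suc n" n]
    have "\<bar>?r (Suc n) - f q * ?r n\<bar> \<le> elem_sym (Suc n) f P + f q * elem_sym n f P"
      using insert.prems by auto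
    ultimately show ?thesis using insert.hyps Suc by (simp add: elem_sym_insert_Suc)
  qed
qed

text \<open>Expanding the power counts each product over \<open>i\<close> distinct elements
  \<open>fact i\<close> times. The induction keeps just the two binomial terms that match the
  recursion of \<open>elem_sym\<close>.\<close>

lemma elem_sym_le:
  assumes "finite P" "\<And>p. p \<in> P \<Longrightarrow> f p \<ge> 0"
  shows "elem_sym i f P \<le> (\<Sum>p\<in>P. f p) ^ i / fact i"
  using assms
proof (induction P arbitrary: i rule: finite_induct)
  case empty
  then show ?case by (cases i) (simp_all add: elem_sym_0 elem_sym_empty_Suc)
next
  case (insert q P)
  show ?case
  proof (cases i)
    case 0
    then show ?thesis using insert.hyps by (simp add: elem_sym_0)
  next
    case (Suc n)
    let ?S = "\<Sum>p\<in>P. f p"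
    have S: "?S \<ge> 0" using insert.prems by (intro sum_nonneg) auto
    have q: "f q \<ge> 0" using insert.prems by auto
    have bern: "?S ^ Suc n + real (Suc n) * f q * ?S ^ n \<le> (?S + f q) ^ Suc n"
    proof -
      have "(?S + f q) ^ Suc n = (\<Sum>k\<le>Suc n. real (Suc n choose k) * ?S ^ k * f q ^ (Suc n - k))"
        by (rule binomial_ring)
      also have "\<dots> \<ge> (\<Sum>k\<in>{n, Suc n}. real (Suc n choose k) * ?S ^ k * f q ^ (Suc n - k))"
        using S q by (intro sum_mono2) auto
      finally show ?thesis by (simp add: algebra_simps Suc_diff_le)
    qed
    have "elem_sym (Suc n) f (insert q P) = elem_sym (Suc n) f P + f q * elem_sym n f P"
      using insert.hyps by (rule elem_sym_insert_Suc)
    also have "\<dots> \<le> ?S ^ Suc n / fact (Suc n) + f q * (?S ^ n / fact n)"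
      using insert.IH insert.prems q by (intro add_mono mult_left_mono) (simp_all del: power_Suc fact_Suc)
    also have "\<dots> = (?S ^ Suc n + real (Suc n) * f q * ?S ^ n) / fact (Suc n)"
    proof -
      have "a / (N * F) + f q * (c / F) = (a + N * f q * c) / (N * F)"
        if "N > 0" "F > 0" for a c N F :: real
        using that by (simp add: divide_simps)
      from this[of "real (Suc n)" "fact n"] show ?thesis by (simp only: fact_Suc of_nat_fact of_nat_mult) simp
    qed
    also have "\<dots> \<le> (?S + f q) ^ Suc n / fact (Suc n)"
      using bern by (intro divide_right_mono) auto
    finally show ?thesis using insert.hyps Suc by (simp add: add.commute)
  qed
qed

text \<open>The identity \<open>(j choose k) * (X choose j) = (X choose k) * ((X - k) choose (j -
  k))\<close> reduces this to \<open>bonferroni_prod\<close> for \<open>X - k\<close> equal weights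
  \<open>r\<close>. It is used with \<open>r = 1\<close> for the integers up to \<open>x\<close> and
  with small \<open>r\<close> for the random model, so that both get the same coefficients.\<close>

lemma bonferroni_thinned:
  assumes "0 \<le> r" "r \<le> 1" "k \<le> K"
  shows "\<bar>real (X choose k) * r ^ k * (1 - r) ^ (X - k)
      - (\<Sum>j=k..<K. (-1) ^ (j - k) * real (j choose k) * real (X choose j) * r ^ j)\<bar>
    \<le> real (K choose k) * real (X choose K) * r ^ K"
proof (cases "k \<le> X")
  case False
  then show ?thesis using assms by (simp add: binomial_eq_0)
next
  case True
  have choose: "real (j choose k) * real (X choose j) = real (X choose k) * real ((X - k) choose (j - k))"
    if "k \<le> j" for j
  proof (cases "j \<le> X")
    case True
    then show ?thesis using choose_mult[OF that True] by (metis of_nat_mult mult.commute)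
  next
    case False
    then have "X choose j = 0" "(X - k) choose (j - k) = 0"
      using that False \<open>k \<le> X\<close> by (auto intro!: binomial_eq_0)
    then show ?thesis by (metis mult_zero_right of_nat_0)
  qed
  let ?c = "real (X choose k) * r ^ k"
  have c: "?c \<ge> 0" using assms by simp
  have "\<bar>(1 - r) ^ (X - k) - (\<Sum>i<K - k. (-1) ^ i * (real ((X - k) choose i) * r ^ i))\<bar>
      \<le> real ((X - k) choose (K - k)) * r ^ (K - k)"
    using bonferroni_prod[of "{..<X - k}" "\<lambda>_. r" "K - k"] assms
    by (simp add: elem_sym_const)
  then have "?c * \<bar>(1 - r) ^ (X - k) - (\<Sum>i<K - k. (-1) ^ i * (real ((X - k) choose i) * r ^ i))\<bar>
      \<le> ?c * (real ((X - k) choose (K - k)) * r ^ (K - k))"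
    using c by (rule mult_left_mono)
  also have "\<dots> = real (X choose k) * real ((X - k) choose (K - k)) * r ^ K"
    using assms(3) by (simp add: algebra_simps flip: power_add)
  also have "\<dots> = real (K choose k) * real (X choose K) * r ^ K"
    using choose[OF assms(3)] by simp
  also have "?c * \<bar>(1 - r) ^ (X - k) - (\<Sum>i<K - k. (-1) ^ i * (real ((X - k) choose i) * r ^ i))\<bar>
      = \<bar>?c * (1 - r) ^ (X - k)
        - (\<Sum>i<K - k. (-1) ^ i * (?c * real ((X - k) choose i) * r ^ i))\<bar>"
  proof -
    have *: "c * \<bar>a - (\<Sum>i<n. (-1) ^ i * (g i * r ^ i))\<bar> = \<bar>c * a - (\<Sum>i<n. (-1) ^ i * (c * g i * r ^ i))\<bar>"
      if "c \<ge> 0" for c a n and g :: "nat \<Rightarrow> real"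
    proof -
      have "c * a - (\<Sum>i<n. (-1) ^ i * (c * g i * r ^ i)) = c * (a - (\<Sum>i<n. (-1) ^ i * (g i * r ^ i)))"
        by (simp add: right_diff_distrib sum_distrib_left mult_ac)
      then show ?thesis using that by (simp add: abs_mult)
    qed
    show ?thesis by (rule *[OF c])
  qed
  also have "(\<Sum>i<K - k. (-1) ^ i * (?c * real ((X - k) choose i) * r ^ i))
      = (\<Sum>j=k..<K. (-1) ^ (j - k) * real (j choose k) * real (X choose j) * r ^ j)"
  proof (rule sum.reindex_bij_witness[of _ "\<lambda>j. j - k" "\<lambda>i. i + k"])
    fix i assume "i \<in> {..<K - k}"
    have "real ((i + k) choose k) * real (X choose (i + k)) = real (X choose k) * real ((X - k) choose i)"
      using choose[of "i + k"] by simp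
    then have "(-1) ^ i * (real ((i + k) choose k) * real (X choose (i + k))) * r ^ (i + k)
        = (-1) ^ i * (real (X choose k) * real ((X - k) choose i)) * r ^ (i + k)" by simp
    then show "(-1) ^ (i + k - k) * real ((i + k) choose k) * real (X choose (i + k)) * r ^ (i + k)
        = (-1) ^ i * (?c * real ((X - k) choose i) * r ^ i)"
      by (simp add: power_add mult_ac)
  qed auto
  finally show ?thesis .
qed

subsection \<open>Sieving by random residue classes\<close>

text \<open>The expectation of \<open>f\<close> over the random set left after deleting from \<open>R\<close> one uniformly
  distributed residue class modulo each entry of the list, independently; the recursion replaces
  a product probability space.\<close>

fun sieve_avg :: "nat list \<Rightarrow> (nat set \<Rightarrow> real) \<Rightarrow> nat set \<Rightarrow> real" where
  "sieve_avg [] f R = f R"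
| "sieve_avg (p # ps) f R = (\<Sum>a<p. sieve_avg ps f {h \<in> R. h mod p \<noteq> a}) / real p"

lemma sieve_avg_append: "sieve_avg (ps @ qs) f R = sieve_avg ps (sieve_avg qs f) R"
  by (induction ps arbitrary: R) auto

lemma sieve_avg_mono:
  assumes "\<And>S. S \<subseteq> R \<Longrightarrow> f S \<le> g S"
  shows "sieve_avg ps f R \<le> sieve_avg ps g R"
  using assms
proof (induction ps arbitrary: R)
  case (Cons p ps)
  then show ?case by (auto intro!: divide_right_mono sum_mono Cons.IH)
qed auto

lemma sieve_avg_cong:
  assumes "\<And>S. S \<subseteq> R \<Longrightarrow> f S = g S"
  shows "sieve_avg ps f R = sieve_avg ps g R"
  by (intro antisym sieve_avg_mono) (auto simp: assms)

lemma sieve_avg_const: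
  assumes "\<And>p. p \<in> set ps \<Longrightarrow> p > 0"
  shows "sieve_avg ps (\<lambda>_. c) R = c"
  using assms by (induction ps arbitrary: R) auto

lemma sieve_avg_add: "sieve_avg ps (\<lambda>S. f S + g S) R = sieve_avg ps f R + sieve_avg ps g R"
  by (induction ps arbitrary: R) (auto simp: sum.distrib add_divide_distrib)

lemma sieve_avg_cmult: "sieve_avg ps (\<lambda>S. c * f S) R = c * sieve_avg ps f R"
  by (induction ps arbitrary: R) (auto simp: sum_distrib_left)

lemma sieve_avg_diff: "sieve_avg ps (\<lambda>S. f S - g S) R = sieve_avg ps f R - sieve_avg ps g R"
  using sieve_avg_add[of ps f "\<lambda>S. (-1) * g S" R] by (simp only: sieve_avg_cmult) simp

lemma sieve_avg_sum: "sieve_avg ps (\<lambda>S. \<Sum>i\<in>I. f i S) R = (\<Sum>i\<in>I. sieve_avg ps (f i) R)"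
  by (induction ps arbitrary: R) (auto simp: sum_divide_distrib intro: sum.swap)

lemma sieve_avg_abs: "\<bar>sieve_avg ps f R\<bar> \<le> sieve_avg ps (\<lambda>S. \<bar>f S\<bar>) R"
proof -
  have "sieve_avg ps f R \<le> sieve_avg ps (\<lambda>S. \<bar>f S\<bar>) R"
    by (rule sieve_avg_mono) auto
  moreover have "sieve_avg ps (\<lambda>S. (-1) * f S) R \<le> sieve_avg ps (\<lambda>S. \<bar>f S\<bar>) R"
    by (rule sieve_avg_mono) auto
  ultimately show ?thesis unfolding sieve_avg_cmult by linarith
qed

text \<open>Distinctness lets a choice of classes be a function of the modulus. This is how a bound
  valid for every choice, such as the pure sieve gives for the small primes, enters the
  average.\<close>

lemma sieve_avg_le_of_all_choices:
  assumes "distinct ps" "\<And>p. p \<in> set ps \<Longrightarrow> p > 0"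
    and "\<And>a. (\<And>p. p \<in> set ps \<Longrightarrow> a p < p) \<Longrightarrow> f {h \<in> R. \<forall>p\<in>set ps. h mod p \<noteq> a p} \<le> c"
  shows "sieve_avg ps f R \<le> c"
  using assms
proof (induction ps arbitrary: R)
  case Nil
  then show ?case by simp
next
  case (Cons p ps)
  have "sieve_avg ps f {h \<in> R. h mod p \<noteq> b} \<le> c" if "b < p" for b
  proof (rule Cons.IH)
    fix a assume a: "\<And>q. q \<in> set ps \<Longrightarrow> a q < q"
    have eq: "{h \<in> {h \<in> R. h mod p \<noteq> b}. \<forall>p\<in>set ps. h mod p \<noteq> a p}
      = {h \<in> R. \<forall>q\<in>set (p # ps). h mod q \<noteq> (a(p := b)) q}"
      using Cons.prems(1) by auto
    show "f {h \<in> {h \<in> R. h mod p \<noteq> b}. \<forall>p\<in>set ps. h mod p \<noteq> a p} \<le> c"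
      unfolding eq by (rule Cons.prems(3)) (use a that in auto)
  qed (use Cons.prems in auto)
  then have "(\<Sum>b<p. sieve_avg ps f {h \<in> R. h mod p \<noteq> b}) \<le> real p * c"
    using sum_bounded_above[of "{..<p}" "\<lambda>b. sieve_avg ps f {h \<in> R. h mod p \<noteq> b}" c] by simp
  then show ?case using Cons.prems(2)[of p] by (simp add: divide_simps mult.commute)
qed

text \<open>\<open>H\<close> survives the step at \<open>p\<close> exactly when the deleted class
  avoids its residues. The resulting factors are those of the singular series before
  normalisation.\<close>

lemma sieve_avg_superset:
  assumes "finite H" "\<And>p. p \<in> set ps \<Longrightarrow> p > 0"
  shows "sieve_avg ps (\<lambda>S. of_bool (H \<subseteq> S)) R
    = of_bool (H \<subseteq> R) * (\<Prod>p\<leftarrow>ps. 1 - real (card ((\<lambda>h. h mod p) ` H)) / real p)"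
  using assms
proof (induction ps arbitrary: R)
  case Nil
  then show ?case by simp
next
  case (Cons p ps)
  let ?P = "\<Prod>p\<leftarrow>ps. 1 - real (card ((\<lambda>h. h mod p) ` H)) / real p"
  have p: "p > 0" using Cons.prems by simp
  have sub: "(\<lambda>h. h mod p) ` H \<subseteq> {..<p}" using p by auto
  have "(\<Sum>a<p. sieve_avg ps (\<lambda>S. of_bool (H \<subseteq> S)) {h \<in> R. h mod p \<noteq> a})
      = (\<Sum>a<p. of_bool (H \<subseteq> R) * ?P * of_bool (a \<notin> (\<lambda>h. h mod p) ` H))"
  proof (intro sum.cong refl)
    fix a
    have "H \<subseteq> {h \<in> R. h mod p \<noteq> a} \<longleftrightarrow> H \<subseteq> R \<and> a \<notin> (\<lambda>h. h mod p) ` H" by blast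
    moreover have "sieve_avg ps (\<lambda>S. of_bool (H \<subseteq> S)) {h \<in> R. h mod p \<noteq> a}
        = of_bool (H \<subseteq> {h \<in> R. h mod p \<noteq> a}) * ?P"
      using Cons.prems by (intro Cons.IH) auto
    ultimately show "sieve_avg ps (\<lambda>S. of_bool (H \<subseteq> S)) {h \<in> R. h mod p \<noteq> a}
        = of_bool (H \<subseteq> R) * ?P * of_bool (a \<notin> (\<lambda>h. h mod p) ` H)"
      by (simp only: of_bool_conj mult_ac)
  qed
  also have "\<dots> = of_bool (H \<subseteq> R) * ?P * real (card ({..<p} - (\<lambda>h. h mod p) ` H))"
    by (subst sum_distrib_left[symmetric]) (simp add: of_bool_def sum.If_cases set_diff_eq Int_def)
  also have "real (card ({..<p} - (\<lambda>h. h mod p) ` H)) = real p - real (card ((\<lambda>h. h mod p) ` H))"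
    using sub card_mono[OF _ sub] Cons.prems(1) by (subst card_Diff_subset) (auto simp: of_nat_diff)
  finally show ?case using p by (simp add: field_simps)
qed

lemma choose_card_eq_sum_subsets:
  assumes "finite R" "S \<subseteq> R"
  shows "real (card S choose j) = (\<Sum>H | H \<subseteq> R \<and> card H = j. of_bool (H \<subseteq> S))"
proof -
  have "(\<Sum>H | H \<subseteq> R \<and> card H = j. of_bool (H \<subseteq> S)) = real (card {H. H \<subseteq> S \<and> card H = j})"
  proof -
    have "{H. H \<subseteq> R \<and> card H = j} \<inter> {H. H \<subseteq> S} = {H. H \<subseteq> S \<and> card H = j}"
      using assms(2) by auto
    then show ?thesis using assms(1) by (simp add: of_bool_def sum.If_cases)
  qed
  then show ?thesis using assms by (simp add: n_subsets finite_subset)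
qed

text \<open>These binomial moments are all that truncated inclusion-exclusion sees of the random
  set.\<close>

lemma sieve_avg_choose:
  assumes "finite R" "\<And>p. p \<in> set ps \<Longrightarrow> p > 0"
  shows "sieve_avg ps (\<lambda>S. real (card S choose j)) R
    = (\<Sum>H | H \<subseteq> R \<and> card H = j. \<Prod>p\<leftarrow>ps. 1 - real (card ((\<lambda>h. h mod p) ` H)) / real p)"
proof -
  have "sieve_avg ps (\<lambda>S. real (card S choose j)) R
      = sieve_avg ps (\<lambda>S. \<Sum>H | H \<subseteq> R \<and> card H = j. of_bool (H \<subseteq> S)) R"
    using assms(1) by (intro sieve_avg_cong choose_card_eq_sum_subsets)
  also have "\<dots> = (\<Sum>H | H \<subseteq> R \<and> card H = j. \<Prod>p\<leftarrow>ps. 1 - real (card ((\<lambda>h. h mod p) ` H)) / real p)"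
    unfolding sieve_avg_sum
  proof (intro sum.cong refl)
    fix H assume "H \<in> {H. H \<subseteq> R \<and> card H = j}"
    then show "sieve_avg ps (\<lambda>S. of_bool (H \<subseteq> S)) R
        = (\<Prod>p\<leftarrow>ps. 1 - real (card ((\<lambda>h. h mod p) ` H)) / real p)"
      using assms by (subst sieve_avg_superset) (auto dest: finite_subset)
  qed
  finally show ?thesis .
qed

subsection \<open>Exponential moments and Brun's pure sieve\<close>

lemma card_residue_class_le:
  assumes "p > 0"
  shows "card {h \<in> {1..M}. h mod p = a} \<le> M div p + 1"
proof -
  have "card {h \<in> {1..M}. h mod p = a} \<le> card {0..M div p}"
  proof (rule card_inj_on_le)
    show "inj_on (\<lambda>h. h div p) {h \<in> {1..M}. h mod p = a}"
    proof (rule inj_onI)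
      fix x y assume "x \<in> {h \<in> {1..M}. h mod p = a}" "y \<in> {h \<in> {1..M}. h mod p = a}" "x div p = y div p"
      then show "x = y" using div_mult_mod_eq[of x p] div_mult_mod_eq[of y p] by simp
    qed
  qed (auto intro: div_le_mono)
  then show ?thesis by simp
qed

lemma card_residue_class_ge:
  assumes "a < p"
  shows "M div p \<le> card {h \<in> {1..M}. h mod p = a}"
proof -
  let ?q = "M div p"
  \<comment> \<open>The window starts at 1, so class 0 is represented by \<open>p\<close>,
    \<open>2 * p\<close> and so on, and not by 0.\<close>
  define f where "f i = (if a = 0 then (i + 1) * p else a + i * p)" for i
  have "card {..<?q} \<le> card {h \<in> {1..M}. h mod p = a}"
  proof (rule card_inj_on_le)
    show "inj_on f {..<?q}" using assms by (auto simp: inj_on_def f_def split: if_splits)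
    show "f ` {..<?q} \<subseteq> {h \<in> {1..M}. h mod p = a}"
    proof safe
      fix i assume "i < ?q"
      then have "(i + 1) * p \<le> ?q * p" by (intro mult_right_mono) auto
      also have "\<dots> \<le> M" by simp
      finally have "(i + 1) * p \<le> M" .
      then show "f i \<in> {1..M}" "f i mod p = a" using assms by (auto simp: f_def)
    qed
  qed auto
  then show ?thesis by simp
qed

lemma exp_le_quadratic:
  fixes x :: real
  assumes "\<bar>x\<bar> \<le> 1"
  shows "exp x \<le> 1 + x + x\<^sup>2"
proof (cases "x \<ge> 0")
  case True
  then show ?thesis using assms exp_bound by simp
next
  case False
  define y where "y = - x"
  have y: "0 \<le> y" "y \<le> 1" using False assms by (auto simp: y_def)
  have "1 \<le> 1 + (y\<^sup>2 + y ^ 3 + y ^ 4) / 2" using y by simp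
  also have "\<dots> = (1 - y + y\<^sup>2) * (1 + y + y\<^sup>2 / 2)" by (simp add: field_simps power2_eq_square power3_eq_cube power4_eq_xxxx)
  also have "\<dots> \<le> (1 - y + y\<^sup>2) * exp y"
    using y exp_lower_Taylor_quadratic[of y] by (intro mult_left_mono) auto
  finally have "exp (- y) \<le> 1 - y + y\<^sup>2" by (simp add: exp_minus field_simps)
  then show ?thesis by (simp add: y_def)
qed

text \<open>Deleting class \<open>a\<close> modulo \<open>p\<close> costs \<open>N a\<close> points.
  The \<open>N a\<close> add up to \<open>card R\<close> and none exceeds \<open>M / p + 1\<close>,
  so averaging the quadratic bound for \<open>exp (- t * N a)\<close> gives the expected loss plus a
  variance term linear in \<open>card R\<close>. In the latter \<open>card R\<close> is replaced by
  \<open>M\<close>, which makes it independent of the classes deleted before.\<close>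

lemma sieve_avg_exp_le:
  assumes "\<And>p. p \<in> set ps \<Longrightarrow> p \<ge> 2" "R \<subseteq> {1..M}"
    and "\<And>p. p \<in> set ps \<Longrightarrow> \<bar>s\<bar> * (real M / real p + 1) \<le> 1"
  shows "sieve_avg ps (\<lambda>S. exp (s * real (card S))) R
    \<le> exp (s * (\<Prod>p\<leftarrow>ps. 1 - 1 / real p) * real (card R)
          + s\<^sup>2 * (\<Sum>p\<leftarrow>ps. (real M / real p + 1) * (real M / real p)))"
  using assms
proof (induction ps arbitrary: R)
  case Nil
  then show ?case by simp
next
  case (Cons p ps)
  define D where "D = (\<Prod>p\<leftarrow>ps. 1 - 1 / real p)"
  define V where "V = s\<^sup>2 * (\<Sum>p\<leftarrow>ps. (real M / real p + 1) * (real M / real p))"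
  define B where "B = real M / real p + 1"
  \<comment> \<open>By the induction hypothesis the later moduli turn the slope \<open>s\<close>
    into \<open>s * D\<close>; this is the slope that the step at \<open>p\<close> sees.\<close>
  define t where "t = s * D"
  define N where "N a = card {h \<in> R. h mod p = a}" for a
  have p: "p \<ge> 2" using Cons.prems by simp
  have finR: "finite R" using Cons.prems(2) finite_subset by blast
  have D: "0 \<le> D" "D \<le> 1"
  proof -
    have "\<And>p. p \<in> set ps \<Longrightarrow> p \<ge> 2" using Cons.prems by simp
    then have "0 \<le> D \<and> D \<le> 1" unfolding D_def
    proof (induction ps)
      case (Cons q qs)
      then have "q \<ge> 2" by simp
      then have "0 \<le> 1 - 1 / real q" "1 - 1 / real q \<le> 1" by auto
      then show ?case using Cons by (auto intro!: mult_le_one mult_nonneg_nonneg)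
    qed auto
    then show "0 \<le> D" "D \<le> 1" by auto
  qed
  have B: "B \<ge> 0" by (simp add: B_def)
  have ts: "\<bar>t\<bar> \<le> \<bar>s\<bar>" using D by (simp add: t_def abs_mult mult_left_le)
  have tB: "\<bar>t\<bar> * B \<le> 1"
  proof -
    have "\<bar>t\<bar> * B \<le> \<bar>s\<bar> * B" using ts B by (rule mult_right_mono)
    then show ?thesis using Cons.prems(3)[of p] by (simp add: B_def)
  qed
  have NB: "real (N a) \<le> B" for a
  proof -
    have "N a \<le> card {h \<in> {1..M}. h mod p = a}"
      unfolding N_def using Cons.prems(2) by (intro card_mono) auto
    also have "\<dots> \<le> M div p + 1" using p by (intro card_residue_class_le) auto
    finally have "real (N a) \<le> real (M div p) + 1" by linarith
    also have "real (M div p) \<le> real M / real p" by (rule of_nat_div_le_of_nat)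
    finally show ?thesis by (simp add: B_def)
  qed
  have card_removed: "real (card {h \<in> R. h mod p \<noteq> a}) = real (card R) - real (N a)" for a
  proof -
    have "{h \<in> R. h mod p \<noteq> a} = R - {h \<in> R. h mod p = a}" by auto
    then show ?thesis unfolding N_def using finR
      by (simp add: card_Diff_subset of_nat_diff card_mono)
  qed
  have sumN: "(\<Sum>a<p. real (N a)) = real (card R)"
  proof -
    have "(\<Sum>a<p. N a) = card (\<Union>a<p. {h \<in> R. h mod p = a})"
      unfolding N_def using finR by (subst card_UN_disjoint) auto
    also have "(\<Union>a<p. {h \<in> R. h mod p = a}) = R" using p by auto
    finally show ?thesis by (metis of_nat_sum)
  qed
  have "exp (- t * real (N a)) \<le> 1 - t * real (N a) + t\<^sup>2 * B * real (N a)" for a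
  proof -
    have "\<bar>- t * real (N a)\<bar> \<le> \<bar>t\<bar> * B" using NB by (simp add: abs_mult mult_left_mono)
    then have "exp (- t * real (N a)) \<le> 1 + - t * real (N a) + (- t * real (N a))\<^sup>2"
      using tB by (intro exp_le_quadratic) linarith
    also have "(- t * real (N a))\<^sup>2 = t\<^sup>2 * (real (N a) * real (N a))"
      by (simp add: power2_eq_square)
    also have "\<dots> \<le> t\<^sup>2 * (B * real (N a))" using NB by (intro mult_left_mono mult_right_mono) auto
    finally show ?thesis by (simp add: mult_ac)
  qed
  then have "(\<Sum>a<p. exp (- t * real (N a))) \<le> (\<Sum>a<p. 1 - t * real (N a) + t\<^sup>2 * B * real (N a))"
    by (rule sum_mono)
  also have "\<dots> = real p - t * real (card R) + t\<^sup>2 * B * real (card R)"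
    by (simp add: sum.distrib sum_subtractf sum_distrib_left[symmetric] sumN)
  finally have "(\<Sum>a<p. exp (- t * real (N a))) / real p
      \<le> (real p - t * real (card R) + t\<^sup>2 * B * real (card R)) / real p"
    by (rule divide_right_mono) simp
  also have "\<dots> = 1 + (- t * real (card R) / real p + t\<^sup>2 * B * (real (card R) / real p))"
    using p by (simp add: field_simps)
  also have "\<dots> \<le> exp (- t * real (card R) / real p + t\<^sup>2 * B * (real (card R) / real p))"
    by (rule exp_ge_add_one_self)
  also have "\<dots> \<le> exp (- t * real (card R) / real p + s\<^sup>2 * B * (real M / real p))"
  proof -
    have "card R \<le> M" using card_mono[OF _ Cons.prems(2)] by simp
    moreover have "t\<^sup>2 \<le> s\<^sup>2" using ts by (simp add: abs_le_square_iff)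
    ultimately show ?thesis using B by (intro exp_le_cancel_iff[THEN iffD2] add_left_mono mult_mono divide_right_mono) auto
  qed
  finally have avg: "(\<Sum>a<p. exp (- t * real (N a))) / real p
      \<le> exp (- t * real (card R) / real p + s\<^sup>2 * B * (real M / real p))" .
  have "sieve_avg (p # ps) (\<lambda>S. exp (s * real (card S))) R
      \<le> (\<Sum>a<p. exp (t * real (card {h \<in> R. h mod p \<noteq> a}) + V)) / real p"
    unfolding sieve_avg.simps t_def D_def V_def using Cons.prems
    by (intro divide_right_mono sum_mono Cons.IH) auto
  also have "\<dots> = exp (t * real (card R) + V) * ((\<Sum>a<p. exp (- t * real (N a))) / real p)"
    by (simp add: card_removed sum_distrib_left sum_divide_distrib exp_add[symmetric] algebra_simps)
  also have "\<dots> \<le> exp (t * real (card R) + V) * exp (- t * real (card R) / real p + s\<^sup>2 * B * (real M / real p))"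
    by (intro mult_left_mono avg) auto
  also have "\<dots> = exp (s * ((1 - 1 / real p) * D) * real (card R) + (s\<^sup>2 * (B * (real M / real p)) + V))"
    by (simp add: exp_add[symmetric] t_def algebra_simps)
  finally show ?case
    by (simp add: D_def V_def B_def distrib_left)
qed

section \<open>Brun's pure sieve for a fixed choice of residue classes\<close>

lemma chinese_remainder_primes:
  assumes "finite D" "\<And>p. p \<in> D \<Longrightarrow> prime p" "\<And>p. p \<in> D \<Longrightarrow> a p < p"
  shows "\<exists>c<(\<Prod>p\<in>D. p). \<forall>h::nat. (\<forall>p\<in>D. h mod p = a p) \<longleftrightarrow> h mod (\<Prod>p\<in>D. p) = c"
  using assms
proof (induction D rule: finite_induct)
  case empty
  then show ?case by auto
next
  case (insert q D)
  let ?d = "\<Prod>p\<in>D. p"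
  from insert obtain c where c: "c < ?d" "\<And>h::nat. (\<forall>p\<in>D. h mod p = a p) \<longleftrightarrow> h mod ?d = c"
    by auto
  have cop: "coprime q ?d"
    using insert by (intro prod_coprime_right) (auto intro!: primes_coprime)
  obtain x where x: "[x = a q] (mod q)" "[x = c] (mod ?d)"
    using binary_chinese_remainder_nat[OF cop] by blast
  have "(h mod q = a q \<and> h mod ?d = c) \<longleftrightarrow> h mod (q * ?d) = x mod (q * ?d)" for h
  proof -
    have "h mod q = a q \<longleftrightarrow> [h = x] (mod q)" using x(1) insert.prems(2)[of q]
      by (simp add: cong_def)
    moreover have "h mod ?d = c \<longleftrightarrow> [h = x] (mod ?d)" using x(2) c(1) by (simp add: cong_def)
    moreover have "[h = x] (mod q) \<and> [h = x] (mod ?d) \<longleftrightarrow> [h = x] (mod (q * ?d))"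
      using cop coprime_cong_mult_nat[of h x q ?d] cong_modulus_mult_nat[of h x q ?d]
        cong_modulus_mult_nat[of h x ?d q] by (auto simp: mult.commute)
    ultimately show ?thesis by (simp add: cong_def)
  qed
  moreover have "x mod (q * ?d) < q * ?d"
    using insert.prems insert.hyps by (intro mod_less_divisor) (auto intro!: prod_pos dest: prime_gt_0_nat)
  ultimately show ?case using insert.hyps c(2) by auto
qed

lemma binomial_sum_le_power: "(\<Sum>i\<le>m. real (n choose i)) \<le> (real n + 1) ^ m"
proof -
  have "(\<Sum>i\<le>m. real (n choose i)) \<le> (\<Sum>i\<le>m. real (m choose i) * real n ^ i * 1 ^ (m - i))"
  proof (rule sum_mono)
    fix i assume "i \<in> {..m}"
    then have "1 \<le> m choose i" by (simp add: Suc_le_eq zero_less_binomial_iff)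
    then have "1 * real n ^ i \<le> real (m choose i) * real n ^ i"
      by (intro mult_right_mono) auto
    moreover have "real (n choose i) \<le> real n ^ i"
    proof (cases "i \<le> n")
      case True
      then have "n choose i \<le> n ^ i" by (rule binomial_le_pow)
      then show ?thesis by (metis of_nat_le_iff of_nat_power)
    qed (simp add: binomial_eq_0)
    ultimately show "real (n choose i) \<le> real (m choose i) * real n ^ i * 1 ^ (m - i)"
      unfolding power_one mult_1_right by linarith
  qed
  also have "\<dots> = (real n + 1) ^ m" by (rule binomial_ring[symmetric])
  finally show ?thesis .
qed

text \<open>Both the count and its main term are compared with the same truncated alternating sum,
  whence the factor 2.\<close>

lemma brun_pure_sieve:
  assumes "finite P" "\<And>p. p \<in> P \<Longrightarrow> prime p" "\<And>p. p \<in> P \<Longrightarrow> a p < p"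
  shows "\<bar>real (card {h \<in> {1..M}. \<forall>p\<in>P. h mod p \<noteq> a p}) - real M * (\<Prod>p\<in>P. 1 - 1 / real p)\<bar>
    \<le> 2 * real M * ((\<Sum>p\<in>P. 1 / real p) ^ m / fact m) + (real (card P) + 1) ^ m"
proof -
  define x where "x h p = (of_bool (h mod p = a p) :: real)" for h p
  let ?y = "\<lambda>p. 1 / real p"
  define E where "E i = (\<Sum>h=1..M. elem_sym i (x h) P)" for i
  have card_eq: "real (card {h \<in> {1..M}. \<forall>p\<in>P. h mod p \<noteq> a p}) = (\<Sum>h=1..M. \<Prod>p\<in>P. 1 - x h p)"
  proof -
    have "(\<Prod>p\<in>P. 1 - x h p) = of_bool (\<forall>p\<in>P. h mod p \<noteq> a p)" for h
      using assms(1) by (auto simp: x_def)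
    then show ?thesis by (simp add: of_bool_def sum.If_cases Int_def)
  qed
  \<comment> \<open>By the Chinese remainder theorem a set of \<open>i\<close> moduli prescribes a
    single class modulo its product, and \<open>real M\<close> divided by that product counts the
    class with error at most 1. The bound is therefore the number of such sets.\<close>
  have E: "\<bar>E i - real M * elem_sym i ?y P\<bar> \<le> real (card P choose i)" for i
  proof -
    have prodx: "(\<Prod>p\<in>D. x h p) = of_bool (\<forall>p\<in>D. h mod p = a p)" if "finite D" for h D
      using that by (induction D) (auto simp: x_def)
    have "E i = (\<Sum>D | D \<subseteq> P \<and> card D = i. \<Sum>h=1..M. \<Prod>p\<in>D. x h p)"
      unfolding E_def elem_sym_def by (rule sum.swap)
    also have "\<dots> - real M * elem_sym i ?y P
        = (\<Sum>D | D \<subseteq> P \<and> card D = i. (\<Sum>h=1..M. \<Prod>p\<in>D. x h p) - real M * prod ?y D)"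
      by (simp add: elem_sym_def sum_subtractf sum_distrib_left)
    also have "\<bar>\<dots>\<bar> \<le> (\<Sum>D | D \<subseteq> P \<and> card D = i. 1)"
    proof (rule order_trans[OF sum_abs], rule sum_mono)
      fix D assume D: "D \<in> {D. D \<subseteq> P \<and> card D = i}"
      then have finD: "finite D" using assms(1) finite_subset by blast
      let ?d = "\<Prod>p\<in>D. p"
      obtain c where c: "c < ?d" "\<And>h::nat. (\<forall>p\<in>D. h mod p = a p) \<longleftrightarrow> h mod ?d = c"
        using chinese_remainder_primes[of D a] finD D assms by blast
      have "(\<Sum>h=1..M. \<Prod>p\<in>D. x h p) = real (card {h \<in> {1..M}. h mod ?d = c})"
        using finD c(2) by (simp add: prodx of_bool_def sum.If_cases Int_def)
      moreover have "real M * prod ?y D = real M / real ?d"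
        by (simp add: prod_dividef)
      moreover have "real (M div ?d) \<le> real (card {h \<in> {1..M}. h mod ?d = c})"
        using card_residue_class_ge[OF c(1)] by simp
      moreover have "real (card {h \<in> {1..M}. h mod ?d = c}) \<le> real (M div ?d) + 1"
        using card_residue_class_le[of ?d M c] c(1) by linarith
      moreover have "real (M div ?d) \<le> real M / real ?d" by (rule of_nat_div_le_of_nat)
      moreover have "real M / real ?d \<le> real (M div ?d) + 1"
      proof -
        have "M \<le> (M div ?d + 1) * ?d"
        proof -
          have "M = M div ?d * ?d + M mod ?d" by (rule div_mult_mod_eq[symmetric])
          also have "\<dots> \<le> M div ?d * ?d + ?d"
            using c(1) by (intro add_left_mono less_imp_le mod_less_divisor) simp
          finally show ?thesis by simp
        qed
        then have "real M \<le> (real (M div ?d) + 1) * real ?d"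
          by (metis of_nat_1 of_nat_add of_nat_le_iff of_nat_mult)
        moreover have "0 < real ?d" using c(1) by (simp only: of_nat_0_less_iff)
        ultimately show ?thesis by (simp only: pos_divide_le_eq)
      qed
      ultimately show "\<bar>(\<Sum>h=1..M. \<Prod>p\<in>D. x h p) - real M * prod ?y D\<bar> \<le> 1" by linarith
    qed
    also have "\<dots> = real (card P choose i)" using assms(1) by (simp add: n_subsets)
    finally show ?thesis .
  qed
  have p2: "p \<ge> 2" if "p \<in> P" for p using assms(2)[OF that] prime_ge_2_nat by blast
  have "\<bar>(\<Sum>h=1..M. \<Prod>p\<in>P. 1 - x h p) - (\<Sum>i<m. (-1) ^ i * E i)\<bar> \<le> E m"
  proof -
    have "(\<Sum>i<m. (-1) ^ i * E i) = (\<Sum>h=1..M. \<Sum>i<m. (-1) ^ i * elem_sym i (x h) P)"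
      unfolding E_def sum_distrib_left by (rule sum.swap)
    then have "(\<Sum>h=1..M. \<Prod>p\<in>P. 1 - x h p) - (\<Sum>i<m. (-1) ^ i * E i)
        = (\<Sum>h=1..M. (\<Prod>p\<in>P. 1 - x h p) - (\<Sum>i<m. (-1) ^ i * elem_sym i (x h) P))"
      by (simp add: sum_subtractf)
    also have "\<bar>\<dots>\<bar> \<le> (\<Sum>h=1..M. elem_sym m (x h) P)"
      by (rule order_trans[OF sum_abs], rule sum_mono, rule bonferroni_prod)
        (use assms(1) in \<open>auto simp: x_def\<close>)
    finally show ?thesis by (simp add: E_def)
  qed
  moreover have "\<bar>(\<Sum>i<m. (-1) ^ i * E i) - real M * (\<Sum>i<m. (-1) ^ i * elem_sym i ?y P)\<bar>
      \<le> (\<Sum>i<m. real (card P choose i))"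
  proof -
    have "(\<Sum>i<m. (-1) ^ i * E i) - real M * (\<Sum>i<m. (-1) ^ i * elem_sym i ?y P)
        = (\<Sum>i<m. (-1) ^ i * (E i - real M * elem_sym i ?y P))"
      by (simp add: sum_subtractf sum_distrib_left algebra_simps)
    also have "\<bar>\<dots>\<bar> \<le> (\<Sum>i<m. real (card P choose i))"
      by (rule order_trans[OF sum_abs], rule sum_mono) (use E in \<open>simp add: abs_mult\<close>)
    finally show ?thesis .
  qed
  moreover have "\<bar>real M * (\<Sum>i<m. (-1) ^ i * elem_sym i ?y P) - real M * (\<Prod>p\<in>P. 1 - ?y p)\<bar>
      \<le> real M * elem_sym m ?y P"
  proof -
    have "\<bar>(\<Prod>p\<in>P. 1 - ?y p) - (\<Sum>i<m. (-1) ^ i * elem_sym i ?y P)\<bar> \<le> elem_sym m ?y P"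
      by (rule bonferroni_prod) (use assms(1) p2 in \<open>auto simp: divide_le_eq_1 dest: p2\<close>)
    then have "real M * \<bar>(\<Sum>i<m. (-1) ^ i * elem_sym i ?y P) - (\<Prod>p\<in>P. 1 - ?y p)\<bar>
        \<le> real M * elem_sym m ?y P"
      by (intro mult_left_mono) (auto simp: abs_minus_commute)
    then show ?thesis by (simp add: abs_mult right_diff_distrib[symmetric])
  qed
  moreover have "E m \<le> real M * elem_sym m ?y P + real (card P choose m)"
    using E[of m] by linarith
  moreover have "(\<Sum>i<m. real (card P choose i)) + real (card P choose m) \<le> (real (card P) + 1) ^ m"
    using binomial_sum_le_power[of "card P" m] by (simp add: lessThan_Suc_atMost[symmetric])
  moreover have "real M * elem_sym m ?y P \<le> real M * ((\<Sum>p\<in>P. ?y p) ^ m / fact m)"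
    using assms(1) by (intro mult_left_mono elem_sym_le) auto
  ultimately show ?thesis unfolding card_eq by linarith
qed

subsection \<open>Sums and products over primes\<close>

definition prime_recip_sum :: "nat \<Rightarrow> real" where
  "prime_recip_sum n = (\<Sum>p | prime p \<and> p \<le> n. 1 / real p)"

definition mertens_prod :: "nat \<Rightarrow> real" where
  "mertens_prod n = (\<Prod>p | prime p \<and> p \<le> n. 1 - 1 / real p)"

text \<open>Chebyshev's argument: the primes in question all exceed \<open>2 ^ j\<close>, and their
  product divides the central binomial coefficient of \<open>2 ^ Suc j\<close>, which is at most
  \<open>2 ^ (2 ^ Suc j)\<close>.\<close>

lemma card_primes_dyadic: "j * card {p :: nat. prime p \<and> 2 ^ j < p \<and> p \<le> 2 ^ Suc j} \<le> 2 ^ Suc j"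
proof -
  let ?n = "2 ^ j :: nat"
  let ?A = "{p. prime p \<and> ?n < p \<and> p \<le> 2 * ?n}"
  have fin: "finite ?A" by (rule finite_subset[of _ "{..2 * ?n}"]) auto
  have "p dvd (2 * ?n choose ?n)" if "p \<in> ?A" for p
  proof -
    have p: "prime p" "?n < p" "p \<le> 2 * ?n" using that by auto
    have "p dvd fact (2 * ?n)" using p by (simp add: prime_dvd_fact_iff)
    also have "fact (2 * ?n) = fact ?n * fact ?n * (2 * ?n choose ?n)"
      using binomial_fact_lemma[of ?n "2 * ?n"] by simp
    finally have "p dvd fact ?n * fact ?n * (2 * ?n choose ?n)" .
    moreover have "\<not> p dvd fact ?n" using p by (simp add: prime_dvd_fact_iff)
    ultimately show ?thesis using p(1) by (metis prime_dvd_mult_iff)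
  qed
  moreover have prod_dvd: "(\<Prod>p\<in>B. p) dvd c" if "finite B" "\<And>p. p \<in> B \<Longrightarrow> prime p \<and> p dvd c" for B and c :: nat
    using that
  proof (induction B rule: finite_induct)
    case (insert q B)
    have "coprime q (\<Prod>p\<in>B. p)"
      using insert by (intro prod_coprime_right) (metis insertCI primes_coprime)
    then show ?case using insert by (auto intro: divides_mult)
  qed auto
  ultimately have "(\<Prod>p\<in>?A. p) dvd (2 * ?n choose ?n)"
    by (intro prod_dvd fin) simp
  then have "(\<Prod>p\<in>?A. p) \<le> (2 * ?n choose ?n)" by (rule dvd_imp_le) (simp add: zero_less_binomial_iff)
  also have "\<dots> \<le> 2 ^ (2 * ?n)" by (rule binomial_le_pow2)
  finally have "(\<Prod>p\<in>?A. p) \<le> 2 ^ (2 * ?n)" .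
  moreover have "(\<Prod>p\<in>?A. ?n) \<le> (\<Prod>p\<in>?A. p)" by (rule prod_mono) auto
  ultimately have "(2 ^ (j * card ?A) :: nat) \<le> 2 ^ (2 * ?n)" by (simp add: power_mult)
  then show ?thesis by simp
qed

text \<open>The dyadic block above \<open>2 ^ j\<close> contributes at most \<open>2 / j\<close>;
  the leading \<open>1 / 2\<close> is the prime 2.\<close>

lemma prime_recip_sum_power2_le:
  assumes "J \<ge> 1"
  shows "prime_recip_sum (2 ^ J) \<le> 1 / 2 + 2 * harm (J - 1)"
  using assms
proof (induction J rule: dec_induct)
  case base
  have "{p. prime p \<and> p \<le> (2::nat)} = {2}" by (auto intro: antisym dest: prime_ge_2_nat)
  then show ?case by (simp add: prime_recip_sum_def harm_def)
next
  case (step j)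
  let ?A = "{p. prime p \<and> (2::nat) ^ j < p \<and> p \<le> 2 ^ Suc j}"
  have fin: "finite ?A" "finite {p. prime p \<and> p \<le> (2::nat) ^ j}"
    by (rule finite_subset[of _ "{..2 ^ Suc j}"]; auto)+
  have "{p. prime p \<and> p \<le> (2::nat) ^ Suc j} = {p. prime p \<and> p \<le> 2 ^ j} \<union> ?A"
    by (auto intro: order_trans)
  then have "prime_recip_sum (2 ^ Suc j) = prime_recip_sum (2 ^ j) + (\<Sum>p\<in>?A. 1 / real p)"
    unfolding prime_recip_sum_def using fin by (simp only:) (subst sum.union_disjoint, auto)
  also have "(\<Sum>p\<in>?A. 1 / real p) \<le> (\<Sum>p\<in>?A. 1 / 2 ^ j)"
  proof (rule sum_mono)
    fix p assume "p \<in> ?A"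
    then have "(2::nat) ^ j \<le> p" "prime p" by auto
    from this(1) have "(2::real) ^ j \<le> real p" by (metis of_nat_le_iff of_nat_numeral of_nat_power)
    then show "1 / real p \<le> 1 / 2 ^ j" by (intro divide_left_mono) (use \<open>prime p\<close> prime_gt_0_nat in auto)
  qed
  also have "\<dots> = real (card ?A) / 2 ^ j" by simp
  also have "\<dots> \<le> 2 / real j"
  proof -
    have "real (j * card ?A) \<le> real (2 ^ Suc j)" using card_primes_dyadic[of j] of_nat_le_iff by blast
    then show ?thesis using step by (simp add: field_simps)
  qed
  also have "prime_recip_sum (2 ^ j) + 2 / real j \<le> 1 / 2 + 2 * harm (j - 1) + 2 / real j"
    using step by simp
  also have "\<dots> = 1 / 2 + 2 * harm j"
    using step harm_Suc[of "j - 1", where ?'a = real] by (simp add: field_simps)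
  finally show ?case by simp
qed

lemma prime_recip_sum_mono: "m \<le> n \<Longrightarrow> prime_recip_sum m \<le> prime_recip_sum n"
  unfolding prime_recip_sum_def by (intro sum_mono2) auto

text \<open>Mertens's theorem has 1 in front of the iterated logarithm; the 2 is what the Chebyshev
  bound loses.\<close>

lemma prime_recip_sum_le:
  assumes "n \<ge> 1"
  shows "prime_recip_sum n \<le> 4 + 2 * ln (1 + ln (real n))"
proof -
  define J where "J = Suc (nat \<lfloor>log 2 (real n)\<rfloor>)"
  have log0: "log 2 (real n) \<ge> 0" using assms by simp
  have "real n = 2 powr log 2 (real n)" using assms by simp
  also have "\<dots> \<le> 2 powr real J" using log0 by (intro powr_mono) (auto simp: J_def, linarith)
  finally have "real n \<le> real (2 ^ J)" by (simp add: powr_realpow)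
  then have "n \<le> 2 ^ J" using of_nat_le_iff by blast
  have J: "real J \<le> 2 * (1 + ln (real n))"
  proof -
    have "real J \<le> 1 + log 2 (real n)" using log0 by (simp add: J_def)
    also have "log 2 (real n) = ln (real n) / ln 2" by (simp add: log_def)
    also have "\<dots> \<le> ln (real n) / (1 / 2)"
      using assms ln2_ge_two_thirds by (intro divide_left_mono) auto
    finally show ?thesis by simp
  qed
  have "prime_recip_sum n \<le> prime_recip_sum (2 ^ J)" using \<open>n \<le> 2 ^ J\<close> by (rule prime_recip_sum_mono)
  also have "\<dots> \<le> 1 / 2 + 2 * harm (J - 1)" by (rule prime_recip_sum_power2_le) (simp add: J_def)
  also have "harm (J - 1) \<le> (harm J :: real)" by (intro harm_mono) auto
  also have "harm J \<le> ln (real J) + 1"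
    using decseqD[OF decseq_harm_diff_ln, of 0 "J - 1"] by (simp add: J_def harm_expand)
  also have "ln (real J) \<le> ln (2 * (1 + ln (real n)))"
    using J assms by (subst ln_le_cancel_iff) (auto simp: J_def add_pos_nonneg)
  also have "\<dots> = ln 2 + ln (1 + ln (real n))" using assms by (intro ln_mult_pos) (auto simp: add_pos_nonneg)
  also have "ln 2 \<le> (0.7 :: real)" using ln2_le_25_over_36 by simp
  finally show ?thesis by simp
qed

text \<open>The slope required at \<open>u = 1 / 2\<close> is \<open>2 * ln 2 < 1.39\<close>. The
  choice \<open>3 / 2\<close>, multiplied by the 2 in \<open>prime_recip_sum_le\<close>, gives the
  integer exponent 3 in the next lemma.\<close>

lemma one_minus_ge_exp:
  fixes u :: real
  assumes "0 \<le> u" "u \<le> 1 / 2"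
  shows "exp (- (3 / 2) * u) \<le> 1 - u"
proof -
  have "1 \<le> (1 - u) * (1 + 3 / 2 * u + (3 / 2 * u)\<^sup>2 / 2)"
  proof -
    have "3 / 8 * u + 9 / 8 * u\<^sup>2 \<le> 3 / 8 * (1 / 2) + 9 / 8 * (1 / 2)\<^sup>2"
      using assms by (intro add_mono mult_left_mono power_mono) auto
    then have "0 \<le> u * (1 / 2 - 3 / 8 * u - 9 / 8 * u\<^sup>2)"
      using assms by (intro mult_nonneg_nonneg) (auto simp: power2_eq_square)
    then show ?thesis by (simp add: field_simps power2_eq_square)
  qed
  also have "\<dots> \<le> (1 - u) * exp (3 / 2 * u)"
    using assms exp_lower_Taylor_quadratic[of "3 / 2 * u"] by (intro mult_left_mono) auto
  finally show ?thesis by (simp add: exp_minus field_simps)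
qed

text \<open>The true order is \<open>1 / ln n\<close>. The cube is affordable: for arguments of the
  size of the window it is a power of \<open>u\<close>, and for \<open>n = z\<close> it is of order
  \<open>exp (3 * u / 32)\<close>, far below the window length.\<close>

lemma mertens_prod_ge:
  assumes "n \<ge> 1"
  shows "mertens_prod n \<ge> exp (- 6) / (1 + ln (real n)) ^ 3"
proof -
  have pos: "1 + ln (real n) > 0" using assms by (simp add: add_pos_nonneg)
  have "exp (- 6) / (1 + ln (real n)) ^ 3 = exp (- (3 / 2) * (4 + 2 * ln (1 + ln (real n))))"
  proof -
    have "(1 + ln (real n)) ^ 3 = exp (3 * ln (1 + ln (real n)))"
      using pos by (metis exp_ln exp_of_nat_mult of_nat_numeral)
    then show ?thesis by (simp add: exp_diff[symmetric] algebra_simps)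
  qed
  also have "\<dots> \<le> exp (- (3 / 2) * prime_recip_sum n)"
    using prime_recip_sum_le[OF assms] by simp
  also have "\<dots> = (\<Prod>p | prime p \<and> p \<le> n. exp (- (3 / 2) * (1 / real p)))"
    by (simp add: prime_recip_sum_def sum_distrib_left exp_sum)
  also have "\<dots> \<le> mertens_prod n"
    unfolding mertens_prod_def
  proof (rule prod_mono, safe)
    fix p :: nat assume "prime p"
    then have "p \<ge> 2" by (rule prime_ge_2_nat)
    then show "exp (- (3 / 2) * (1 / real p)) \<le> 1 - 1 / real p"
      by (intro one_minus_ge_exp) (auto simp: field_simps)
  qed auto
  finally show ?thesis .
qed

subsection \<open>The singular series\<close>

definition local_prod :: "nat set \<Rightarrow> nat \<Rightarrow> real" where
  "local_prod H n = (\<Prod>p | prime p \<and> p \<le> n. 1 - real (card ((\<lambda>h. h mod p) ` H)) / real p)"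

lemma card_image_mod_le: "p > 0 \<Longrightarrow> card ((\<lambda>h. h mod p) ` H) \<le> (p :: nat)"
  using card_mono[of "{..<p}" "(\<lambda>h. h mod p) ` H"] by (simp add: image_subset_iff)

lemma finite_primes_le: "finite {p :: nat. prime p \<and> p \<le> n}"
  by (rule finite_subset[of _ "{..n}"]) auto

lemma local_prod_nonneg: "local_prod H n \<ge> 0"
  unfolding local_prod_def
proof (rule prod_nonneg, safe)
  fix p :: nat assume "prime p"
  then show "0 \<le> 1 - real (card ((\<lambda>h. h mod p) ` H)) / real p"
    using card_image_mod_le[of p H] prime_gt_0_nat[of p] by (simp add: field_simps)
qed

lemma local_prod_le_1: "local_prod H n \<le> 1"
  unfolding local_prod_def
proof (rule prod_le_1, safe)
  fix p :: nat assume "prime p"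
  then show "0 \<le> 1 - real (card ((\<lambda>h. h mod p) ` H)) / real p"
    using card_image_mod_le[of p H] prime_gt_0_nat[of p] by (simp add: field_simps)
qed auto

lemma mertens_prod_pos: "mertens_prod n > 0"
  unfolding mertens_prod_def
proof (rule prod_pos, safe)
  fix p :: nat assume "prime p"
  then show "0 < 1 - 1 / real p" using prime_gt_1_nat[of p] by (simp add: field_simps)
qed

lemma mertens_prod_le_1: "mertens_prod n \<le> 1"
  unfolding mertens_prod_def
proof (rule prod_le_1, safe)
  fix p :: nat assume "prime p"
  then show "0 \<le> 1 - 1 / real p" using prime_gt_1_nat[of p] by (simp add: field_simps)
qed auto

text \<open>Both bounds are Bernoulli's inequality, for \<open>(1 - 1 / p) ^ j\<close> and for
  \<open>(1 + 1 / p) ^ j\<close>. A factor with \<open>j\<close> residues thus differs from 1 by at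
  most \<open>j\<^sup>2 / p\<^sup>2\<close>, which sums to \<open>j\<^sup>2 / z\<close> over the
  primes above \<open>z\<close>.\<close>

lemma singular_factor_bounds:
  fixes j p :: nat
  assumes "2 \<le> p" "j \<le> p"
  shows "1 - (real j / real p)\<^sup>2 \<le> (1 - real j / real p) * (1 - 1 / real p) powi (- int j)"
    "(1 - real j / real p) * (1 - 1 / real p) powi (- int j) \<le> 1"
proof -
  let ?u = "1 / real p"
  have u: "0 < 1 - ?u" "0 \<le> ?u" "?u \<le> 1" using assms by (auto simp: field_simps)
  have eq: "(1 - ?u) powi (- int j) = 1 / (1 - ?u) ^ j"
    by (simp add: power_int_minus divide_inverse)
  have "1 + real j * (- ?u) \<le> (1 + (- ?u)) ^ j" by (intro Bernoulli_inequality) (use u in linarith)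
  then show "(1 - real j / real p) * (1 - 1 / real p) powi (- int j) \<le> 1"
    unfolding eq using u by (simp add: field_simps)
  have "(1 - real j / real p) * (1 + real j * ?u) \<le> (1 - real j / real p) * (1 / (1 - ?u) ^ j)"
  proof (intro mult_left_mono)
    have "1 + real j * ?u \<le> (1 + ?u) ^ j" by (intro Bernoulli_inequality) (use u in linarith)
    also have "\<dots> \<le> (1 / (1 - ?u)) ^ j"
    proof (rule power_mono)
      have "(1 + ?u) * (1 - ?u) \<le> 1" by (simp add: algebra_simps)
      then show "1 + ?u \<le> 1 / (1 - ?u)" using u(1) by (simp only: pos_le_divide_eq)
    qed (use u in auto)
    finally show "1 + real j * ?u \<le> 1 / (1 - ?u) ^ j" by (simp add: power_one_over)
    show "0 \<le> 1 - real j / real p" using assms by (simp add: field_simps)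
  qed
  then show "1 - (real j / real p)\<^sup>2 \<le> (1 - real j / real p) * (1 - 1 / real p) powi (- int j)"
    unfolding eq by (simp add: algebra_simps power2_eq_square)
qed

lemma sum_inverse_squares_tail:
  assumes "1 \<le> z" "z \<le> n"
  shows "(\<Sum>i\<in>{z<..n}. 1 / (real i)\<^sup>2) \<le> 1 / real z - 1 / real n"
  using assms(2)
proof (induction n rule: dec_induct)
  case (step n)
  have "{z<..Suc n} = insert (Suc n) {z<..n}" using step by auto
  then have "(\<Sum>i\<in>{z<..Suc n}. 1 / (real i)\<^sup>2) = 1 / (real (Suc n))\<^sup>2 + (\<Sum>i\<in>{z<..n}. 1 / (real i)\<^sup>2)" by simp
  also have "1 / (real (Suc n))\<^sup>2 \<le> 1 / (real n * real (Suc n))"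
    using step assms(1) by (intro divide_left_mono) (auto simp: power2_eq_square)
  also have "\<dots> = 1 / real n - 1 / real (Suc n)" using step assms(1) by (simp add: field_simps)
  finally show ?case using step by simp
qed simp

text \<open>The elements of \<open>H\<close> lie in \<open>{1..z}\<close> and so are incongruent
  modulo each prime above \<open>z\<close>. The tail of the product is therefore the same for all
  \<open>H\<close> of one size, and \<open>singular_factor_bounds\<close> controls it.\<close>

lemma singular_series_bounds:
  assumes "H \<subseteq> {1..z}" "1 \<le> z"
  defines "j \<equiv> card H"
  shows "local_prod H z / mertens_prod z ^ j * (1 - (real j)\<^sup>2 / real z) \<le> singular_series (int ` H)"
    "singular_series (int ` H) \<le> local_prod H z / mertens_prod z ^ j"
proof -
  define f where "f p = (if prime p
           then (1 - real (card ((\<lambda>h. h mod int p) ` int ` H)) / real p)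
                  * (1 - 1 / real p) powi (- int (card (int ` H)))
           else 1)" for p
  have ss: "singular_series (int ` H) = prodinf f" by (simp add: singular_series_def f_def[abs_def])
  have finH: "finite H" using assms(1) finite_subset by blast
  have cardI: "card (int ` H) = j" unfolding j_def by (rule card_image) simp
  have cardmod: "card ((\<lambda>h. h mod int p) ` int ` H) = card ((\<lambda>h. h mod p) ` H)" for p
  proof -
    have "(\<lambda>h. h mod int p) ` int ` H = int ` (\<lambda>h. h mod p) ` H" by (auto simp: image_image zmod_int)
    then show ?thesis by (simp add: card_image)
  qed
  have f_eq: "f p = (if prime p then (1 - real (card ((\<lambda>h. h mod p) ` H)) / real p) * (1 - 1 / real p) powi (- int j) else 1)" for p
    by (simp add: f_def cardmod cardI)
  have jz: "j \<le> z" unfolding j_def using card_mono[OF _ assms(1)] by simp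
  have large: "card ((\<lambda>h. h mod p) ` H) = j" if "p > z" for p
  proof -
    have "(\<lambda>h. h mod p) ` H = (\<lambda>h. h) ` H"
      using assms(1) that by (intro image_cong refl mod_less) (auto simp: subset_eq)
    then show ?thesis by (simp add: j_def)
  qed
  have fl: "1 - (real j / real p)\<^sup>2 \<le> f p" "f p \<le> 1" if "p > z" for p
    using singular_factor_bounds[of p j] jz that assms(2) by (auto simp: f_eq large)
  \<comment> \<open>Convergence ties \<open>prodinf\<close> to the partial products, for which the
    bounds are proved.\<close>
  have "summable (\<lambda>i. norm (f i - 1))"
  proof (rule summable_comparison_test')
    show "summable (\<lambda>i. (real j)\<^sup>2 * (1 / (real i)\<^sup>2))"
      using inverse_power_summable[of 2, where ?'a = real]
      by (intro summable_mult) (simp add: divide_inverse power_inverse)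
    fix p assume "p \<ge> Suc z"
    then show "norm (norm (f p - 1)) \<le> (real j)\<^sup>2 * (1 / (real p)\<^sup>2)"
      using fl[of p] by (simp add: power_divide abs_if)
  qed
  then have "convergent_prod f"
    by (intro abs_convergent_prod_imp_convergent_prod summable_imp_abs_convergent_prod)
  then have lim: "(\<lambda>n. \<Prod>i\<le>n. f i) \<longlonglongrightarrow> singular_series (int ` H)"
    unfolding ss by (rule convergent_prod_LIMSEQ)
  have Fz: "(\<Prod>i\<le>z. f i) = local_prod H z / mertens_prod z ^ j"
  proof -
    have "(\<Prod>i\<le>z. f i) = (\<Prod>i\<in>{p. prime p \<and> p \<le> z}. f i)"
      by (rule prod.mono_neutral_right) (auto simp: f_eq)
    also have "\<dots> = (\<Prod>p\<in>{p. prime p \<and> p \<le> z}. (1 - real (card ((\<lambda>h. h mod p) ` H)) / real p) / (1 - 1 / real p) ^ j)"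
      by (rule prod.cong) (auto simp: f_eq power_int_minus divide_inverse)
    also have "\<dots> = local_prod H z / mertens_prod z ^ j"
      by (simp only: prod_dividef prod_power_distrib local_prod_def mertens_prod_def)
    finally show ?thesis .
  qed
  have Fz0: "(\<Prod>i\<le>z. f i) \<ge> 0"
    unfolding Fz using local_prod_nonneg mertens_prod_pos by (simp add: less_imp_le)
  have partial: "(\<Prod>i\<le>n. f i) \<le> (\<Prod>i\<le>z. f i)"
      "(\<Prod>i\<le>z. f i) * (1 - (real j)\<^sup>2 / real z) \<le> (\<Prod>i\<le>n. f i)" if "n \<ge> z" for n
  proof -
    have "{..n} = {..z} \<union> {z<..n}" using that by auto
    then have split: "(\<Prod>i\<le>n. f i) = (\<Prod>i\<le>z. f i) * (\<Prod>i\<in>{z<..n}. f i)"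
      by (simp only:) (rule prod.union_disjoint, auto)
    have jp: "(real j / real i)\<^sup>2 \<le> 1" if "i \<in> {z<..n}" for i
      using that jz assms(2) by (intro power_le_one) (auto simp: field_simps)
    have "(\<Prod>i\<in>{z<..n}. f i) \<le> 1"
    proof (rule prod_le_1)
      fix i assume i: "i \<in> {z<..n}"
      then show "0 \<le> f i \<and> f i \<le> 1" using fl[of i] jp[OF i] by auto
    qed
    then show "(\<Prod>i\<le>n. f i) \<le> (\<Prod>i\<le>z. f i)" unfolding split using Fz0 mult_left_le by blast
    have "(\<Sum>i\<in>{z<..n}. (real j / real i)\<^sup>2) = (real j)\<^sup>2 * (\<Sum>i\<in>{z<..n}. 1 / (real i)\<^sup>2)"
      by (simp add: sum_distrib_left power_divide)
    also have "\<dots> \<le> (real j)\<^sup>2 * (1 / real z)"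
      using sum_inverse_squares_tail[OF assms(2) that] by (intro mult_left_mono) (auto intro: order_trans)
    finally have "1 - (real j)\<^sup>2 / real z \<le> 1 - (\<Sum>i\<in>{z<..n}. (real j / real i)\<^sup>2)" by simp
    also have "\<dots> \<le> (\<Prod>i\<in>{z<..n}. 1 - (real j / real i)\<^sup>2)"
      using jp by (intro Weierstrass_prod_ineq) auto
    also have "\<dots> \<le> (\<Prod>i\<in>{z<..n}. f i)" using fl jp by (intro prod_mono) auto
    finally show "(\<Prod>i\<le>z. f i) * (1 - (real j)\<^sup>2 / real z) \<le> (\<Prod>i\<le>n. f i)"
      unfolding split using Fz0 by (intro mult_left_mono)
  qed
  show "local_prod H z / mertens_prod z ^ j * (1 - (real j)\<^sup>2 / real z) \<le> singular_series (int ` H)"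
    using LIMSEQ_le_const[OF lim] partial(2) unfolding Fz by blast
  show "singular_series (int ` H) \<le> local_prod H z / mertens_prod z ^ j"
    using LIMSEQ_le_const2[OF lim] partial(1) unfolding Fz by blast
qed

lemma singular_series_nonneg_le:
  assumes "H \<subseteq> {1..M}" "1 \<le> M"
  shows "0 \<le> singular_series (int ` H)" "singular_series (int ` H) \<le> 1 / mertens_prod M ^ card H"
proof -
  have "singular_series (int ` H) \<le> local_prod H M / mertens_prod M ^ card H"
    using singular_series_bounds(2)[OF assms] .
  also have "\<dots> \<le> 1 / mertens_prod M ^ card H"
    using mertens_prod_pos[of M] by (intro divide_right_mono local_prod_le_1) simp
  finally show "singular_series (int ` H) \<le> 1 / mertens_prod M ^ card H" .
  \<comment> \<open>The value of the series does not depend on the sieving limit; a limit above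
    \<open>(card H)\<^sup>2\<close> makes the lower bound nonnegative.\<close>
  let ?z = "M + (card H)\<^sup>2"
  have "H \<subseteq> {1..?z}" "1 \<le> ?z" using assms by auto
  note b = singular_series_bounds(1)[OF this]
  have "(real (card H))\<^sup>2 / real ?z \<le> 1"
    using assms(2) by (subst divide_le_eq_1_pos) (auto intro: add_pos_nonneg)
  then have "0 \<le> local_prod H ?z / mertens_prod ?z ^ card H * (1 - (real (card H))\<^sup>2 / real ?z)"
    using local_prod_nonneg[of H ?z] mertens_prod_pos[of ?z] by (intro mult_nonneg_nonneg divide_nonneg_pos) auto
  with b show "0 \<le> singular_series (int ` H)" by linarith
qed

subsection \<open>From prime tuples to the sieve model\<close>

definition tuple_count :: "nat set \<Rightarrow> real \<Rightarrow> nat set \<Rightarrow> nat" where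
  "tuple_count A x H = card {n :: nat. 1 \<le> n \<and> real n \<le> x \<and> (\<forall>h\<in>H. n + h \<in> A)}"

lemma num_intervals_bonferroni:
  fixes A :: "nat set" and x y :: real and k K :: nat
  assumes "0 \<le> y" "k \<le> K"
  defines "M \<equiv> nat \<lfloor>y\<rfloor>"
  shows "\<bar>real (num_intervals A x y k) - (\<Sum>j=k..<K. (-1) ^ (j - k) * real (j choose k)
           * (\<Sum>H | H \<subseteq> {1..M} \<and> card H = j. real (tuple_count A x H)))\<bar>
    \<le> real (K choose k) * (\<Sum>H | H \<subseteq> {1..M} \<and> card H = K. real (tuple_count A x H))"
proof -
  define N where "N = {n :: nat. 1 \<le> n \<and> real n \<le> x}"
  have finN: "finite N"
    by (rule finite_subset[of _ "{..nat \<lfloor>x\<rfloor>}"]) (auto simp: N_def le_nat_iff le_floor_iff)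
  define X where "X n = {h \<in> {1..M}. n + h \<in> A}" for n
  have card_eq: "card {a \<in> A. real n + 1 \<le> real a \<and> real a \<le> real n + y} = card (X n)" for n
  proof -
    have "{a \<in> A. real n + 1 \<le> real a \<and> real a \<le> real n + y} = (\<lambda>h. n + h) ` X n"
    proof (intro subset_antisym subsetI)
      fix a assume a: "a \<in> {a \<in> A. real n + 1 \<le> real a \<and> real a \<le> real n + y}"
      then have "n + 1 \<le> a" by (metis (mono_tags, lifting) mem_Collect_eq of_nat_1 of_nat_add of_nat_le_iff)
      moreover from this have "real (a - n) \<le> y" using a by (simp add: of_nat_diff)
      then have "a - n \<le> M" unfolding M_def by (simp add: le_nat_iff le_floor_iff assms(1))
      ultimately have "a - n \<in> X n" "a = n + (a - n)" using a by (auto simp: X_def)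
      then show "a \<in> (\<lambda>h. n + h) ` X n" by blast
    next
      fix a assume "a \<in> (\<lambda>h. n + h) ` X n"
      then obtain h where h: "a = n + h" "1 \<le> h" "h \<le> M" "n + h \<in> A" by (auto simp: X_def)
      then have "real h \<le> y" unfolding M_def using assms(1) by (simp add: le_nat_iff le_floor_iff)
      then show "a \<in> {a \<in> A. real n + 1 \<le> real a \<and> real a \<le> real n + y}" using h by auto
    qed
    then show ?thesis by (simp add: card_image)
  qed
  have sum_tc: "(\<Sum>n\<in>N. real (card (X n) choose j))
      = (\<Sum>H | H \<subseteq> {1..M} \<and> card H = j. real (tuple_count A x H))" for j
  proof -
    have "(\<Sum>n\<in>N. real (card (X n) choose j))
        = (\<Sum>n\<in>N. \<Sum>H | H \<subseteq> {1..M} \<and> card H = j. of_bool (H \<subseteq> X n))"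
      by (intro sum.cong refl choose_card_eq_sum_subsets) (auto simp: X_def)
    also have "\<dots> = (\<Sum>H | H \<subseteq> {1..M} \<and> card H = j. \<Sum>n\<in>N. of_bool (H \<subseteq> X n))" by (rule sum.swap)
    also have "\<dots> = (\<Sum>H | H \<subseteq> {1..M} \<and> card H = j. real (tuple_count A x H))"
    proof (intro sum.cong refl)
      fix H assume "H \<in> {H. H \<subseteq> {1..M} \<and> card H = j}"
      then have "N \<inter> {n. H \<subseteq> X n} = {n :: nat. 1 \<le> n \<and> real n \<le> x \<and> (\<forall>h\<in>H. n + h \<in> A)}"
        by (auto simp: N_def X_def)
      then show "(\<Sum>n\<in>N. of_bool (H \<subseteq> X n)) = real (tuple_count A x H)"
        using finN by (simp add: tuple_count_def of_bool_def sum.If_cases)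
    qed
    finally show ?thesis .
  qed
  have "real (num_intervals A x y k) = (\<Sum>n\<in>N. of_bool (card (X n) = k))"
  proof -
    have "{n :: nat. 1 \<le> n \<and> real n \<le> x \<and> card (X n) = k} = N \<inter> {n. card (X n) = k}"
      by (auto simp: N_def)
    then show ?thesis using finN by (simp add: num_intervals_def card_eq of_bool_def sum.If_cases)
  qed
  \<comment> \<open>Thinning with \<open>r = 1\<close> expresses the exact count:
    \<open>0 ^ (card (X n) - k)\<close> with \<open>0 ^ 0 = 1\<close> excludes larger sets, and the
    binomial coefficient vanishes for smaller ones.\<close>
  also have "\<dots> = (\<Sum>n\<in>N. real (card (X n) choose k) * 1 ^ k * (1 - 1) ^ (card (X n) - k))"
    by (intro sum.cong refl) (auto simp: of_bool_def power_0_left binomial_eq_0)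
  finally have num: "real (num_intervals A x y k)
      = (\<Sum>n\<in>N. real (card (X n) choose k) * 1 ^ k * (1 - 1) ^ (card (X n) - k))" .
  let ?s = "\<lambda>n. \<Sum>j=k..<K. (-1) ^ (j - k) * real (j choose k) * real (card (X n) choose j) * 1 ^ j"
  have "(\<Sum>n\<in>N. ?s n) = (\<Sum>j=k..<K. \<Sum>n\<in>N. (-1) ^ (j - k) * real (j choose k) * real (card (X n) choose j) * 1 ^ j)"
    by (rule sum.swap)
  also have "\<dots> = (\<Sum>j=k..<K. (-1) ^ (j - k) * real (j choose k)
           * (\<Sum>H | H \<subseteq> {1..M} \<and> card H = j. real (tuple_count A x H)))"
    by (simp only: sum_tc[symmetric] sum_distrib_left power_one mult_1_right)
  finally have eq: "real (num_intervals A x y k) - (\<Sum>j=k..<K. (-1) ^ (j - k) * real (j choose k)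
           * (\<Sum>H | H \<subseteq> {1..M} \<and> card H = j. real (tuple_count A x H)))
      = (\<Sum>n\<in>N. real (card (X n) choose k) * 1 ^ k * (1 - 1) ^ (card (X n) - k) - ?s n)"
    unfolding num by (simp add: sum_subtractf)
  have "\<bar>\<Sum>n\<in>N. real (card (X n) choose k) * 1 ^ k * (1 - 1) ^ (card (X n) - k) - ?s n\<bar>
      \<le> (\<Sum>n\<in>N. real (K choose k) * real (card (X n) choose K) * 1 ^ K)"
    by (rule order_trans[OF sum_abs], rule sum_mono, rule bonferroni_thinned) (use assms(2) in auto)
  also have "\<dots> = real (K choose k) * (\<Sum>H | H \<subseteq> {1..M} \<and> card H = K. real (tuple_count A x H))"
    by (simp only: sum_tc[symmetric] sum_distrib_left power_one mult_1_right)
  finally show ?thesis unfolding eq .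
qed

section \<open>Lists of consecutive primes and the thinned sieve model\<close>

definition primes_between :: "nat \<Rightarrow> nat \<Rightarrow> nat list" where
  "primes_between m n = filter prime [Suc m..<Suc n]"

lemma set_primes_between: "set (primes_between m n) = {p. prime p \<and> m < p \<and> p \<le> n}"
  by (auto simp: primes_between_def)

lemma distinct_primes_between: "distinct (primes_between m n)"
  by (simp add: primes_between_def)

lemma primes_between_append:
  assumes "l \<le> m" "m \<le> n"
  shows "primes_between l n = primes_between l m @ primes_between m n"
proof -
  have "[Suc l..<Suc n] = [Suc l..<Suc m] @ [Suc m..<Suc n]"
    using assms upt_add_eq_append[of "Suc l" "Suc m" "n - m"] by simp
  then show ?thesis by (simp add: primes_between_def)
qed

lemma prod_list_primes_between:
  "(\<Prod>p\<leftarrow>primes_between m n. f p) = (\<Prod>p | prime p \<and> m < p \<and> p \<le> n. f p)"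
  using prod.distinct_set_conv_list[OF distinct_primes_between, of f m n]
  by (simp add: set_primes_between)

lemma prod_list_primes_upto:
  "(\<Prod>p\<leftarrow>primes_between 0 n. f p) = (\<Prod>p | prime p \<and> p \<le> n. f p)"
proof -
  have "{p. prime p \<and> 0 < p \<and> p \<le> n} = {p. prime p \<and> p \<le> n}" by (auto dest: prime_gt_0_nat)
  then show ?thesis by (simp add: prod_list_primes_between)
qed

text \<open>The probability that exactly \<open>k\<close> elements of \<open>S\<close> survive if each is kept independently with
  probability \<open>r\<close>. With \<open>r = 1 / (mertens_prod z * ln t)\<close>, a tuple survives sieving up to \<open>z\<close> and thinning with
  probability close to its singular series divided by a power of \<open>ln t\<close>.\<close>

definition thinned_prob :: "real \<Rightarrow> nat \<Rightarrow> nat set \<Rightarrow> real" where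
  "thinned_prob r k S = real (card S choose k) * r ^ k * (1 - r) ^ (card S - k)"

text \<open>\<open>bonferroni_thinned\<close> averaged term by term. The alternating sum is the one
  which the tuple counts produce up to small errors, so it serves as a bridge and never has to be
  evaluated.\<close>

lemma sieve_avg_thinned_prob:
  fixes r :: real and k K M z :: nat
  assumes "0 \<le> r" "r \<le> 1" "k \<le> K"
  defines "B \<equiv> \<lambda>j. \<Sum>H | H \<subseteq> {1..M} \<and> card H = j. local_prod H z"
  shows "\<bar>sieve_avg (primes_between 0 z) (thinned_prob r k) {1..M}
      - (\<Sum>j=k..<K. (-1) ^ (j - k) * real (j choose k) * (B j * r ^ j))\<bar>
    \<le> real (K choose k) * (B K * r ^ K)"
proof -
  let ?A = "\<lambda>f. sieve_avg (primes_between 0 z) f {1..M}"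
  have B: "?A (\<lambda>S. real (card S choose j)) = B j" for j
    unfolding B_def
    by (subst sieve_avg_choose) (auto simp: set_primes_between local_prod_def prod_list_primes_upto)
  have cB: "?A (\<lambda>S. c * real (card S choose j) * r ^ j) = c * (B j * r ^ j)" for c j
    using sieve_avg_cmult[of _ "c * r ^ j" "\<lambda>S. real (card S choose j)" "{1..M}"] B[of j]
    by (simp add: mult_ac)
  have "?A (thinned_prob r k) - (\<Sum>j=k..<K. (-1) ^ (j - k) * real (j choose k) * (B j * r ^ j))
      = ?A (\<lambda>S. thinned_prob r k S
          - (\<Sum>j=k..<K. (-1) ^ (j - k) * real (j choose k) * real (card S choose j) * r ^ j))"
    by (simp only: sieve_avg_diff sieve_avg_sum cB)
  moreover have "\<bar>?A (\<lambda>S. thinned_prob r k S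
          - (\<Sum>j=k..<K. (-1) ^ (j - k) * real (j choose k) * real (card S choose j) * r ^ j))\<bar>
      \<le> ?A (\<lambda>S. real (K choose k) * real (card S choose K) * r ^ K)"
    by (rule order_trans[OF sieve_avg_abs], rule sieve_avg_mono, unfold thinned_prob_def,
        rule bonferroni_thinned) (use assms in auto)
  ultimately show ?thesis by (simp only: cB)
qed

lemma binomial_le_power_div_fact: "real (n choose j) \<le> real n ^ j / fact j"
proof -
  have "fact j * (n choose j) \<le> n ^ j"
  proof (cases "j \<le> n")
    case True
    have "fact j * (n choose j) = fact n div fact (n - j)"
    proof -
      have "fact n = (fact j * (n choose j)) * fact (n - j)"
        using binomial_fact_lemma[OF True] by (simp add: mult_ac)
      then show ?thesis by simp
    qed
    also have "\<dots> \<le> n ^ j" using True by (rule fact_div_fact_le_pow)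
    finally show ?thesis .
  qed (simp add: binomial_eq_0)
  then have "real (fact j * (n choose j)) \<le> real (n ^ j)" by (simp only: of_nat_le_iff)
  then show ?thesis by (simp add: field_simps)
qed

lemma abs_sum_mult_le:
  fixes c f :: "nat \<Rightarrow> real"
  assumes "\<And>j. j \<in> {k..<K} \<Longrightarrow> \<bar>c j\<bar> \<le> C" "\<And>j. j \<in> {k..<K} \<Longrightarrow> \<bar>f j\<bar> \<le> F" "0 \<le> C" "0 \<le> F"
  shows "\<bar>\<Sum>j=k..<K. c j * f j\<bar> \<le> real K * C * F"
proof -
  have "\<bar>\<Sum>j=k..<K. c j * f j\<bar> \<le> (\<Sum>j=k..<K. \<bar>c j * f j\<bar>)" by (rule sum_abs)
  also have "\<dots> \<le> (\<Sum>j=k..<K. C * F)"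
    using assms by (intro sum_mono) (auto simp: abs_mult intro!: mult_mono)
  also have "\<dots> = real (K - k) * (C * F)" by simp
  also have "\<dots> \<le> real K * (C * F)" using assms by (intro mult_right_mono) auto
  finally show ?thesis by (simp add: mult_ac)
qed

lemma continuous_on_inverse_ln_power:
  "2 \<le> a \<Longrightarrow> continuous_on {a..b} (\<lambda>t::real. 1 / ln t ^ j)"
  by (intro continuous_intros) auto

lemma ln_ge_half: "2 \<le> t \<Longrightarrow> 1 / 2 \<le> ln (t::real)"
proof -
  assume "2 \<le> t"
  then have "ln 2 \<le> ln t" by simp
  then show "1 / 2 \<le> ln t" using ln2_ge_two_thirds by linarith
qed

text \<open>The number \<open>a\<close> only has to be large enough that \<open>ln t\<close> hardly varies on \<open>{a..x}\<close>; the part of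
  the integrals below \<open>a\<close> is estimated trivially.\<close>

lemma num_intervals_transfer:
  fixes A :: "nat set" and x y a E P e :: real and k K z :: nat
  assumes "0 \<le> y" "k \<le> K"
  defines "M \<equiv> nat \<lfloor>y\<rfloor>"
  defines "U \<equiv> real M / mertens_prod M"
  assumes "1 \<le> M" "M \<le> z" "(real K)\<^sup>2 / real z \<le> 1 / 2"
    and "exp 1 \<le> a" "a \<le> x" "0 \<le> E" "0 \<le> e"
    and HL: "\<And>H. H \<subseteq> {1..M} \<Longrightarrow> card H \<le> K \<Longrightarrow>
      \<bar>real (tuple_count A x H) - singular_series (int ` H) * integral {2..x} (\<lambda>t. 1 / ln t ^ card H)\<bar> \<le> x * E"
    and thin: "\<And>t. a \<le> t \<Longrightarrow> t \<le> x \<Longrightarrow> 1 / (mertens_prod z * ln t) \<le> 1"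
    and model: "\<And>t. a \<le> t \<Longrightarrow> t \<le> x \<Longrightarrow>
      \<bar>sieve_avg (primes_between 0 z) (thinned_prob (1 / (mertens_prod z * ln t)) k) {1..M} - P\<bar> \<le> e"
  shows "\<bar>real (num_intervals A x y k) - x * P\<bar> \<le> x * e + a * \<bar>P\<bar>
    + 3 * x * (2 * U / ln a) ^ K / fact K + (real K + 1) * a * (4 * U) ^ K
    + x * (2 * real K ^ 3 * (2 * U) ^ K / real z) + x * ((real K + 1) * (2 * real M) ^ K * E)"
proof -
  define I where "I j = integral {2..x} (\<lambda>t. 1 / ln t ^ j)" for j :: nat
  define J where "J j = integral {a..x} (\<lambda>t. 1 / ln t ^ j)" for j :: nat
  define T where "T j = (\<Sum>H | H \<subseteq> {1..M} \<and> card H = j. real (tuple_count A x H))" for j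
  define W where "W j = (\<Sum>H | H \<subseteq> {1..M} \<and> card H = j. singular_series (int ` H))" for j
  define B where "B j = (\<Sum>H | H \<subseteq> {1..M} \<and> card H = j. local_prod H z)" for j
  define V where "V j = B j / mertens_prod z ^ j" for j
  define c where "c j = (-1) ^ (j - k) * real (j choose k)" for j
  have a2: "2 \<le> a" using assms(8) exp_ge_add_one_self[of 1] by simp
  then have x0: "0 \<le> x" "2 \<le> x" using assms by auto
  have lna: "1 \<le> ln a" using assms(8) a2 by (subst ln_ge_iff) auto
  have \<Theta>z: "mertens_prod z > 0" and \<Theta>M: "mertens_prod M > 0" "mertens_prod M \<le> 1"
    by (auto simp: mertens_prod_pos mertens_prod_le_1)
  have U1: "1 \<le> U" using \<Theta>M assms(5) by (simp add: U_def field_simps)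
  have z0: "real z > 0" using assms by linarith
  have cle: "\<bar>c j\<bar> \<le> 2 ^ K" if "j \<le> K" for j
  proof -
    have "\<bar>c j\<bar> = real (j choose k)" by (simp add: c_def abs_mult)
    also have "\<dots> \<le> 2 ^ j" by (metis binomial_le_pow2 of_nat_le_iff of_nat_numeral of_nat_power)
    also have "\<dots> \<le> 2 ^ K" using that by (intro power_increasing) auto
    finally show ?thesis .
  qed
  have Kk: "real (K choose k) \<le> 2 ^ K" by (metis binomial_le_pow2 of_nat_le_iff of_nat_numeral of_nat_power)
  have cardH: "card {H. H \<subseteq> {1..M} \<and> card H = j} = M choose j" for j by (simp add: n_subsets)
  have W0: "0 \<le> W j" and WU: "W j \<le> U ^ j / fact j" for j
  proof -
    show "0 \<le> W j" unfolding W_def using assms(5) by (intro sum_nonneg singular_series_nonneg_le(1)) auto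
    have "W j \<le> (\<Sum>H | H \<subseteq> {1..M} \<and> card H = j. 1 / mertens_prod M ^ j)"
      unfolding W_def
    proof (rule sum_mono)
      fix H assume "H \<in> {H. H \<subseteq> {1..M} \<and> card H = j}"
      then show "singular_series (int ` H) \<le> 1 / mertens_prod M ^ j"
        using singular_series_nonneg_le(2)[of H M] assms(5) by auto
    qed
    also have "\<dots> = real (M choose j) / mertens_prod M ^ j" by (simp add: cardH[simplified])
    also have "\<dots> \<le> (real M ^ j / fact j) / mertens_prod M ^ j"
      using \<Theta>M by (intro divide_right_mono binomial_le_power_div_fact) auto
    finally show "W j \<le> U ^ j / fact j" by (simp add: U_def power_divide mult.commute)
  qed
  have V0: "0 \<le> V j" for j unfolding V_def B_def using \<Theta>z by (intro divide_nonneg_pos sum_nonneg local_prod_nonneg) auto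
  have V_sum: "V j = (\<Sum>H | H \<subseteq> {1..M} \<and> card H = j. local_prod H z / mertens_prod z ^ j)" for j
    by (simp add: V_def B_def sum_divide_distrib)
  have WV: "W j \<le> V j" "V j * (1 - (real j)\<^sup>2 / real z) \<le> W j" for j
  proof -
    have "1 \<le> z" using assms(5,6) by simp
    then have b: "singular_series (int ` H) \<le> local_prod H z / mertens_prod z ^ j"
      "local_prod H z / mertens_prod z ^ j * (1 - (real j)\<^sup>2 / real z) \<le> singular_series (int ` H)"
      if "H \<in> {H. H \<subseteq> {1..M} \<and> card H = j}" for H
    proof -
      have "H \<subseteq> {1..z}" "card H = j" using that assms(6) by force+
      then show "singular_series (int ` H) \<le> local_prod H z / mertens_prod z ^ j"
        "local_prod H z / mertens_prod z ^ j * (1 - (real j)\<^sup>2 / real z) \<le> singular_series (int ` H)"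
        using singular_series_bounds[of H z] \<open>1 \<le> z\<close> by blast+
    qed
    show "W j \<le> V j" unfolding V_sum W_def by (intro sum_mono b)
    show "V j * (1 - (real j)\<^sup>2 / real z) \<le> W j"
      unfolding V_sum W_def sum_distrib_right by (intro sum_mono b)
  qed
  have jz: "(real j)\<^sup>2 / real z \<le> 1 / 2" if "j \<le> K" for j
  proof -
    have "(real j)\<^sup>2 / real z \<le> (real K)\<^sup>2 / real z" using that by (intro divide_right_mono power_mono) auto
    then show ?thesis using assms(7) by linarith
  qed
  have VW2: "V j \<le> 2 * W j" if "j \<le> K" for j
  proof -
    have "V j * (1 / 2) \<le> V j * (1 - (real j)\<^sup>2 / real z)" using jz[OF that] V0 by (intro mult_left_mono) auto
    then show ?thesis using WV(2)[of j] by linarith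
  qed
  have Upow: "U ^ j / fact j \<le> U ^ K" if "j \<le> K" for j
  proof -
    have "U ^ j / fact j \<le> U ^ j / 1" using U1 by (intro divide_left_mono) auto
    also have "\<dots> \<le> U ^ K" using that U1 by (simp add: power_increasing)
    finally show ?thesis .
  qed
  have Mpow: "real (M choose j) \<le> real M ^ K" if "j \<le> K" for j
  proof -
    have "real (M choose j) \<le> real M ^ j / fact j" by (rule binomial_le_power_div_fact)
    also have "\<dots> \<le> real M ^ j / 1" by (intro divide_left_mono) auto
    also have "\<dots> \<le> real M ^ K" using that assms(5) by (simp add: power_increasing)
    finally show ?thesis .
  qed
  have J: "0 \<le> J j" "J j \<le> x / ln a ^ j" "J j \<le> x" "\<bar>I j - J j\<bar> \<le> a * 2 ^ j" for j
  proof -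
    have bnd: "1 / ln t ^ j \<le> 1 / ln a ^ j" "0 \<le> 1 / ln t ^ j" if "a \<le> t" for t
    proof -
      have "ln a \<le> ln t" using that a2 by simp
      then show "1 / ln t ^ j \<le> 1 / ln a ^ j" "0 \<le> 1 / ln t ^ j"
        using lna by (auto intro!: divide_left_mono power_mono)
    qed
    show J0: "0 \<le> J j" unfolding J_def using a2 bnd
      by (intro integral_nonneg integrable_continuous_real continuous_on_inverse_ln_power) auto
    have "norm (J j) \<le> 1 / ln a ^ j * (x - a)"
      unfolding J_def using assms(9) a2 bnd by (intro integral_bound continuous_on_inverse_ln_power) auto
    also have "\<dots> \<le> 1 / ln a ^ j * x" using lna a2 by (intro mult_left_mono) auto
    finally show J1: "J j \<le> x / ln a ^ j" by simp
    have "x / ln a ^ j \<le> x / 1" using lna x0 by (intro divide_left_mono) auto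
    with J1 show "J j \<le> x" by simp
    have "I j = integral {2..a} (\<lambda>t. 1 / ln t ^ j) + J j"
      unfolding I_def J_def using a2 assms(9)
      by (intro Henstock_Kurzweil_Integration.integral_combine[symmetric] integrable_continuous_real
          continuous_on_inverse_ln_power) auto
    moreover have "norm (integral {2..a} (\<lambda>t. 1 / ln t ^ j)) \<le> 2 ^ j * (a - 2)"
    proof (rule integral_bound)
      fix t assume "t \<in> {2..a}"
      then have "1 / 2 \<le> ln t" using ln_ge_half[of t] by auto
      then have "(1 / 2) ^ j \<le> ln t ^ j" by (intro power_mono) auto
      moreover from this have "0 < ln t ^ j" using less_le_trans[of 0 "(1/2)^j" "ln t ^ j"] by auto
      ultimately show "norm (1 / ln t ^ j) \<le> 2 ^ j" by (simp add: field_simps power_divide)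
    qed (use a2 continuous_on_inverse_ln_power in auto)
    moreover have "2 ^ j * (a - 2) \<le> a * 2 ^ j" by (simp add: algebra_simps)
    ultimately show "\<bar>I j - J j\<bar> \<le> a * 2 ^ j" unfolding real_norm_def by linarith
  qed
  have TW: "\<bar>T j - W j * I j\<bar> \<le> real M ^ K * (x * E)" if "j \<le> K" for j
  proof -
    have "T j - W j * I j = (\<Sum>H | H \<subseteq> {1..M} \<and> card H = j.
        real (tuple_count A x H) - singular_series (int ` H) * I j)"
      by (simp add: T_def W_def sum_subtractf sum_distrib_right)
    moreover have "\<bar>\<Sum>H | H \<subseteq> {1..M} \<and> card H = j.
        real (tuple_count A x H) - singular_series (int ` H) * I j\<bar>
        \<le> (\<Sum>H | H \<subseteq> {1..M} \<and> card H = j. x * E)"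
    proof (rule order_trans[OF sum_abs], rule sum_mono)
      fix H assume "H \<in> {H. H \<subseteq> {1..M} \<and> card H = j}"
      then show "\<bar>real (tuple_count A x H) - singular_series (int ` H) * I j\<bar> \<le> x * E"
        using HL[of H] that unfolding I_def by auto
    qed
    moreover have "(\<Sum>H | H \<subseteq> {1..M} \<and> card H = j. x * E) = real (M choose j) * (x * E)"
      using cardH[of j] by simp
    moreover have "real (M choose j) * (x * E) \<le> real M ^ K * (x * E)"
      using Mpow[OF that] x0 assms(10) by (intro mult_right_mono) auto
    ultimately show ?thesis by linarith
  qed
  \<comment> \<open>Five replacements in this order: the count by the truncated series,
    \<open>T j\<close> by \<open>W j * I j\<close> (the hypothesis \<open>HL\<close>),
    \<open>I j\<close> by \<open>J j\<close>, \<open>W j\<close> by \<open>V j\<close> (dropping the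
    primes above \<open>z\<close>), and the resulting series by a multiple of
    \<open>P\<close>.\<close>
  have T1: "\<bar>real (num_intervals A x y k) - (\<Sum>j=k..<K. c j * T j)\<bar>
      \<le> x * (2 * U / ln a) ^ K / fact K + a * (4 * U) ^ K + (2 * real M) ^ K * (x * E)"
  proof -
    have T0: "0 \<le> T K" by (simp add: T_def sum_nonneg)
    have "\<bar>real (num_intervals A x y k) - (\<Sum>j=k..<K. c j * T j)\<bar> \<le> real (K choose k) * T K"
      unfolding c_def T_def M_def using assms(1,2) by (rule num_intervals_bonferroni)
    also have "\<dots> \<le> 2 ^ K * T K" using Kk T0 by (rule mult_right_mono)
    also have "\<dots> \<le> 2 ^ K * (W K * I K + real M ^ K * (x * E))"
      using TW[of K] by (intro mult_left_mono) auto
    also have "W K * I K \<le> W K * (x / ln a ^ K + a * 2 ^ K)"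
      using J(2,4)[of K] W0 by (intro mult_left_mono) auto
    also have "\<dots> \<le> U ^ K / fact K * (x / ln a ^ K) + U ^ K * (a * 2 ^ K)"
    proof -
      have "W K * (x / ln a ^ K) \<le> U ^ K / fact K * (x / ln a ^ K)"
        using WU x0 lna by (intro mult_right_mono) auto
      moreover have "W K * (a * 2 ^ K) \<le> U ^ K * (a * 2 ^ K)"
        using order_trans[OF WU Upow[of K]] a2 by (intro mult_right_mono) auto
      ultimately show ?thesis by (simp add: distrib_left)
    qed
    also have "2 ^ K * (U ^ K / fact K * (x / ln a ^ K) + U ^ K * (a * 2 ^ K) + real M ^ K * (x * E))
       = x * (2 * U / ln a) ^ K / fact K + a * (4 * U) ^ K + (2 * real M) ^ K * (x * E)"
    proof -
      have "(4::real) ^ K = 2 ^ K * 2 ^ K" by (simp add: power_mult_distrib[symmetric])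
      then show ?thesis by (simp add: power_mult_distrib power_divide distrib_left mult_ac)
    qed
    finally show ?thesis by simp
  qed
  have T2: "\<bar>\<Sum>j=k..<K. c j * (T j - W j * I j)\<bar> \<le> real K * 2 ^ K * (real M ^ K * (x * E))"
    using cle TW x0 assms(10) by (intro abs_sum_mult_le) auto
  have T3: "\<bar>\<Sum>j=k..<K. c j * (W j * (I j - J j))\<bar> \<le> real K * 2 ^ K * (U ^ K * (a * 2 ^ K))"
  proof (intro abs_sum_mult_le)
    fix j assume "j \<in> {k..<K}"
    then have j: "j \<le> K" by auto
    have "\<bar>W j * (I j - J j)\<bar> = W j * \<bar>I j - J j\<bar>" using W0 by (simp add: abs_mult)
    also have "\<dots> \<le> U ^ K * (a * 2 ^ j)"
      using order_trans[OF WU Upow[OF j]] J(4)[of j] W0 U1 by (intro mult_mono) auto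
    also have "\<dots> \<le> U ^ K * (a * 2 ^ K)" using U1 a2 j by (intro mult_left_mono power_increasing) auto
    finally show "\<bar>W j * (I j - J j)\<bar> \<le> U ^ K * (a * 2 ^ K)" .
  qed (use cle U1 a2 in auto)
  have T4: "\<bar>\<Sum>j=k..<K. c j * ((W j - V j) * J j)\<bar> \<le> real K * 2 ^ K * (2 * U ^ K * ((real K)\<^sup>2 / real z) * x)"
  proof (intro abs_sum_mult_le)
    fix j assume "j \<in> {k..<K}"
    then have j: "j \<le> K" by auto
    have "\<bar>W j - V j\<bar> \<le> V j * ((real j)\<^sup>2 / real z)" using WV[of j] by (simp add: algebra_simps)
    also have "\<dots> \<le> 2 * U ^ K * ((real K)\<^sup>2 / real z)"
      using VW2[OF j] order_trans[OF WU Upow[OF j]] V0 j U1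
      by (intro mult_mono divide_right_mono power_mono) auto
    finally have "\<bar>W j - V j\<bar> \<le> 2 * U ^ K * ((real K)\<^sup>2 / real z)" .
    then show "\<bar>(W j - V j) * J j\<bar> \<le> 2 * U ^ K * ((real K)\<^sup>2 / real z) * x"
      using J(1,3)[of j] x0 U1 by (simp only: abs_mult) (intro mult_mono, auto)
  qed (use cle U1 x0 in auto)
  have T5: "\<bar>(\<Sum>j=k..<K. c j * (V j * J j)) - (x - a) * P\<bar> \<le> x * e + 2 * x * (2 * U / ln a) ^ K / fact K"
  proof -
    \<comment> \<open>For \<open>r = 1 / (mertens_prod z * ln t)\<close> one has
      \<open>B j * r ^ j = V j / ln t ^ j\<close>. Hence \<open>f t\<close> is the truncated series
      of the model at \<open>t\<close>, and the hypothesis \<open>model\<close> can be applied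
      pointwise before integrating.\<close>
    define f where "f t = (\<Sum>j=k..<K. c j * (V j * (1 / ln t ^ j)))" for t :: real
    have cont: "continuous_on {a..x} f"
      unfolding f_def using a2 by (intro continuous_on_sum continuous_on_mult continuous_on_const continuous_on_inverse_ln_power)
    have intf: "integral {a..x} f = (\<Sum>j=k..<K. c j * (V j * J j))"
    proof -
      have "integral {a..x} f = (\<Sum>j=k..<K. integral {a..x} (\<lambda>t. c j * (V j * (1 / ln t ^ j))))"
        unfolding f_def
        by (intro integral_sum finite_atLeastLessThan integrable_continuous_real continuous_on_mult
            continuous_on_const continuous_on_inverse_ln_power a2)
      then show ?thesis by (simp only: integral_mult_right J_def)
    qed
    have bound: "\<bar>f t - P\<bar> \<le> e + 2 * (2 * U / ln a) ^ K / fact K" if t: "t \<in> {a..x}" for t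
    proof -
      define r where "r = 1 / (mertens_prod z * ln t)"
      have "ln a \<le> ln t" using t a2 by simp
      then have lnt: "ln t \<ge> ln a" "ln t > 0" using lna by auto
      have r: "0 \<le> r" "r \<le> 1" using thin[of t] t lnt \<Theta>z by (auto simp: r_def)
      have Br: "B j * r ^ j = V j * (1 / ln t ^ j)" for j
        by (simp add: V_def r_def power_divide power_mult_distrib)
      have "\<bar>sieve_avg (primes_between 0 z) (thinned_prob r k) {1..M} - f t\<bar>
          \<le> real (K choose k) * (B K * r ^ K)"
        using sieve_avg_thinned_prob[OF r assms(2), of z M]
        unfolding f_def c_def B_def[symmetric] Br by simp
      also have "\<dots> \<le> 2 ^ K * (2 * (U ^ K / fact K) * (1 / ln a ^ K))"
        unfolding Br using Kk V0 VW2[of K] WU[of K] lnt lna U1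
        by (intro mult_mono divide_left_mono power_mono) (auto intro!: mult_nonneg_nonneg)
      also have "\<dots> = 2 * (2 * U / ln a) ^ K / fact K"
        by (simp add: power_divide power_mult_distrib mult_ac)
      finally show ?thesis using model[of t] t unfolding r_def by auto
    qed
    have "integral {a..x} (\<lambda>t. f t - P) = integral {a..x} f - (x - a) * P"
      using cont assms(9) by (subst integral_diff) (auto intro: integrable_continuous_real)
    moreover have "norm (integral {a..x} (\<lambda>t. f t - P)) \<le> (e + 2 * (2 * U / ln a) ^ K / fact K) * (x - a)"
      using cont assms(9) bound by (intro integral_bound continuous_intros) auto
    moreover have "(e + 2 * (2 * U / ln a) ^ K / fact K) * (x - a) \<le> (e + 2 * (2 * U / ln a) ^ K / fact K) * x"
      using assms(11) U1 lna a2 by (intro mult_left_mono) auto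
    ultimately show ?thesis unfolding intf by (simp add: algebra_simps)
  qed
  have split: "(\<Sum>j=k..<K. c j * T j) = (\<Sum>j=k..<K. c j * (T j - W j * I j)) + (\<Sum>j=k..<K. c j * (W j * (I j - J j)))
      + (\<Sum>j=k..<K. c j * ((W j - V j) * J j)) + (\<Sum>j=k..<K. c j * (V j * J j))"
    by (simp add: sum.distrib[symmetric] algebra_simps)
  have collect: "\<bar>n - q\<bar> \<le> b1 + b2 + b3 + b4 + b5 + \<bar>r\<bar>"
    if "\<bar>n - s\<bar> \<le> b1" "\<bar>s2\<bar> \<le> b2" "\<bar>s3\<bar> \<le> b3" "\<bar>s4\<bar> \<le> b4" "\<bar>s5 - q'\<bar> \<le> b5"
      "s = s2 + s3 + s4 + s5" "q' = q - r" for n q b1 b2 b3 b4 b5 r s s2 s3 s4 s5 q' :: real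
    using that by linarith
  define t1 t2 t3 t4 where "t1 = x * (2 * U / ln a) ^ K / fact K" and "t2 = a * (4 * U) ^ K"
    and "t3 = (2 * real M) ^ K * (x * E)" and "t4 = x * (2 * real K ^ 3 * (2 * U) ^ K / real z)"
  have "(4::real) ^ K = 2 ^ K * 2 ^ K" by (simp add: power_mult_distrib[symmetric])
  then have eqs: "real K * 2 ^ K * (U ^ K * (a * 2 ^ K)) = real K * t2"
    "real K * 2 ^ K * (real M ^ K * (x * E)) = real K * t3"
    "real K * 2 ^ K * (2 * U ^ K * ((real K)\<^sup>2 / real z) * x) = t4"
    "2 * x * (2 * U / ln a) ^ K / fact K = 2 * t1"
    by (simp_all add: t1_def t2_def t3_def t4_def power_mult_distrib power2_eq_square power3_eq_cube mult_ac)
  have "\<bar>real (num_intervals A x y k) - x * P\<bar>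
      \<le> (t1 + t2 + t3) + real K * t3 + real K * t2 + t4 + (x * e + 2 * t1) + \<bar>a * P\<bar>"
    using collect[OF T1 T2 T3 T4 T5 split left_diff_distrib]
    unfolding eqs t1_def[symmetric] t2_def[symmetric] t3_def[symmetric] .
  also have "\<bar>a * P\<bar> = a * \<bar>P\<bar>" using a2 by (simp add: abs_mult)
  also have "(t1 + t2 + t3) + real K * t3 + real K * t2 + t4 + (x * e + 2 * t1) + a * \<bar>P\<bar>
    = x * e + a * \<bar>P\<bar> + 3 * t1 + (real K + 1) * t2 + t4 + (real K + 1) * t3"
    by (simp add: algebra_simps)
  finally show ?thesis unfolding t1_def t2_def t3_def t4_def by (simp add: mult_ac)
qed

subsection \<open>Concentration of the sieved set\<close>

lemma power_le_fact_mult_binomial: "(n - k) ^ k \<le> fact k * (n choose k)"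
proof (induction k)
  case (Suc k)
  have "(n - Suc k) ^ Suc k \<le> (n - k) * (n - k) ^ k"
    by (simp only: power_Suc) (intro mult_mono power_mono; simp)
  also have "\<dots> \<le> (n - k) * (fact k * (n choose k))" by (intro mult_left_mono Suc) simp
  also have "\<dots> = fact k * ((n - k) * (n choose k))" by simp
  also have "(n - k) * (n choose k) = Suc k * (n choose Suc k)"
    by (simp only: binomial_absorb_comp binomial_absorption)
  finally show ?case by (simp add: algebra_simps)
qed simp

lemma power_div_fact_le_exp:
  fixes l :: real
  assumes "0 \<le> l"
  shows "l ^ k / fact k \<le> exp l"
proof -
  have "(\<Sum>i\<in>{k}. inverse (fact i) * l ^ i) \<le> (\<Sum>i. inverse (fact i) * l ^ i)"
    using assms by (intro sum_le_suminf summable_exp) auto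
  also have "\<dots> = exp l" by (simp add: exp_def scaleR_conv_of_real)
  finally show ?thesis by (simp add: field_simps)
qed

lemma thinned_prob_nonneg: "0 \<le> r \<Longrightarrow> r \<le> 1 \<Longrightarrow> 0 \<le> thinned_prob r k S"
  by (simp add: thinned_prob_def)

lemma thinned_prob_le_1:
  assumes "0 \<le> r" "r \<le> 1"
  shows "thinned_prob r k S \<le> 1"
proof (cases "k \<le> card S")
  case True
  have "(\<Sum>i\<in>{k}. real (card S choose i) * r ^ i * (1 - r) ^ (card S - i))
      \<le> (\<Sum>i\<le>card S. real (card S choose i) * r ^ i * (1 - r) ^ (card S - i))"
    using assms True by (intro sum_mono2) auto
  also have "\<dots> = (r + (1 - r)) ^ card S" by (rule binomial_ring[symmetric])
  finally show ?thesis by (simp add: thinned_prob_def)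
qed (simp add: thinned_prob_def binomial_eq_0)

text \<open>Binomial against Poisson. In \<open>\<epsilon>\<close>, the term
  \<open>(k + l) * \<eta>\<close> is the uncertainty of the mean \<open>n * r\<close>, felt both in
  \<open>l ^ k\<close> and in \<open>exp (- l)\<close>; \<open>r * k\<close> comes from the exponent
  \<open>n - k\<close>, \<open>k\<^sup>2 * r / l\<close> from the falling factorial, and
  \<open>4 * r * l\<close> from \<open>ln (1 - r) \<ge> - r - 2 * r\<^sup>2\<close>.\<close>

lemma thinned_prob_approx_poisson:
  fixes l \<eta> r :: real and S :: "nat set" and k :: nat
  defines "n \<equiv> card S" and "P \<equiv> exp (- l) * l ^ k / fact k"
  defines "\<epsilon> \<equiv> (real k + l) * \<eta> + r * real k + (real k)\<^sup>2 * r / l + 4 * r * l"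
  assumes "0 \<le> r" "r \<le> 1 / 2" "0 < l" "0 \<le> \<eta>" "\<eta> \<le> 1" "k \<le> n"
    and lo: "l * (1 - \<eta>) \<le> real n * r" and hi: "real n * r \<le> l * (1 + \<eta>)"
    and "\<epsilon> \<le> 1"
  shows "\<bar>thinned_prob r k S - P\<bar> \<le> 2 * \<epsilon> * P"
proof -
  have P0: "0 \<le> P" using assms by (simp add: P_def)
  have G: "thinned_prob r k S = real (n choose k) * r ^ k * (1 - r) ^ (n - k)"
    by (simp add: thinned_prob_def n_def)
  have terms: "0 \<le> (real k + l) * \<eta>" "0 \<le> r * real k" "0 \<le> (real k)\<^sup>2 * r / l" "0 \<le> 4 * r * l"
    using assms by auto
  have "thinned_prob r k S \<le> (real n ^ k / fact k) * r ^ k * exp (- r * (real n - real k))"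
  proof -
    have "(1 - r) ^ (n - k) \<le> exp (- r) ^ (n - k)"
      using assms(4,5) exp_ge_add_one_self[of "- r"] by (intro power_mono) auto
    also have "\<dots> = exp (- r * (real n - real k))"
      using \<open>k \<le> n\<close> by (simp add: exp_of_nat_mult[symmetric] of_nat_diff mult.commute)
    finally show ?thesis unfolding G using assms(4,5)
      by (intro mult_mono binomial_le_power_div_fact) auto
  qed
  also have "\<dots> = (real n * r) ^ k / fact k * exp (- (real n * r) + r * real k)"
    by (simp add: power_mult_distrib algebra_simps)
  also have "\<dots> \<le> (l * (1 + \<eta>)) ^ k / fact k * exp (- (l * (1 - \<eta>)) + r * real k)"
    using lo assms(4,6,7) by (intro mult_mono[OF divide_right_mono[OF power_mono[OF hi]]]) auto
  also have "\<dots> \<le> (l ^ k * exp (real k * \<eta>)) / fact k * exp (- (l * (1 - \<eta>)) + r * real k)"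
  proof -
    have "(1 + \<eta>) ^ k \<le> exp \<eta> ^ k" using assms by (intro power_mono exp_ge_add_one_self) auto
    then have "l ^ k * (1 + \<eta>) ^ k \<le> l ^ k * exp (real k * \<eta>)"
      using assms by (intro mult_left_mono) (auto simp: exp_of_nat_mult)
    then show ?thesis by (intro mult_right_mono divide_right_mono) (auto simp: power_mult_distrib)
  qed
  also have "\<dots> = P * exp ((real k + l) * \<eta> + r * real k)"
    by (simp add: P_def exp_add[symmetric] algebra_simps)
  also have "\<dots> \<le> P * exp \<epsilon>" using P0 terms by (intro mult_left_mono) (auto simp: \<epsilon>_def)
  also have "\<dots> \<le> P * (1 + 2 * \<epsilon>)"
  proof (rule mult_left_mono[OF _ P0])
    have "0 \<le> \<epsilon>" using terms by (simp add: \<epsilon>_def)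
    then have "exp \<epsilon> \<le> 1 + \<epsilon> + \<epsilon>\<^sup>2" using \<open>\<epsilon> \<le> 1\<close> by (intro exp_bound)
    moreover have "\<epsilon>\<^sup>2 \<le> \<epsilon>" using \<open>0 \<le> \<epsilon>\<close> \<open>\<epsilon> \<le> 1\<close> by (simp add: power2_eq_square mult_left_le)
    ultimately show "exp \<epsilon> \<le> 1 + 2 * \<epsilon>" by linarith
  qed
  finally have upper: "thinned_prob r k S \<le> P + 2 * \<epsilon> * P" using P0 by (simp add: algebra_simps)
  \<comment> \<open>For the lower bound, \<open>A\<close> collects the losses in the
    \<open>k\<close>-th power and \<open>B\<close> those in the exponential.\<close>
  define A where "A = real k * (\<eta> + real k * r / l)"
  define B where "B = l * \<eta> + 4 * r * l"
  have A0: "0 \<le> A" and B0: "0 \<le> B" using assms by (auto simp: A_def B_def)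
  have AB: "A + B \<le> \<epsilon>" using terms by (simp add: A_def B_def \<epsilon>_def algebra_simps power2_eq_square)
  have A_le: "l ^ k * (1 - A) \<le> ((real n - real k) * r) ^ k"
  proof (cases "k = 0")
    case False
    have u: "\<eta> + real k * r / l \<le> 1"
    proof -
      have "1 * (\<eta> + real k * r / l) \<le> A" unfolding A_def using False assms by (intro mult_right_mono) auto
      then have "\<eta> + real k * r / l \<le> A" by simp
      also have "A \<le> A + B" using B0 by simp
      also note AB
      also note \<open>\<epsilon> \<le> 1\<close>
      finally show ?thesis .
    qed
    define v where "v = \<eta> + real k * r / l"
    have "1 + real k * (- v) \<le> (1 + (- v)) ^ k"
      using u unfolding v_def[symmetric] by (intro Bernoulli_inequality) linarith
    moreover have "A = real k * v" by (simp add: A_def v_def)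
    ultimately have "l ^ k * (1 - A) \<le> l ^ k * (1 - v) ^ k"
      using \<open>0 < l\<close> by (intro mult_left_mono) auto
    then have "l ^ k * (1 - A) \<le> l ^ k * (1 - (\<eta> + real k * r / l)) ^ k" by (simp only: v_def)
    also have "\<dots> = (l * (1 - \<eta>) - real k * r) ^ k"
    proof -
      have "l * (1 - (\<eta> + real k * r / l)) = l * (1 - \<eta>) - real k * r"
        using \<open>0 < l\<close> by (simp add: field_simps)
      then show ?thesis by (metis power_mult_distrib)
    qed
    also have "\<dots> \<le> ((real n - real k) * r) ^ k"
    proof (rule power_mono)
      have "0 \<le> l * (1 - (\<eta> + real k * r / l))" using u assms by simp
      also have "\<dots> = l * (1 - \<eta>) - real k * r" using assms(6) by (simp add: field_simps)
      finally show "0 \<le> l * (1 - \<eta>) - real k * r" .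
      show "l * (1 - \<eta>) - real k * r \<le> (real n - real k) * r" using lo by (simp add: left_diff_distrib)
    qed
    finally show ?thesis .
  qed (simp add: A_def)
  have B_le: "exp (- l) * (1 - B) \<le> (1 - r) ^ (n - k)"
  proof -
    have "1 + (- B) \<le> exp (- B)" by (rule exp_ge_add_one_self)
    then have "exp (- l) * (1 - B) \<le> exp (- l) * exp (- B)" by (intro mult_left_mono) auto
    also have "\<dots> = exp (- (l * (1 + \<eta>)) - 2 * r * (2 * l))"
      by (simp add: B_def exp_add[symmetric] algebra_simps)
    also have "\<dots> \<le> exp (- (real n * r) - 2 * r * (real n * r))"
    proof -
      have "l * (1 + \<eta>) \<le> l * 2" using assms(6,8) by (intro mult_left_mono) auto
      then have "real n * r \<le> 2 * l" using hi by linarith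
      then have "2 * r * (real n * r) \<le> 2 * r * (2 * l)" using assms(4) by (intro mult_left_mono) auto
      then show ?thesis using hi by (subst exp_le_cancel_iff) linarith
    qed
    also have "\<dots> = exp (real n * (- r - 2 * r\<^sup>2))" by (simp add: algebra_simps power2_eq_square)
    also have "\<dots> \<le> exp (real n * ln (1 - r))"
      using ln_one_minus_pos_lower_bound[of r] assms(4,5) by (simp add: mult_left_mono)
    also have "\<dots> = (1 - r) ^ n" using assms(5) by (simp add: exp_of_nat_mult)
    also have "\<dots> \<le> (1 - r) ^ (n - k)" using assms(4,5) by (intro power_decreasing) auto
    finally show ?thesis .
  qed
  have "P * (1 - \<epsilon>) \<le> P * ((1 - A) * (1 - B))"
  proof (rule mult_left_mono[OF _ P0])
    have "(1 - A) * (1 - B) = 1 - (A + B) + A * B" by (simp add: algebra_simps)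
    then show "1 - \<epsilon> \<le> (1 - A) * (1 - B)" using AB mult_nonneg_nonneg[OF A0 B0] by linarith
  qed
  also have "\<dots> = (l ^ k * (1 - A)) * (exp (- l) * (1 - B)) / fact k" by (simp add: P_def)
  also have "\<dots> \<le> ((real n - real k) * r) ^ k * (1 - r) ^ (n - k) / fact k"
    using A_le B_le A0 B0 AB assms by (intro divide_right_mono mult_mono) auto
  also have "\<dots> \<le> real (n choose k) * r ^ k * (1 - r) ^ (n - k)"
  proof -
    have "real ((n - k) ^ k) \<le> real (fact k * (n choose k))"
      by (subst of_nat_le_iff) (rule power_le_fact_mult_binomial)
    then have "(real n - real k) ^ k \<le> fact k * real (n choose k)" using \<open>k \<le> n\<close> by (simp add: of_nat_diff)
    then have "(real n - real k) ^ k * (r ^ k * (1 - r) ^ (n - k)) \<le> fact k * real (n choose k) * (r ^ k * (1 - r) ^ (n - k))"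
      using assms(4,5) by (intro mult_right_mono) auto
    then show ?thesis by (simp add: power_mult_distrib pos_divide_le_eq mult_ac)
  qed
  finally have "P - \<epsilon> * P \<le> thinned_prob r k S" unfolding G by (simp add: algebra_simps)
  moreover have "0 \<le> \<epsilon> * P" using AB A0 B0 P0 by (intro mult_nonneg_nonneg) auto
  ultimately show ?thesis using upper by (simp add: abs_le_iff)
qed

section \<open>Deviations of the size of the sieved set\<close>

lemma sum_primes_between_inverse_squares:
  assumes "1 \<le> w"
  shows "(\<Sum>p\<leftarrow>primes_between w M. 1 / (real p)\<^sup>2) \<le> 1 / real w"
proof -
  have "(\<Sum>p\<leftarrow>primes_between w M. 1 / (real p)\<^sup>2) = (\<Sum>p | prime p \<and> w < p \<and> p \<le> M. 1 / (real p)\<^sup>2)"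
    using sum.distinct_set_conv_list[OF distinct_primes_between, of "\<lambda>p. 1 / (real p)\<^sup>2" w M]
    by (simp add: set_primes_between)
  also have "\<dots> \<le> (\<Sum>p\<in>{w<..M}. 1 / (real p)\<^sup>2)" by (intro sum_mono2) auto
  also have "\<dots> \<le> 1 / real w"
    using sum_inverse_squares_tail[OF assms, of M] by (cases "w \<le> M") (auto intro: order_trans)
  finally show ?thesis .
qed

lemma prod_primes_between:
  assumes "m \<le> n"
  shows "(\<Prod>p\<leftarrow>primes_between m n. 1 - 1 / real p) = mertens_prod n / mertens_prod m"
proof -
  have "mertens_prod n = (\<Prod>p\<leftarrow>primes_between 0 n. 1 - 1 / real p)"
    by (simp add: mertens_prod_def prod_list_primes_upto)
  also have "primes_between 0 n = primes_between 0 m @ primes_between m n"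
    using assms by (intro primes_between_append) auto
  finally have "mertens_prod n = mertens_prod m * (\<Prod>p\<leftarrow>primes_between m n. 1 - 1 / real p)"
    by (simp add: mertens_prod_def prod_list_primes_upto)
  then show ?thesis using mertens_prod_pos[of m] by simp
qed

lemma mertens_prod_antimono: "m \<le> n \<Longrightarrow> mertens_prod n \<le> mertens_prod m"
proof -
  assume mn: "m \<le> n"
  have "(\<Prod>p\<leftarrow>primes_between m n. 1 - 1 / real p) \<le> 1"
    unfolding prod_list_primes_between
  proof (rule prod_le_1, safe)
    fix p :: nat assume "prime p"
    then show "0 \<le> 1 - 1 / real p" using prime_gt_1_nat[of p] by (simp add: field_simps)
  qed auto
  then show ?thesis using mn mertens_prod_pos[of m] by (simp add: prod_primes_between)
qed

text \<open>For primes up to \<open>M\<close> a residue class meets \<open>{1..M}\<close> in at most \<open>2 * M / p\<close> points, for larger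
  primes in at most one. Normalising by the survival probability costs a power of \<open>ln M\<close> in the
  first range and a power of \<open>ln z\<close> in the second, where only the smaller variance affords it.\<close>

lemma sieve_avg_exp_two_ranges:
  fixes M w z :: nat and s :: real and R :: "nat set"
  assumes "1 \<le> w" "w \<le> M" "M \<le> z" "R \<subseteq> {1..M}" "\<bar>s\<bar> * 2 \<le> 1"
  defines "D \<equiv> mertens_prod z / mertens_prod M"
  assumes "\<bar>s\<bar> * D * (2 * real M / real w) \<le> 1"
  shows "sieve_avg (primes_between w z) (\<lambda>S. exp (s * real (card S))) R
    \<le> exp (s * (mertens_prod z / mertens_prod w) * real (card R)
        + s\<^sup>2 * (D\<^sup>2 * (2 * (real M)\<^sup>2 / real w) + 2 * real M * prime_recip_sum z))"
proof -
  have D0: "0 \<le> D" unfolding D_def using mertens_prod_pos by (simp add: less_imp_le)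
  define V where "V = 2 * real M * prime_recip_sum z"
  have M0: "real M > 0" using assms by simp
  have ge2: "p \<ge> 2" if "p \<in> set (primes_between m n)" for p m n
    using that prime_ge_2_nat by (auto simp: set_primes_between)
  have outer: "sieve_avg (primes_between M z) (\<lambda>S. exp (s * real (card S))) S
      \<le> exp (s\<^sup>2 * V) * exp (s * D * real (card S))" if "S \<subseteq> R" for S
  proof -
    have le: "(real M / real p + 1) \<le> 2" if "p \<in> set (primes_between M z)" for p
      using that ge2[OF that] by (auto simp: set_primes_between field_simps)
    have "sieve_avg (primes_between M z) (\<lambda>S. exp (s * real (card S))) S
      \<le> exp (s * D * real (card S)
          + s\<^sup>2 * (\<Sum>p\<leftarrow>primes_between M z. (real M / real p + 1) * (real M / real p)))"
      unfolding D_def prod_primes_between[OF assms(3), symmetric]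
    proof (rule sieve_avg_exp_le)
      fix p assume p: "p \<in> set (primes_between M z)"
      have "\<bar>s\<bar> * (real M / real p + 1) \<le> \<bar>s\<bar> * 2" using le[OF p] by (intro mult_left_mono) auto
      then show "\<bar>s\<bar> * (real M / real p + 1) \<le> 1" using assms(5) by linarith
    qed (use ge2 that assms(4) in auto)
    also have "(\<Sum>p\<leftarrow>primes_between M z. (real M / real p + 1) * (real M / real p)) \<le> V"
    proof -
      have "(\<Sum>p\<leftarrow>primes_between M z. (real M / real p + 1) * (real M / real p))
          \<le> (\<Sum>p\<leftarrow>primes_between M z. 2 * real M * (1 / real p))"
      proof (rule sum_list_mono)
        fix p assume "p \<in> set (primes_between M z)"
        from mult_right_mono[OF le[OF this], of "real M / real p"]
        show "(real M / real p + 1) * (real M / real p) \<le> 2 * real M * (1 / real p)" by simp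
      qed
      also have "\<dots> = 2 * real M * (\<Sum>p | prime p \<and> M < p \<and> p \<le> z. 1 / real p)"
        using sum.distinct_set_conv_list[OF distinct_primes_between, of "\<lambda>p. 2 * real M * (1 / real p)" M z]
        by (simp add: set_primes_between sum_distrib_left)
      also have "\<dots> \<le> V" unfolding V_def prime_recip_sum_def
        by (intro mult_left_mono sum_mono2 finite_primes_le) auto
      finally show ?thesis .
    qed
    finally show ?thesis by (simp add: exp_add[symmetric] add.commute mult_left_mono)
  qed
  have inner: "sieve_avg (primes_between w M) (\<lambda>S. exp (s * D * real (card S))) R
      \<le> exp (s * D * (mertens_prod M / mertens_prod w) * real (card R) + (s * D)\<^sup>2 * (2 * (real M)\<^sup>2 / real w))"
  proof -
    have le: "(real M / real p + 1) \<le> 2 * real M / real p" if "p \<in> set (primes_between w M)" for p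
      using that ge2[OF that] by (auto simp: set_primes_between field_simps)
    have "sieve_avg (primes_between w M) (\<lambda>S. exp (s * D * real (card S))) R
      \<le> exp (s * D * (mertens_prod M / mertens_prod w) * real (card R)
          + (s * D)\<^sup>2 * (\<Sum>p\<leftarrow>primes_between w M. (real M / real p + 1) * (real M / real p)))"
      unfolding prod_primes_between[OF assms(2), symmetric]
    proof (rule sieve_avg_exp_le)
      fix p assume p: "p \<in> set (primes_between w M)"
      have "\<bar>s * D\<bar> * (real M / real p + 1) \<le> \<bar>s\<bar> * D * (2 * real M / real w)"
      proof -
        have "2 * real M / real p \<le> 2 * real M / real w"
          using p assms(1) by (intro divide_left_mono) (auto simp: set_primes_between)
        then show ?thesis using le[OF p] D0 by (simp only: abs_mult abs_of_nonneg) (intro mult_left_mono, auto)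
      qed
      then show "\<bar>s * D\<bar> * (real M / real p + 1) \<le> 1" using assms(7) by linarith
    qed (use ge2 assms(4) in auto)
    also have "(\<Sum>p\<leftarrow>primes_between w M. (real M / real p + 1) * (real M / real p)) \<le> 2 * (real M)\<^sup>2 / real w"
    proof -
      have "(\<Sum>p\<leftarrow>primes_between w M. (real M / real p + 1) * (real M / real p))
          \<le> (\<Sum>p\<leftarrow>primes_between w M. 2 * (real M)\<^sup>2 * (1 / (real p)\<^sup>2))"
      proof (rule sum_list_mono)
        fix p assume "p \<in> set (primes_between w M)"
        from mult_right_mono[OF le[OF this], of "real M / real p"]
        show "(real M / real p + 1) * (real M / real p) \<le> 2 * (real M)\<^sup>2 * (1 / (real p)\<^sup>2)"
          by (simp add: power2_eq_square)
      qed
      also have "\<dots> = 2 * (real M)\<^sup>2 * (\<Sum>p\<leftarrow>primes_between w M. 1 / (real p)\<^sup>2)"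
        by (rule sum_list_const_mult)
      also have "\<dots> \<le> 2 * (real M)\<^sup>2 * (1 / real w)"
        using sum_primes_between_inverse_squares[OF assms(1)] by (intro mult_left_mono) auto
      finally show ?thesis by simp
    qed
    finally show ?thesis by (simp add: mult_left_mono)
  qed
  have "primes_between w z = primes_between w M @ primes_between M z"
    using assms(2,3) by (rule primes_between_append)
  \<comment> \<open>The primes above \<open>M\<close> are averaged out first, which leaves an
    exponential moment with slope \<open>s * D\<close> for the primes up to
    \<open>M\<close>.\<close>
  then have "sieve_avg (primes_between w z) (\<lambda>S. exp (s * real (card S))) R
      = sieve_avg (primes_between w M) (sieve_avg (primes_between M z) (\<lambda>S. exp (s * real (card S)))) R"
    by (simp add: sieve_avg_append)
  also have "\<dots> \<le> sieve_avg (primes_between w M) (\<lambda>S. exp (s\<^sup>2 * V) * exp (s * D * real (card S))) R"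
    by (intro sieve_avg_mono outer)
  also have "\<dots> \<le> exp (s\<^sup>2 * V) * exp (s * D * (mertens_prod M / mertens_prod w) * real (card R) + (s * D)\<^sup>2 * (2 * (real M)\<^sup>2 / real w))"
    unfolding sieve_avg_cmult by (intro mult_left_mono inner) auto
  also have "\<dots> = exp (s * (mertens_prod z / mertens_prod w) * real (card R)
        + s\<^sup>2 * (D\<^sup>2 * (2 * (real M)\<^sup>2 / real w) + V))"
    using mertens_prod_pos[of M]
    by (simp add: exp_add[symmetric] D_def power_mult_distrib power_divide algebra_simps)
  finally show ?thesis by (simp add: V_def)
qed

text \<open>A two-sided Chernoff bound. One factor \<open>1 + \<delta>\<close> or
  \<open>1 - \<delta>\<close> is inherited from \<open>R\<close>, the other is spent on the primes
  above \<open>w\<close>. The first condition in \<open>small\<close> keeps the variance from primes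
  above \<open>M\<close> below that from primes between \<open>w\<close> and \<open>M\<close>; the
  second keeps the slope \<open>s\<close> admissible.\<close>

lemma sieve_avg_deviation:
  fixes M w z :: nat and \<delta> :: real and R :: "nat set"
  assumes "1 \<le> w" "w \<le> M" "M \<le> z" "R \<subseteq> {1..M}" "0 < \<delta>" "\<delta> \<le> 1 / 2"
  defines "X \<equiv> real M * mertens_prod z"
  assumes R: "(1 - \<delta>) * (real M * mertens_prod w) \<le> real (card R)"
      "real (card R) \<le> (1 + \<delta>) * (real M * mertens_prod w)"
    and small: "real w * prime_recip_sum z * (mertens_prod M)\<^sup>2 \<le> (mertens_prod z)\<^sup>2 * real M"
      "real w \<le> X"
  shows "sieve_avg (primes_between w z)
      (\<lambda>S. of_bool (\<not> ((1 - \<delta>)\<^sup>2 * X \<le> real (card S) \<and> real (card S) \<le> (1 + \<delta>)\<^sup>2 * X))) R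
    \<le> 2 * exp (- (\<delta>\<^sup>2 * (mertens_prod M)\<^sup>2 * real w / 64))"
proof -
  define \<Theta> where "\<Theta> = mertens_prod M"
  define D where "D = mertens_prod z / \<Theta>"
  \<comment> \<open>This value minimises \<open>4 * s\<^sup>2 * X\<^sup>2 / (\<Theta>\<^sup>2 * w) -
    s * \<delta> * X / 2\<close>, variance against deviation; the minimum is the exponent with
    64.\<close>
  define s where "s = \<delta> * \<Theta>\<^sup>2 * real w / (16 * X)"
  define Y where "Y = mertens_prod z / mertens_prod w * real (card R)"
  have pos: "mertens_prod z > 0" "mertens_prod w > 0" "\<Theta> > 0" "\<Theta> \<le> 1" "real M > 0" "real w > 0"
    using assms mertens_prod_pos mertens_prod_le_1 by (auto simp: \<Theta>_def)
  have X0: "X > 0" using pos by (simp add: X_def)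
  have s0: "s > 0" using pos X0 assms by (simp add: s_def)
  have Y: "(1 - \<delta>) * X \<le> Y" "Y \<le> (1 + \<delta>) * X"
  proof -
    have "mertens_prod z / mertens_prod w * ((1 - \<delta>) * (real M * mertens_prod w)) \<le> Y"
      "Y \<le> mertens_prod z / mertens_prod w * ((1 + \<delta>) * (real M * mertens_prod w))"
      unfolding Y_def using R pos by (intro mult_left_mono; simp)+
    then show "(1 - \<delta>) * X \<le> Y" "Y \<le> (1 + \<delta>) * X" using pos by (auto simp: X_def mult_ac)
  qed
  have \<Theta>2: "\<Theta>\<^sup>2 \<le> 1" using pos by (simp add: power_le_one)
  have c1: "s * 2 \<le> 1"
  proof -
    have "\<delta> * \<Theta>\<^sup>2 * real w \<le> 1 * 1 * X" using assms pos \<Theta>2 X0 by (intro mult_mono) auto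
    then show ?thesis using X0 by (simp add: s_def field_simps)
  qed
  have c2: "s * D * (2 * real M / real w) \<le> 1"
  proof -
    have "s * D * (2 * real M / real w) = \<delta> * \<Theta> / 8"
      using pos by (simp add: s_def D_def X_def power2_eq_square field_simps)
    also have "\<dots> \<le> 1 * 1 / 8" using assms pos by (intro divide_right_mono mult_mono) auto
    finally show ?thesis by simp
  qed
  have var: "s\<^sup>2 * (D\<^sup>2 * (2 * (real M)\<^sup>2 / real w) + 2 * real M * prime_recip_sum z) \<le> s * \<delta> * X / 4"
  proof -
    have "2 * real M * prime_recip_sum z \<le> D\<^sup>2 * (2 * (real M)\<^sup>2 / real w)"
    proof -
      have "real w * prime_recip_sum z * \<Theta>\<^sup>2 * (2 * real M) \<le> (mertens_prod z)\<^sup>2 * real M * (2 * real M)"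
        using small(1) pos unfolding \<Theta>_def by (intro mult_right_mono) auto
      then show ?thesis using pos by (simp add: D_def power_divide field_simps power2_eq_square)
    qed
    then have "s\<^sup>2 * (D\<^sup>2 * (2 * (real M)\<^sup>2 / real w) + 2 * real M * prime_recip_sum z)
        \<le> s\<^sup>2 * (2 * (D\<^sup>2 * (2 * (real M)\<^sup>2 / real w)))"
      by (intro mult_left_mono) (linarith, simp)
    also have "\<dots> = s\<^sup>2 * (D\<^sup>2 * (4 * (real M)\<^sup>2 / real w))" by simp
    also have "\<dots> = s * (s * (D\<^sup>2 * (4 * (real M)\<^sup>2 / real w)))" by (simp add: power2_eq_square)
    also have "s * (D\<^sup>2 * (4 * (real M)\<^sup>2 / real w)) = \<delta> * X / 4"
      using pos by (simp add: s_def D_def X_def power2_eq_square field_simps)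
    finally show ?thesis by simp
  qed
  have expo: "s * \<delta> * X / 4 = \<delta>\<^sup>2 * \<Theta>\<^sup>2 * real w / 64"
    using X0 by (simp add: s_def power2_eq_square)
  let ?A = "\<lambda>f. sieve_avg (primes_between w z) f R"
  have tail: "?A (\<lambda>S. exp (s' * (real (card S) - t))) \<le> exp (- (\<delta>\<^sup>2 * \<Theta>\<^sup>2 * real w / 64))"
    if "\<bar>s'\<bar> = s" "s' * Y - s' * t \<le> - (s * \<delta> * X / 2)" for s' t
  proof -
    have "?A (\<lambda>S. exp (s' * (real (card S) - t))) = ?A (\<lambda>S. exp (- s' * t) * exp (s' * real (card S)))"
      by (simp add: exp_add[symmetric] algebra_simps)
    also have "\<dots> = exp (- s' * t) * ?A (\<lambda>S. exp (s' * real (card S)))" by (rule sieve_avg_cmult)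
    also have "\<dots> \<le> exp (- s' * t) * exp (s' * (mertens_prod z / mertens_prod w) * real (card R)
        + s'\<^sup>2 * (D\<^sup>2 * (2 * (real M)\<^sup>2 / real w) + 2 * real M * prime_recip_sum z))"
      unfolding D_def \<Theta>_def using assms(1-4) c1 c2 that(1) unfolding D_def \<Theta>_def
      by (intro mult_left_mono sieve_avg_exp_two_ranges) auto
    also have "s'\<^sup>2 = s\<^sup>2" using that(1) by (metis power2_abs)
    also have "exp (- s' * t) * exp (s' * (mertens_prod z / mertens_prod w) * real (card R)
        + s\<^sup>2 * (D\<^sup>2 * (2 * (real M)\<^sup>2 / real w) + 2 * real M * prime_recip_sum z))
        \<le> exp (- s' * t + s' * Y + s * \<delta> * X / 4)"
      using var by (simp add: exp_add[symmetric] Y_def mult_ac)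
    also have "\<dots> \<le> exp (- (s * \<delta> * X / 4))" using that(2) by (subst exp_le_cancel_iff) linarith
    finally show ?thesis by (simp add: expo)
  qed
  have Yhalf: "X / 2 \<le> Y" 
  proof -
    have "1 / 2 * X \<le> (1 - \<delta>) * X" using assms(6) X0 by (intro mult_right_mono) auto
    then show ?thesis using Y(1) by linarith
  qed
  have dev: "s * \<delta> * X / 2 \<le> s * \<delta> * Y" using Yhalf s0 assms(5) mult_left_mono[of "X / 2" Y "s * \<delta>"] by simp
  have up: "?A (\<lambda>S. exp (s * (real (card S) - (1 + \<delta>) * Y))) \<le> exp (- (\<delta>\<^sup>2 * \<Theta>\<^sup>2 * real w / 64))"
    using s0 dev by (intro tail) (auto simp: algebra_simps)
  have down: "?A (\<lambda>S. exp (- s * (real (card S) - (1 - \<delta>) * Y))) \<le> exp (- (\<delta>\<^sup>2 * \<Theta>\<^sup>2 * real w / 64))"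
    using s0 dev by (intro tail) (auto simp: algebra_simps)
  have "?A (\<lambda>S. of_bool (\<not> ((1 - \<delta>)\<^sup>2 * X \<le> real (card S) \<and> real (card S) \<le> (1 + \<delta>)\<^sup>2 * X)))
      \<le> ?A (\<lambda>S. exp (s * (real (card S) - (1 + \<delta>) * Y)) + exp (- s * (real (card S) - (1 - \<delta>) * Y)))"
  proof (rule sieve_avg_mono)
    fix S
    have "(1 - \<delta>)\<^sup>2 * X \<le> (1 - \<delta>) * Y" "(1 + \<delta>) * Y \<le> (1 + \<delta>)\<^sup>2 * X"
      using mult_left_mono[OF Y(1), of "1 - \<delta>"] mult_left_mono[OF Y(2), of "1 + \<delta>"] assms(5,6)
      by (auto simp: power2_eq_square mult_ac)
    moreover have "1 \<le> exp (s * (real (card S) - (1 + \<delta>) * Y))" if "(1 + \<delta>) * Y \<le> real (card S)"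
      using that s0 by simp
    moreover have "1 \<le> exp (- s * (real (card S) - (1 - \<delta>) * Y))" if "real (card S) \<le> (1 - \<delta>) * Y"
      using that s0 by (simp add: mult_le_0_iff)
    ultimately show "of_bool (\<not> ((1 - \<delta>)\<^sup>2 * X \<le> real (card S) \<and> real (card S) \<le> (1 + \<delta>)\<^sup>2 * X))
        \<le> exp (s * (real (card S) - (1 + \<delta>) * Y)) + exp (- s * (real (card S) - (1 - \<delta>) * Y))"
      using exp_ge_zero[of "s * (real (card S) - (1 + \<delta>) * Y)"] exp_ge_zero[of "- s * (real (card S) - (1 - \<delta>) * Y)"]
      by (simp only: of_bool_def split: if_splits) linarith
  qed
  then show ?thesis unfolding sieve_avg_add using up down by (simp add: \<Theta>_def)
qed

text \<open>On sets of the right size the Poisson approximation applies. On the others both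
  quantities lie in [0, 1], so they contribute at most their probability. Brun's sieve fixes the
  size after the primes up to \<open>w\<close> for every choice of classes, hence the deviation
  bound holds after each choice and passes to the average.\<close>

lemma sieve_model_estimate:
  fixes M w z k m :: nat and \<delta> \<eta> l r :: real
  defines "X \<equiv> real M * mertens_prod z" and "P \<equiv> exp (- l) * l ^ k / fact k"
  defines "\<epsilon> \<equiv> (real k + l) * \<eta> + r * real k + (real k)\<^sup>2 * r / l + 4 * r * l"
  assumes "1 \<le> w" "w \<le> M" "M \<le> z" "0 < \<delta>" "\<delta> \<le> 1 / 2"
    and small: "real w * prime_recip_sum z * (mertens_prod M)\<^sup>2 \<le> (mertens_prod z)\<^sup>2 * real M"
      "real w \<le> X"
    and brun: "2 * real M * (prime_recip_sum w ^ m / fact m) + (real w + 1) ^ m \<le> \<delta> * (real M * mertens_prod w)"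
    and "0 \<le> r" "r \<le> 1 / 2" "0 < l" "0 \<le> \<eta>" "\<eta> \<le> 1" "real k \<le> (1 - \<delta>)\<^sup>2 * X"
    and lo: "l * (1 - \<eta>) \<le> (1 - \<delta>)\<^sup>2 * X * r" and hi: "(1 + \<delta>)\<^sup>2 * X * r \<le> l * (1 + \<eta>)"
    and "\<epsilon> \<le> 1"
  shows "\<bar>sieve_avg (primes_between 0 z) (thinned_prob r k) {1..M} - P\<bar>
    \<le> 2 * \<epsilon> * P + 2 * exp (- (\<delta>\<^sup>2 * (mertens_prod M)\<^sup>2 * real w / 64))"
proof -
  let ?bad = "\<lambda>S :: nat set. \<not> ((1 - \<delta>)\<^sup>2 * X \<le> real (card S) \<and> real (card S) \<le> (1 + \<delta>)\<^sup>2 * X)"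
  let ?q = "2 * exp (- (\<delta>\<^sup>2 * (mertens_prod M)\<^sup>2 * real w / 64))"
  have pos: "p > 0" if "p \<in> set (primes_between m n)" for p m n
    using that by (auto simp: set_primes_between)
  have P: "0 \<le> P" "P \<le> 1"
    using power_div_fact_le_exp[of l k] assms(14) by (auto simp: P_def exp_minus field_simps)
  have \<epsilon>0: "0 \<le> \<epsilon>" using assms by (auto simp: \<epsilon>_def)
  have point: "\<bar>thinned_prob r k S - P\<bar> \<le> 2 * \<epsilon> * P + of_bool (?bad S)" for S
  proof (cases "?bad S")
    case True
    have "\<bar>thinned_prob r k S - P\<bar> \<le> 1"
    proof -
      have "0 \<le> thinned_prob r k S" "thinned_prob r k S \<le> 1"
        using assms(12,13) by (auto intro: thinned_prob_nonneg thinned_prob_le_1)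
      then show ?thesis using P by linarith
    qed
    then show ?thesis using True \<epsilon>0 P by (simp add: add_increasing)
  next
    case False
    then have S: "(1 - \<delta>)\<^sup>2 * X \<le> real (card S)" "real (card S) \<le> (1 + \<delta>)\<^sup>2 * X" by auto
    have "k \<le> card S" using S(1) assms(17) by linarith
    moreover have "l * (1 - \<eta>) \<le> real (card S) * r" "real (card S) * r \<le> l * (1 + \<eta>)"
      using mult_right_mono[OF S(1) assms(12)] mult_right_mono[OF S(2) assms(12)] lo hi by linarith+
    ultimately have "\<bar>thinned_prob r k S - P\<bar> \<le> 2 * \<epsilon> * P"
      unfolding P_def \<epsilon>_def using assms by (intro thinned_prob_approx_poisson) auto
    then show ?thesis by (simp add: False)
  qed
  have stage: "sieve_avg (primes_between w z) (\<lambda>S. of_bool (?bad S)) {h \<in> {1..M}. \<forall>p\<in>set (primes_between 0 w). h mod p \<noteq> a p} \<le> ?q"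
    if a: "\<And>p. p \<in> set (primes_between 0 w) \<Longrightarrow> a p < p" for a
  proof -
    let ?R = "{h \<in> {1..M}. \<forall>p\<in>set (primes_between 0 w). h mod p \<noteq> a p}"
    have eq: "set (primes_between 0 w) = {p. prime p \<and> p \<le> w}"
      by (auto simp: set_primes_between dest: prime_gt_0_nat)
    have "\<bar>real (card ?R) - real M * mertens_prod w\<bar>
        \<le> 2 * real M * (prime_recip_sum w ^ m / fact m) + (real (card {p. prime p \<and> p \<le> w}) + 1) ^ m"
      unfolding eq mertens_prod_def prime_recip_sum_def
      by (rule brun_pure_sieve) (use a eq finite_primes_le in auto)
    also have "(real (card {p. prime p \<and> p \<le> w}) + 1) ^ m \<le> (real w + 1) ^ m"
    proof -
      have "card {p. prime p \<and> p \<le> w} \<le> card {1..w}"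
        by (intro card_mono) (auto dest: prime_gt_0_nat simp: Suc_le_eq)
      then show ?thesis by (intro power_mono) auto
    qed
    finally have "\<bar>real (card ?R) - real M * mertens_prod w\<bar> \<le> \<delta> * (real M * mertens_prod w)"
      using brun by linarith
    then have "(1 - \<delta>) * (real M * mertens_prod w) \<le> real (card ?R)"
      "real (card ?R) \<le> (1 + \<delta>) * (real M * mertens_prod w)"
      by (auto simp: abs_le_iff algebra_simps)
    then show ?thesis using assms(4-8) small unfolding X_def
      by (intro sieve_avg_deviation) auto
  qed
  have "\<bar>sieve_avg (primes_between 0 z) (thinned_prob r k) {1..M} - P\<bar>
      = \<bar>sieve_avg (primes_between 0 z) (\<lambda>S. thinned_prob r k S - P) {1..M}\<bar>"
    using sieve_avg_const[of "primes_between 0 z" P "{1..M}"] pos by (simp add: sieve_avg_diff)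
  also have "\<dots> \<le> sieve_avg (primes_between 0 z) (\<lambda>S. \<bar>thinned_prob r k S - P\<bar>) {1..M}"
    by (rule sieve_avg_abs)
  also have "\<dots> \<le> sieve_avg (primes_between 0 z) (\<lambda>S. 2 * \<epsilon> * P + of_bool (?bad S)) {1..M}"
    by (intro sieve_avg_mono point)
  also have "\<dots> = 2 * \<epsilon> * P + sieve_avg (primes_between 0 z) (\<lambda>S. of_bool (?bad S)) {1..M}"
    using sieve_avg_const[of "primes_between 0 z" "2 * \<epsilon> * P" "{1..M}"] pos by (simp add: sieve_avg_add)
  also have "sieve_avg (primes_between 0 z) (\<lambda>S. of_bool (?bad S)) {1..M} \<le> ?q"
  proof -
    have "primes_between 0 z = primes_between 0 w @ primes_between w z"
      using assms by (intro primes_between_append) auto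
    then show ?thesis
      using sieve_avg_le_of_all_choices[OF distinct_primes_between, of 0 w
          "sieve_avg (primes_between w z) (\<lambda>S. of_bool (?bad S))" "{1..M}" ?q] pos stage
      by (simp only: sieve_avg_append)
  qed
  finally show ?thesis by simp
qed

subsection \<open>Asymptotic parameters\<close>

text \<open>Throughout \<open>u\<close> stands for \<open>ln (ln x)\<close>, and \<open>h = q * log_gauge u\<close>, where the interval has length
  at least \<open>exp (q\<^sup>2 * u)\<close>. The sieve acts deterministically up to \<open>w = exp (1.17 * h)\<close>, with
  \<open>m = 0.85 * q * sqrt (u / ln u)\<close> inclusion-exclusion steps, and relative deviations
  \<open>\<delta> = exp (- 0.39 * h)\<close> are allowed; \<open>k\<close> and \<open>l\<close> are at most \<open>T = exp (0.378 * h)\<close>, and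
  \<open>0.378\<close> slightly exceeds \<open>1 / sqrt 7\<close>. The constants must satisfy
  \<open>1.17 * 0.85 < 1\<close> (\<open>w ^ m\<close> is less than the length), \<open>0.85 / 2 > 0.39\<close> (Brun's main error
  \<open>m ^ (- m)\<close> is less than \<open>\<delta>\<close>), \<open>0.39 > 0.378\<close> (\<open>T * \<delta>\<close> is small) and
  \<open>1.17 - 2 * 0.39 > 0.378\<close> (\<open>\<delta>\<^sup>2 * w\<close> exceeds \<open>T\<close>).\<close>

definition log_gauge :: "real \<Rightarrow> real" where "log_gauge u = sqrt (u * ln u)"

text \<open>The bound of \<open>mertens_prod_ge\<close> for arguments up to
  \<open>exp (2 * u)\<close>, which covers the window; \<open>large_mertens\<close> is its analogue
  at the sieving limit, where \<open>ln z \<le> 1 + exp (u / 32)\<close>.\<close>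

definition small_mertens :: "real \<Rightarrow> real" where "small_mertens u = exp (- 6) / (1 + 2 * u) ^ 3"

definition large_mertens :: "real \<Rightarrow> real" where "large_mertens u = exp (- 6) / (2 + exp (u / 32)) ^ 3"

lemmas rate_defs = log_gauge_def small_mertens_def large_mertens_def

text \<open>The decimals are slacks. \<open>0.00275\<close> is half of
  \<open>1 - 1.17 * 0.85\<close>, since \<open>q\<^sup>2 \<ge> 1 / 2\<close>. \<open>0.01855\<close>
  is \<open>0.7 * (0.49 * 0.85 - 0.39)\<close>, where \<open>0.7\<close> bounds \<open>q\<close>
  from below and \<open>0.49\<close> stands for the exponent \<open>1 / 2\<close> of
  \<open>u\<close> in \<open>m\<close>.\<close>

definition brun_regime :: "real \<Rightarrow> bool" where
  "brun_regime u \<longleftrightarrow>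
    exp (0.85 * sqrt (u / ln u) + 0.39 * log_gauge u - 0.00275 * u) \<le> small_mertens u / 4 \<and>
    2 * exp (u powr 0.49 * (4 + 2 * ln (1 + 1.17 * log_gauge u)) - 0.01855 * log_gauge u + 0.49 * ln u)
      \<le> small_mertens u / 2"

text \<open>Side conditions of the earlier lemmas in the worst case: window length
  \<open>exp (u / 2) / 2\<close>, and \<open>h\<close> anywhere between
  \<open>0.7 * log_gauge u\<close> and \<open>log_gauge u\<close>. They hold eventually because
  \<open>log_gauge u\<close> tends to infinity but is of smaller order than
  \<open>u\<close>.\<close>

definition size_regime :: "real \<Rightarrow> bool" where
  "size_regime u \<longleftrightarrow>
    exp (1.17 * log_gauge u) * (4 + 2 * ln (2 + exp (u / 32))) \<le> (large_mertens u)\<^sup>2 * (exp (u / 2) / 2) \<and>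
    exp (1.17 * log_gauge u) \<le> large_mertens u * (exp (u / 2) / 2) \<and>
    exp (0.378 * log_gauge u) \<le> large_mertens u * (exp (u / 2) / 2) / 4 \<and>
    exp (- (0.39 * (0.7 * log_gauge u))) \<le> 1 / 14 \<and>
    exp (0.39 * log_gauge u) \<le> exp (u / 2) \<and>
    exp u \<le> (1 + exp (- (0.39 * log_gauge u))) * (exp u - exp (u / 2)) \<and>
    exp u / 2 \<le> exp u - exp (u / 2) \<and>
    2 * exp (- u) / large_mertens u \<le> 1 / 2 \<and>
    4 * exp (u + 0.378 * log_gauge u) / small_mertens u \<le> exp (3 * u) \<and>
    2 * exp (u + 0.378 * log_gauge u) \<le> exp (2 * u) \<and>
    exp (2 * log_gauge u) \<le> exp (exp (u / 32)) / 2 \<and>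
    exp (u + 0.378 * log_gauge u) \<le> exp (exp (u / 32)) \<and>
    exp (1.17 * log_gauge u) \<le> exp (u / 2) / 2 \<and>
    exp (0.378 * log_gauge u) \<le> exp (log_gauge u) / 4 - 1"

text \<open>There are eight shares of \<open>1 / (8 * u ^ 10)\<close>: three from the model (two for
  \<open>2 * \<epsilon>\<close>, one for sets of the wrong size) and five from the transfer, so the
  constant in the theorem can be 1. The last four conditions compare with
  \<open>exp (- 2 * exp (0.378 * log_gauge u))\<close>, a lower bound for every Poisson weight that
  occurs. The decimals satisfy \<open>0.012 = 0.39 - 0.378 = 1.17 - 2 * 0.39 - 0.378\<close>,
  \<open>0.756 = 2 * 0.378\<close> and \<open>0.26 < 0.7 * 0.378\<close>.\<close>

definition error_regime :: "real \<Rightarrow> bool" where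
  "error_regime u \<longleftrightarrow>
    14 * exp (- (0.012 * (0.7 * log_gauge u)))
      + exp (0.756 * log_gauge u) * (2 * exp (- u) / large_mertens u) * (5 + exp (u / 2)) \<le> 1 / (8 * u ^ 10) \<and>
    3 \<le> (small_mertens u)\<^sup>2 * exp (0.012 * (0.7 * log_gauge u)) / 64 \<and>
    2 * exp (1 - exp (0.26 * log_gauge u)) \<le> 1 / (8 * u ^ 10) \<and>
    exp (- exp (u / 2)) \<le> 1 / (8 * u ^ 10) \<and>
    3 * exp (exp 2 * (4 * exp (0.378 * log_gauge u) / small_mertens u) - 2 * (exp (log_gauge u) / 4 - 1))
      \<le> exp (- 2 * exp (0.378 * log_gauge u)) / (8 * u ^ 10) \<and>
    exp (log_gauge u + 3 * u * exp (log_gauge u) - exp (u / 2))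
      \<le> exp (- 2 * exp (0.378 * log_gauge u)) / (8 * u ^ 10) \<and>
    2 * exp (3 * log_gauge u + 3 * u * exp (log_gauge u) - exp (u / 32))
      \<le> exp (- 2 * exp (0.378 * log_gauge u)) / (8 * u ^ 10) \<and>
    exp (log_gauge u + u * exp (log_gauge u) / 2 - u * exp (log_gauge u))
      \<le> exp (- 2 * exp (0.378 * log_gauge u)) / (8 * u ^ 10)"

lemma eventually_brun_regime: "eventually brun_regime at_top"
  unfolding brun_regime_def rate_defs eventually_conj_iff
  by (intro conjI; real_asymp)

lemma eventually_size_regime: "eventually size_regime at_top"
  unfolding size_regime_def rate_defs eventually_conj_iff
  by (intro conjI; real_asymp)

lemma eventually_error_regime: "eventually error_regime at_top"
  unfolding error_regime_def rate_defs eventually_conj_iff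
  by (intro conjI; real_asymp)


section \<open>Estimates for the chosen parameters\<close>

lemma ln_le_of_le_exp: "0 < x \<Longrightarrow> x \<le> exp y \<Longrightarrow> ln x \<le> (y::real)"
  by (metis exp_le_cancel_iff exp_ln)

lemma log_gauge_identities:
  assumes "3 \<le> u"
  shows "0 \<le> log_gauge u" "1 \<le> ln u" "sqrt (u / ln u) * ln u = log_gauge u" "sqrt (u / ln u) * log_gauge u = u"
proof -
  have "exp 1 \<le> u" using assms exp_le by linarith
  then show ln1: "1 \<le> ln u" using assms by (subst ln_ge_iff) auto
  show "0 \<le> log_gauge u" using assms ln1 by (simp add: log_gauge_def)
  have "u * ln u = u / ln u * (ln u)\<^sup>2" using ln1 by (simp add: power2_eq_square)
  then show "sqrt (u / ln u) * ln u = log_gauge u"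
    unfolding log_gauge_def using ln1 by (simp only: real_sqrt_mult real_sqrt_abs)
  have "sqrt (u / ln u) * log_gauge u = sqrt (u\<^sup>2)"
    unfolding log_gauge_def real_sqrt_mult[symmetric] using ln1 by (simp add: power2_eq_square)
  then show "sqrt (u / ln u) * log_gauge u = u" using assms by simp
qed

text \<open>\<open>ln z\<close> is about the 32nd root of \<open>ln x\<close>. This is eventually
  more than any multiple of \<open>u * exp (log_gauge u)\<close>, so \<open>1 / z\<close> beats the
  size of the alternating sums. Yet the factor \<open>ln z ^ 3\<close> lost in the Mertens bound,
  even squared, is negligible against \<open>exp (u / 2)\<close>.\<close>

lemma sieve_limit_bounds:
  assumes "0 \<le> u"
  defines "z \<equiv> nat \<lceil>exp (exp (u / 32))\<rceil>"
  shows "1 \<le> z" "exp (exp (u / 32)) \<le> real z" "large_mertens u \<le> mertens_prod z"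
    "prime_recip_sum z \<le> 4 + 2 * ln (2 + exp (u / 32))"
proof -
  let ?v = "exp (exp (u / 32)) :: real"
  have v: "1 \<le> ?v" by simp
  show zv: "?v \<le> real z" unfolding z_def by (rule real_nat_ceiling_ge)
  then show z1: "1 \<le> z" using v by linarith
  have "real z \<le> ?v + 1" unfolding z_def using v by linarith
  also have "\<dots> \<le> 2 * ?v" using v by linarith
  also have "\<dots> \<le> exp 1 * ?v" using exp_ge_add_one_self[of 1] by (intro mult_right_mono) auto
  also have "\<dots> = exp (1 + exp (u / 32))" by (simp add: exp_add)
  finally have "real z \<le> exp (1 + exp (u / 32))" .
  then have lnz: "ln (real z) \<le> 1 + exp (u / 32)" using z1 by (intro ln_le_of_le_exp) auto
  have lnz0: "0 \<le> ln (real z)" using z1 by simp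
  have "large_mertens u \<le> exp (- 6) / (1 + ln (real z)) ^ 3"
    unfolding large_mertens_def using lnz lnz0 by (intro divide_left_mono power_mono mult_pos_pos) (auto intro!: zero_less_power add_pos_nonneg)
  also have "\<dots> \<le> mertens_prod z" by (rule mertens_prod_ge[OF z1])
  finally show "large_mertens u \<le> mertens_prod z" .
  have "ln (1 + ln (real z)) \<le> ln (2 + exp (u / 32))" using lnz lnz0 by (subst ln_le_cancel_iff) auto
  then show "prime_recip_sum z \<le> 4 + 2 * ln (2 + exp (u / 32))"
    using prime_recip_sum_le[OF z1] by linarith
qed

lemma small_mertens_le:
  assumes "0 \<le> u" "1 \<le> M" "real M \<le> exp (2 * u)"
  shows "small_mertens u \<le> mertens_prod M"
proof -
  have "0 \<le> ln (real M)" "ln (real M) \<le> 2 * u" using assms by (auto intro: ln_le_of_le_exp)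
  then have "small_mertens u \<le> exp (- 6) / (1 + ln (real M)) ^ 3"
    unfolding small_mertens_def using assms(1)
    by (intro divide_left_mono power_mono mult_pos_pos) (auto intro!: zero_less_power add_pos_nonneg)
  also have "\<dots> \<le> mertens_prod M" by (rule mertens_prod_ge[OF assms(2)])
  finally show ?thesis .
qed

lemma mertens_rates_pos: "0 \<le> u \<Longrightarrow> 0 < small_mertens u" "0 < large_mertens u"
  by (auto simp: small_mertens_def large_mertens_def intro!: divide_pos_pos zero_less_power add_pos_nonneg add_pos_pos)

lemma small_mertens_le_1: "0 \<le> u \<Longrightarrow> small_mertens u \<le> 1"
proof -
  assume u: "0 \<le> u"
  then have "(1::real) \<le> (1 + 2 * u) ^ 3" by (intro one_le_power) simp
  moreover have "exp (- 6) \<le> (1::real)" by simp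
  ultimately have "exp (- 6) \<le> (1 + 2 * u) ^ 3" by linarith
  then show ?thesis using u by (simp add: small_mertens_def pos_divide_le_eq)
qed

lemma window_length_bounds:
  fixes u q l y :: real
  assumes "size_regime u" "3 \<le> u" "1 / 2 \<le> q\<^sup>2" "l \<le> exp (0.378 * log_gauge u)"
    "y = l * exp u" "exp (q\<^sup>2 * u) \<le> y"
  defines "M \<equiv> nat \<lfloor>y\<rfloor>"
  shows "y - 1 \<le> real M" "real M \<le> y" "exp (q\<^sup>2 * u) / 2 \<le> real M" "exp (u / 2) / 2 \<le> real M"
    "real M \<le> exp (u + 0.378 * log_gauge u)" "1 \<le> M" "small_mertens u \<le> mertens_prod M" "exp (u / 2) \<le> y"
proof -
  have g: "0 \<le> log_gauge u" using log_gauge_identities[OF assms(2)] by simp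
  have "1 \<le> exp (1.17 * log_gauge u)" using g by simp
  then have big: "2 \<le> exp (u / 2)" using assms(1) unfolding size_regime_def by linarith
  have qu: "exp (u / 2) \<le> exp (q\<^sup>2 * u)" using assms(2) mult_right_mono[OF assms(3), of u] by simp
  then show yu: "exp (u / 2) \<le> y" using assms(6) by linarith
  then have y2: "2 \<le> y" using big by linarith
  show M1: "y - 1 \<le> real M" "real M \<le> y" using y2 by (auto simp: M_def)
  show "exp (q\<^sup>2 * u) / 2 \<le> real M" "exp (u / 2) / 2 \<le> real M" using M1 qu big assms(6) by linarith+
  show "1 \<le> M" using M1 y2 by linarith
  have "y \<le> exp (0.378 * log_gauge u) * exp u" using assms(4,5) by simp
  then show Mu: "real M \<le> exp (u + 0.378 * log_gauge u)" using M1 by (simp add: exp_add mult.commute)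
  then have "real M \<le> exp (2 * u)" using assms(1) exp_gt_zero[of "2 * u"] unfolding size_regime_def by linarith
  then show "small_mertens u \<le> mertens_prod M" using assms(2) \<open>1 \<le> M\<close> by (intro small_mertens_le) auto
qed

lemma brun_error_bound:
  fixes u q h :: real and M w m :: nat
  assumes "brun_regime u" "3 \<le> u" "1 / 2 \<le> q\<^sup>2" "0.7 \<le> q" "q \<le> 1"
    and M: "exp (q\<^sup>2 * u) / 2 \<le> real M" and w: "1 \<le> w" "real w \<le> exp (1.17 * h)"
    and h: "h = q * log_gauge u" and mertens: "small_mertens u \<le> mertens_prod w"
  defines "m \<equiv> nat \<lfloor>0.85 * q * sqrt (u / ln u)\<rfloor>"
  shows "2 * real M * (prime_recip_sum w ^ m / fact m) + (real w + 1) ^ m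
    \<le> exp (- (0.39 * h)) * (real M * mertens_prod w)"
proof -
  define s where "s = sqrt (u / ln u)"
  define \<delta> where "\<delta> = exp (- (0.39 * h))"
  note gid = log_gauge_identities[OF assms(2), folded s_def]
  have s0: "0 \<le> s" using gid(2) assms(2) by (simp add: s_def)
  have hg: "0.7 * log_gauge u \<le> h" "h \<le> log_gauge u" "0 \<le> h"
    using gid(1) assms(4,5) mult_right_mono[OF assms(4) gid(1)] by (auto simp: h mult_left_le_one_le)
  have m: "real m \<le> 0.85 * q * s" "0.85 * q * s - 1 \<le> real m"
    using s0 assms(4) by (auto simp: m_def s_def) linarith
  have \<delta>: "0 < \<delta>" by (simp add: \<delta>_def)
  have M0: "0 < real M" using M exp_gt_zero[of "q\<^sup>2 * u"] by linarith
  define c where "c = u powr 0.49"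
  have c0: "c > 0" using assms(2) by (simp add: c_def)
  have S: "prime_recip_sum w \<le> 4 + 2 * ln (1 + 1.17 * log_gauge u)"
  proof -
    have "ln (real w) \<le> 1.17 * h" using w by (intro ln_le_of_le_exp) auto
    then have "ln (real w) \<le> 1.17 * log_gauge u" "0 \<le> ln (real w)" using hg w by auto
    then have "ln (1 + ln (real w)) \<le> ln (1 + 1.17 * log_gauge u)" by (subst ln_le_cancel_iff) auto
    then show ?thesis using prime_recip_sum_le[OF w(1)] by linarith
  qed
  have S0: "0 \<le> prime_recip_sum w" by (simp add: prime_recip_sum_def sum_nonneg)
  have main1: "2 * (prime_recip_sum w ^ m / fact m) \<le> \<delta> * mertens_prod w / 2"
  proof -
    \<comment> \<open>\<open>S ^ m / fact m \<le> exp (c * S) / c ^ m\<close> avoids Stirling's formula; \<open>c = u powr 0.49\<close>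
      is nearly as large as \<open>m\<close> itself.\<close>
    have "c ^ m * (prime_recip_sum w ^ m / fact m) = (c * prime_recip_sum w) ^ m / fact m"
      by (simp add: power_mult_distrib)
    also have "\<dots> \<le> exp (c * prime_recip_sum w)" using c0 S0 by (intro power_div_fact_le_exp) auto
    also have "\<dots> \<le> exp (c * (4 + 2 * ln (1 + 1.17 * log_gauge u)))" using S c0 by simp
    finally have 1: "c ^ m * (prime_recip_sum w ^ m / fact m) \<le> exp (c * (4 + 2 * ln (1 + 1.17 * log_gauge u)))" .
    \<comment> \<open>\<open>0.4165 = 0.49 * 0.85\<close>; rounding \<open>m\<close> down costs
      \<open>0.49 * ln u\<close>.\<close>
    have "0.4165 * h - 0.49 * ln u = 0.49 * ln u * (0.85 * q * s - 1)"
      using gid(3) by (simp add: h algebra_simps) 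
    also have "\<dots> \<le> 0.49 * ln u * real m" using m gid(2) by (intro mult_left_mono) auto
    finally have "exp (0.4165 * h - 0.49 * ln u) \<le> exp (real m * (0.49 * ln u))" by (simp add: mult.commute)
    also have "\<dots> = c ^ m"
    proof -
      have "c = exp (0.49 * ln u)" using assms(2) by (simp add: c_def powr_def)
      then show ?thesis by (simp only: exp_of_nat_mult)
    qed
    finally have "exp (0.4165 * h - 0.49 * ln u) * (prime_recip_sum w ^ m / fact m)
        \<le> exp (c * (4 + 2 * ln (1 + 1.17 * log_gauge u)))"
      using 1 S0 by (elim order_trans[OF mult_right_mono]) auto
    then have "prime_recip_sum w ^ m / fact m
        \<le> exp (c * (4 + 2 * ln (1 + 1.17 * log_gauge u))) / exp (0.4165 * h - 0.49 * ln u)"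
      by (simp add: pos_le_divide_eq mult.commute)
    also have "\<dots> = exp (c * (4 + 2 * ln (1 + 1.17 * log_gauge u)) - (0.4165 * h - 0.49 * ln u))"
      by (rule exp_diff[symmetric])
    also have "\<dots> \<le> exp (c * (4 + 2 * ln (1 + 1.17 * log_gauge u)) - 0.01855 * log_gauge u + 0.49 * ln u + - (0.39 * h))"
    proof (subst exp_le_cancel_iff)
      have "A - (0.4165 * h - B) \<le> A - 0.01855 * log_gauge u + B + - (0.39 * h)" for A B :: real
        using hg(1) by (simp add: field_simps)
      then show "c * (4 + 2 * ln (1 + 1.17 * log_gauge u)) - (0.4165 * h - 0.49 * ln u)
          \<le> c * (4 + 2 * ln (1 + 1.17 * log_gauge u)) - 0.01855 * log_gauge u + 0.49 * ln u + - (0.39 * h)" .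
    qed
    also have "\<dots> = exp (c * (4 + 2 * ln (1 + 1.17 * log_gauge u)) - 0.01855 * log_gauge u + 0.49 * ln u) * \<delta>"
      by (simp only: exp_add \<delta>_def)
    finally have "2 * (prime_recip_sum w ^ m / fact m)
        \<le> (2 * exp (c * (4 + 2 * ln (1 + 1.17 * log_gauge u)) - 0.01855 * log_gauge u + 0.49 * ln u)) * \<delta>" by simp
    also have "\<dots> \<le> (small_mertens u / 2) * \<delta>"
      using assms(1) \<delta> unfolding brun_regime_def c_def by (intro mult_right_mono) auto
    also have "\<dots> \<le> (mertens_prod w / 2) * \<delta>" using mertens \<delta> by (intro mult_right_mono) auto
    finally show ?thesis by (simp add: mult.commute)
  qed
  have main2: "(real w + 1) ^ m \<le> \<delta> * (real M * mertens_prod w) / 2"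
  proof -
    have "1 \<le> exp (1.17 * h)" using hg(3) by simp
    then have "real w + 1 \<le> exp (1.17 * h) * 2" using w(2) by linarith
    also have "\<dots> \<le> exp (1.17 * h) * exp 1" using exp_ge_add_one_self[of 1] by (intro mult_left_mono) auto
    also have "\<dots> = exp (1.17 * h + 1)" by (simp add: exp_add)
    finally have "(real w + 1) ^ m \<le> exp (1.17 * h + 1) ^ m" by (intro power_mono) auto
    also have "\<dots> = exp (real m * (1.17 * h + 1))" by (simp add: exp_of_nat_mult)
    also have "\<dots> \<le> exp (0.85 * q * s * (1.17 * h + 1))" using m hg by (simp add: mult_right_mono)
    \<comment> \<open>\<open>0.9945 = 0.85 * 1.17\<close>. Since \<open>s * log_gauge u = u\<close>,
      the power is \<open>exp (0.9945 * q\<^sup>2 * u)\<close> up to lower order, less than the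
      window length.\<close>
    also have "0.85 * q * s * (1.17 * h + 1) = 0.9945 * (q\<^sup>2 * (s * log_gauge u)) + 0.85 * (q * s)"
      by (simp add: h power2_eq_square algebra_simps)
    also have "s * log_gauge u = u" by (rule gid(4))
    also have "exp (0.9945 * (q\<^sup>2 * u) + 0.85 * (q * s))
        \<le> exp (q\<^sup>2 * u + - (0.39 * h) + (0.85 * s + 0.39 * log_gauge u - 0.00275 * u))"
    proof (subst exp_le_cancel_iff)
      have "1 / 2 * u \<le> q\<^sup>2 * u" "q * s \<le> s"
        using assms(2,3,4,5) s0 by (auto intro!: mult_right_mono simp: mult_left_le_one_le)
      moreover have "0.9945 * B + 0.85 * C \<le> B + - (0.39 * h) + (0.85 * s + 0.39 * G - 0.00275 * u)"
        if "1 / 2 * u \<le> B" "C \<le> s" "h \<le> G" for B C G :: real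
        using that by (simp add: field_simps)
      ultimately show "0.9945 * (q\<^sup>2 * u) + 0.85 * (q * s)
          \<le> q\<^sup>2 * u + - (0.39 * h) + (0.85 * s + 0.39 * log_gauge u - 0.00275 * u)"
        using hg by blast
    qed
    also have "\<dots> = exp (q\<^sup>2 * u) * \<delta> * exp (0.85 * s + 0.39 * log_gauge u - 0.00275 * u)"
      by (simp only: exp_add \<delta>_def)
    also have "\<dots> \<le> exp (q\<^sup>2 * u) * \<delta> * (small_mertens u / 4)"
      using assms(1) \<delta> unfolding brun_regime_def s_def by (intro mult_left_mono) auto
    also have "\<dots> \<le> (2 * real M) * \<delta> * (mertens_prod w / 4)"
      using M mertens \<delta> M0 mertens_rates_pos(1)[of u] assms(2) by (intro mult_mono) auto
    finally show ?thesis by (simp add: mult_ac)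
  qed
  have "2 * real M * (prime_recip_sum w ^ m / fact m) \<le> real M * (\<delta> * mertens_prod w / 2)"
    using mult_left_mono[OF main1, of "real M"] M0 by (simp add: mult_ac)
  moreover have "real M * (\<delta> * mertens_prod w / 2) = \<delta> * (real M * mertens_prod w) / 2" by simp
  ultimately show ?thesis using main2 unfolding \<delta>_def[symmetric] by linarith
qed

text \<open>\<open>\<delta>\<^sup>2 * w\<close> is about \<open>exp (0.39 * h)\<close>, larger than
  the bound for \<open>T\<close> by a factor \<open>exp (0.012 * h)\<close>, which outweighs
  \<open>\<Theta>\<^sup>2 / 64\<close> and leaves \<open>3 * exp (0.378 * h) - 1\<close> in the
  exponent. Two of the three copies pay for \<open>P \<ge> exp (- 2 * T)\<close>, the third for
  \<open>u ^ 10\<close>.\<close>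

lemma deviation_bound:
  fixes u h T P :: real and w :: nat and \<Theta> :: real
  assumes "error_regime u" "3 \<le> u" "0.7 * log_gauge u \<le> h" "T \<le> exp (0.378 * h)" "exp (- 2 * T) \<le> P"
    and w: "exp (1.17 * h) - 1 \<le> real w" and \<Theta>: "small_mertens u \<le> \<Theta>"
  shows "2 * exp (- ((exp (- (0.39 * h)))\<^sup>2 * \<Theta>\<^sup>2 * real w / 64)) \<le> P / (8 * u ^ 10)"
proof -
  let ?\<theta> = "small_mertens u"
  have g: "0 \<le> log_gauge u" using log_gauge_identities[OF assms(2)] by simp
  then have h0: "0 \<le> h" using assms(3) by linarith
  have \<theta>: "0 < ?\<theta>" "?\<theta> \<le> 1" using assms(2) mertens_rates_pos small_mertens_le_1 by auto
  have P: "0 < P" using assms(5) exp_gt_zero[of "- 2 * T"] by linarith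
  have "exp (0.39 * h) - 1 \<le> exp (- (0.78 * h)) * (exp (1.17 * h) - 1)"
    using h0 by (simp add: right_diff_distrib exp_add[symmetric])
  also have "exp (- (0.78 * h)) = (exp (- (0.39 * h)))\<^sup>2" by (simp add: exp_double[symmetric])
  also have "\<dots> * (exp (1.17 * h) - 1) \<le> \<dots> * real w" using w by (intro mult_left_mono) auto
  finally have 1: "exp (0.39 * h) - 1 \<le> (exp (- (0.39 * h)))\<^sup>2 * real w" .
  have "3 * exp (0.378 * h) - 1 \<le> ?\<theta>\<^sup>2 * (exp (0.39 * h) - 1) / 64"
  proof -
    have "3 \<le> ?\<theta>\<^sup>2 * exp (0.012 * (0.7 * log_gauge u)) / 64" using assms(1) by (simp add: error_regime_def)
    also have "\<dots> \<le> ?\<theta>\<^sup>2 * exp (0.012 * h) / 64" using assms(3) by (simp add: mult_left_mono)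
    finally have "exp (0.378 * h) * 3 \<le> exp (0.378 * h) * (?\<theta>\<^sup>2 * exp (0.012 * h) / 64)" by (intro mult_left_mono) auto
    also have "\<dots> = ?\<theta>\<^sup>2 * exp (0.39 * h) / 64" by (simp add: exp_add[symmetric])
    finally have "exp (0.378 * h) * 3 \<le> ?\<theta>\<^sup>2 * exp (0.39 * h) / 64" .
    moreover have "?\<theta>\<^sup>2 \<le> 1" using \<theta> by (simp add: power_le_one)
    ultimately show ?thesis by (simp add: right_diff_distrib diff_divide_distrib)
  qed
  also have "\<dots> \<le> \<Theta>\<^sup>2 * ((exp (- (0.39 * h)))\<^sup>2 * real w) / 64"
    using 1 \<Theta> \<theta> h0 by (intro divide_right_mono mult_mono power_mono) auto
  finally have D: "3 * exp (0.378 * h) - 1 \<le> (exp (- (0.39 * h)))\<^sup>2 * \<Theta>\<^sup>2 * real w / 64" by (simp add: mult_ac)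
  have "2 * exp (- ((exp (- (0.39 * h)))\<^sup>2 * \<Theta>\<^sup>2 * real w / 64)) \<le> 2 * exp (- 2 * T + (1 - exp (0.26 * log_gauge u)))"
  proof -
    have "0.26 * log_gauge u \<le> 0.378 * (0.7 * log_gauge u)" using g by simp
    also have "\<dots> \<le> 0.378 * h" using assms(3) by (intro mult_left_mono) auto
    finally have "exp (0.26 * log_gauge u) \<le> exp (0.378 * h)" by (subst exp_le_cancel_iff)
    then show ?thesis using D assms(4)
      by (intro mult_left_mono exp_le_cancel_iff[THEN iffD2]) (linarith, simp)
  qed
  also have "\<dots> = exp (- 2 * T) * (2 * exp (1 - exp (0.26 * log_gauge u)))" by (simp only: exp_add mult_ac)
  also have "\<dots> \<le> P * (1 / (8 * u ^ 10))"
    using assms(1,5) P unfolding error_regime_def by (intro mult_mono) auto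
  finally show ?thesis by simp
qed

text \<open>The Mertens product cancels in the mean \<open>X * r = M / L\<close>, so no asymptotic
  formula for it is required; its lower bound serves to make \<open>X\<close> large and
  \<open>r\<close> small. The value \<open>\<eta> = 7 * \<delta>\<close> absorbs three factors
  \<open>1 + \<delta>\<close> or \<open>1 - \<delta>\<close>: two from the sieve and one from
  rounding the window length or from the range of \<open>L\<close>.\<close>

lemma model_close_to_poisson:
  fixes u q h l y T L :: real and k :: nat
  assumes regimes: "brun_regime u" "size_regime u" "error_regime u" and u: "3 \<le> u"
    and q: "1 / 2 \<le> q\<^sup>2" "0.7 \<le> q" "q \<le> 1" and h: "h = q * log_gauge u"
    and T: "1 \<le> T" "real k \<le> T" "l \<le> T" "T \<le> exp (0.378 * h)"
    and l: "exp (- (u / 2)) \<le> l" "l \<le> exp (0.378 * log_gauge u)"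
    and y: "y = l * exp u" "exp (q\<^sup>2 * u) \<le> y"
    and L: "exp u - exp (u / 2) \<le> L" "L \<le> exp u"
  defines "P \<equiv> exp (- l) * l ^ k / fact k" and "M \<equiv> nat \<lfloor>y\<rfloor>" and "z \<equiv> nat \<lceil>exp (exp (u / 32))\<rceil>"
  defines "r \<equiv> 1 / (mertens_prod z * L)"
  assumes P: "exp (- 2 * T) \<le> P"
  shows "r \<le> 1"
    "\<bar>sieve_avg (primes_between 0 z) (thinned_prob r k) {1..M} - P\<bar> \<le> P * (3 / (8 * u ^ 10))"
proof -
  let ?\<theta>1 = "large_mertens u"
  define \<delta> where "\<delta> = exp (- (0.39 * h))"
  define w where "w = nat \<lfloor>exp (1.17 * h)\<rfloor>"
  define m where "m = nat \<lfloor>0.85 * q * sqrt (u / ln u)\<rfloor>"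
  define X where "X = real M * mertens_prod z"
  define r0 where "r0 = 2 * exp (- u) / ?\<theta>1"
  have u0: "0 \<le> u" using u by simp
  have l0: "0 < l" using l(1) exp_gt_zero[of "- (u / 2)"] by linarith
  have g: "0 \<le> log_gauge u" using log_gauge_identities[OF u] by simp
  have hg: "0.7 * log_gauge u \<le> h" "h \<le> log_gauge u" "0 \<le> h"
    using g q(2,3) mult_right_mono[OF q(2) g] by (auto simp: h mult_left_le_one_le)
  note Mb = window_length_bounds[OF regimes(2) u q(1) l(2) y, folded M_def]
  note zb = sieve_limit_bounds[OF u0, folded z_def]
  note size = regimes(2)[unfolded size_regime_def]
  have \<theta>1: "0 < ?\<theta>1" using mertens_rates_pos by simp
  have ew: "1 \<le> exp (1.17 * h)" "exp (1.17 * h) \<le> exp (1.17 * log_gauge u)" using hg by auto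
  have w: "1 \<le> w" "real w \<le> exp (1.17 * h)" "exp (1.17 * h) - 1 \<le> real w"
    using ew by (auto simp: w_def le_nat_iff)
  have wg: "real w \<le> exp (1.17 * log_gauge u)" using w ew by linarith
  have wM: "w \<le> M"
  proof -
    have "real w \<le> real M" using wg size Mb(4) by linarith
    then show ?thesis by simp
  qed
  have Mz: "M \<le> z"
  proof -
    have "real M \<le> real z" using Mb(5) size zb(2) by linarith
    then show ?thesis by simp
  qed
  have \<delta>: "0 < \<delta>" "\<delta> \<le> 1 / 14" "exp (- (0.39 * log_gauge u)) \<le> \<delta>"
  proof -
    have "\<delta> \<le> exp (- (0.39 * (0.7 * log_gauge u)))" unfolding \<delta>_def using hg(1) by simp
    then show "\<delta> \<le> 1 / 14" using size by linarith
    show "exp (- (0.39 * log_gauge u)) \<le> \<delta>" unfolding \<delta>_def using hg(2) by simp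
  qed (simp add: \<delta>_def)
  have \<Theta>z: "?\<theta>1 \<le> mertens_prod z" "0 < mertens_prod z" using zb(3) \<theta>1 by auto
  have \<Theta>M: "0 < mertens_prod M" "mertens_prod M \<le> 1" by (auto simp: mertens_prod_pos mertens_prod_le_1)
  have M0: "0 < real M" using Mb(6) by simp
  have X: "?\<theta>1 * (exp (u / 2) / 2) \<le> X"
    unfolding X_def using \<Theta>z \<theta>1 Mb(4) by (subst mult.commute) (intro mult_mono, auto)
  have small1: "real w * prime_recip_sum z * (mertens_prod M)\<^sup>2 \<le> (mertens_prod z)\<^sup>2 * real M"
  proof -
    have S0: "0 \<le> prime_recip_sum z" by (simp add: prime_recip_sum_def sum_nonneg)
    have "(mertens_prod M)\<^sup>2 \<le> 1" using \<Theta>M by (intro power_le_one) auto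
    then have "real w * prime_recip_sum z * (mertens_prod M)\<^sup>2 \<le> real w * prime_recip_sum z * 1"
      using S0 by (intro mult_left_mono) auto
    also have "\<dots> \<le> exp (1.17 * log_gauge u) * (4 + 2 * ln (2 + exp (u / 32)))"
      using wg zb(4) S0 by (simp add: mult_mono)
    also have "\<dots> \<le> ?\<theta>1\<^sup>2 * (exp (u / 2) / 2)" using size by blast
    also have "\<dots> \<le> (mertens_prod z)\<^sup>2 * real M"
      using \<Theta>z \<theta>1 Mb(4) by (intro mult_mono power_mono) auto
    finally show ?thesis .
  qed
  have small2: "real w \<le> X" using wg size X by linarith
  have brun: "2 * real M * (prime_recip_sum w ^ m / fact m) + (real w + 1) ^ m \<le> \<delta> * (real M * mertens_prod w)"
    unfolding \<delta>_def m_def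
    using Mb(3,7) mertens_prod_antimono[OF wM] w
    by (intro brun_error_bound[OF regimes(1) u q _ _ _ h]) auto
  have e2: "exp u / 2 \<le> exp u - exp (u / 2)" using size by blast
  have L0: "exp u / 2 \<le> L" "0 < L" using e2 L(1) exp_gt_zero[of u] by linarith+
  have r: "0 \<le> r" "r \<le> r0" "r \<le> 1 / 2"
  proof -
    show "0 \<le> r" unfolding r_def using \<Theta>z L0 by simp
    have "r \<le> 1 / (?\<theta>1 * (exp u / 2))"
      unfolding r_def using \<Theta>z \<theta>1 L0 by (intro divide_left_mono mult_mono) auto
    also have "\<dots> = r0" by (simp add: r0_def exp_minus field_simps)
    finally show "r \<le> r0" .
    moreover have "r0 \<le> 1 / 2" unfolding r0_def using size by blast
    ultimately show "r \<le> 1 / 2" by linarith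
  qed
  then show "r \<le> 1" by linarith
  have Xr: "X * r = real M / L" using \<Theta>z by (simp add: X_def r_def)
  have kX: "real k \<le> (1 - \<delta>)\<^sup>2 * X"
  proof -
    have "real k \<le> exp (0.378 * h)" using T by linarith
    also have "\<dots> \<le> exp (0.378 * log_gauge u)" using hg by simp
    also have "\<dots> \<le> ?\<theta>1 * (exp (u / 2) / 2) / 4" using size by blast
    also have "\<dots> \<le> (1 / 2)\<^sup>2 * X" using X by (simp add: power2_eq_square)
    also have "\<dots> \<le> (1 - \<delta>)\<^sup>2 * X"
      using \<delta> X \<theta>1 M0 \<Theta>z by (intro mult_right_mono power_mono) (auto simp: X_def)
    finally show ?thesis .
  qed
  have lo: "l * (1 - 7 * \<delta>) \<le> (1 - \<delta>)\<^sup>2 * X * r"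
  proof -
    have "1 \<le> \<delta> * y"
    proof -
      have "1 = exp (- (0.39 * log_gauge u)) * exp (0.39 * log_gauge u)" by (simp add: exp_add[symmetric])
      also have "\<dots> \<le> \<delta> * y"
      proof (rule mult_mono)
        show "exp (0.39 * log_gauge u) \<le> y" using size Mb(8) by linarith
      qed (use \<delta> in auto)
      finally show ?thesis .
    qed
    then have "(1 - \<delta>) * y \<le> real M" using Mb(1) by (simp add: algebra_simps)
    then have "(1 - \<delta>) * l * exp u \<le> real M" by (simp add: y(1) mult_ac)
    moreover have "(1 - \<delta>) * l * L \<le> (1 - \<delta>) * l * exp u" using L(2) \<delta> l0 by (intro mult_left_mono) auto
    ultimately have quot: "(1 - \<delta>) * l \<le> real M / L" using L0 by (simp add: pos_le_divide_eq)
    have "1 - 7 * \<delta> \<le> (1 - \<delta>)\<^sup>2 * (1 - \<delta>)"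
    proof -
      have "(1 - \<delta>)\<^sup>2 * (1 - \<delta>) = 1 - 3 * \<delta> + \<delta>\<^sup>2 * (3 - \<delta>)" by (simp add: power2_eq_square algebra_simps)
      moreover have "0 \<le> \<delta>\<^sup>2 * (3 - \<delta>)" using \<delta> by simp
      ultimately show ?thesis using \<delta>(1) by linarith
    qed
    then have "l * (1 - 7 * \<delta>) \<le> l * ((1 - \<delta>)\<^sup>2 * (1 - \<delta>))" using l0 by (intro mult_left_mono) auto
    also have "\<dots> = (1 - \<delta>)\<^sup>2 * ((1 - \<delta>) * l)" by simp
    also have "\<dots> \<le> (1 - \<delta>)\<^sup>2 * (real M / L)" using quot by (intro mult_left_mono) auto
    finally show ?thesis by (simp add: Xr mult.assoc)
  qed
  have hi: "(1 + \<delta>)\<^sup>2 * X * r \<le> l * (1 + 7 * \<delta>)"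
  proof -
    have "exp u \<le> (1 + exp (- (0.39 * log_gauge u))) * (exp u - exp (u / 2))" using size by blast
    also have "\<dots> \<le> (1 + \<delta>) * L"
    proof (rule mult_mono)
      show "0 \<le> exp u - exp (u / 2)" using e2 exp_gt_zero[of u] by linarith
    qed (use \<delta> L(1) in auto)
    finally have "l * exp u \<le> l * ((1 + \<delta>) * L)" using l0 by (intro mult_left_mono) auto
    then have "real M \<le> l * (1 + \<delta>) * L" using Mb(2) y(1) by (simp add: mult_ac)
    then have quot: "real M / L \<le> l * (1 + \<delta>)" using L0 by (simp add: pos_divide_le_eq)
    have "(1 + \<delta>)\<^sup>2 * (1 + \<delta>) \<le> 1 + 7 * \<delta>"
    proof -
      have "(1 + \<delta>)\<^sup>2 * (1 + \<delta>) = 1 + 3 * \<delta> + \<delta> * (\<delta> * (3 + \<delta>))" by (simp add: power2_eq_square algebra_simps)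
      moreover have "\<delta> * (\<delta> * (3 + \<delta>)) \<le> \<delta> * (1 * 4)" using \<delta> by (intro mult_left_mono mult_mono) auto
      ultimately show ?thesis by linarith
    qed
    then have "l * ((1 + \<delta>)\<^sup>2 * (1 + \<delta>)) \<le> l * (1 + 7 * \<delta>)" using l0 by (intro mult_left_mono) auto
    moreover have "(1 + \<delta>)\<^sup>2 * (real M / L) \<le> (1 + \<delta>)\<^sup>2 * (l * (1 + \<delta>))" using quot by (intro mult_left_mono) auto
    moreover have "(1 + \<delta>)\<^sup>2 * X * r = (1 + \<delta>)\<^sup>2 * (real M / L)" by (simp add: Xr mult.assoc)
    moreover have "(1 + \<delta>)\<^sup>2 * (l * (1 + \<delta>)) = l * ((1 + \<delta>)\<^sup>2 * (1 + \<delta>))" by simp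
    ultimately show ?thesis by linarith
  qed
  define \<epsilon> where "\<epsilon> = (real k + l) * (7 * \<delta>) + r * real k + (real k)\<^sup>2 * r / l + 4 * r * l"
  have \<epsilon>: "\<epsilon> \<le> 1 / (8 * u ^ 10)"
  proof -
    have r00: "0 \<le> r0" using r by linarith
    have "(real k + l) * (7 * \<delta>) \<le> (T + T) * (7 * \<delta>)" using T \<delta> by (intro mult_right_mono) auto
    also have "\<dots> = 14 * (T * \<delta>)" by simp
    also have "T * \<delta> \<le> exp (- (0.012 * (0.7 * log_gauge u)))"
    proof -
      have "T * \<delta> \<le> exp (0.378 * h) * \<delta>" using T \<delta> by (intro mult_right_mono) auto
      also have "\<dots> = exp (- (0.012 * h))" by (simp add: \<delta>_def exp_add[symmetric])
      also have "\<dots> \<le> exp (- (0.012 * (0.7 * log_gauge u)))" using hg(1) by simp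
      finally show ?thesis .
    qed
    finally have a: "(real k + l) * (7 * \<delta>) \<le> 14 * exp (- (0.012 * (0.7 * log_gauge u)))" by simp
    have TT: "T \<le> T\<^sup>2" using T(1) by (simp add: power2_eq_square)
    have "r * real k \<le> r0 * T\<^sup>2" using r T TT by (intro mult_mono) auto
    moreover have "4 * r * l \<le> 4 * (r0 * T\<^sup>2)"
    proof -
      have "r * l \<le> r0 * T\<^sup>2" using r T TT l0 by (intro mult_mono) auto
      then show ?thesis by simp
    qed
    moreover have "(real k)\<^sup>2 * r / l \<le> r0 * T\<^sup>2 * exp (u / 2)"
    proof -
      \<comment> \<open>The lower bound on \<open>l\<close> is needed here: \<open>r\<close> is of
        order \<open>exp (- u)\<close> up to a small power of \<open>exp u\<close>, so
        \<open>r / l\<close> still tends to 0.\<close>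
      have inv: "1 / l \<le> exp (u / 2)"
      proof -
        have "1 = exp (- (u / 2)) * exp (u / 2)" by (simp add: exp_add[symmetric])
        also have "\<dots> \<le> l * exp (u / 2)" using l by (intro mult_right_mono) auto
        finally show ?thesis using l0 by (simp add: pos_divide_le_eq mult.commute)
      qed
      have "(real k)\<^sup>2 * r \<le> T\<^sup>2 * r0" using r T by (intro mult_mono power_mono) auto
      from mult_mono[OF this inv] have "(real k)\<^sup>2 * r * (1 / l) \<le> T\<^sup>2 * r0 * exp (u / 2)"
        using l0 r00 by simp
      then show ?thesis by (simp add: mult.commute)
    qed
    ultimately have b: "r * real k + (real k)\<^sup>2 * r / l + 4 * r * l \<le> T\<^sup>2 * r0 * (5 + exp (u / 2))"
      by (simp add: algebra_simps)
    have "T\<^sup>2 \<le> exp (0.756 * log_gauge u)"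
    proof -
      have "T\<^sup>2 \<le> (exp (0.378 * log_gauge u))\<^sup>2"
        using T hg by (intro power_mono order_trans[OF T(4)]) auto
      also have "\<dots> = exp (0.756 * log_gauge u)" by (simp add: exp_double[symmetric])
      finally show ?thesis .
    qed
    then have "T\<^sup>2 * r0 * (5 + exp (u / 2)) \<le> exp (0.756 * log_gauge u) * r0 * (5 + exp (u / 2))"
      using r00 by (intro mult_right_mono) (auto simp: add_nonneg_nonneg)
    then have "\<epsilon> \<le> 14 * exp (- (0.012 * (0.7 * log_gauge u))) + exp (0.756 * log_gauge u) * r0 * (5 + exp (u / 2))"
      using a b unfolding \<epsilon>_def by linarith
    also have "\<dots> \<le> 1 / (8 * u ^ 10)" using regimes(3) unfolding error_regime_def r0_def by blast
    finally show ?thesis .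
  qed
  have u10: "1 \<le> u ^ 10" using u by (intro one_le_power) auto
  have P0: "0 \<le> P" using l0 by (simp add: P_def)
  have "\<bar>sieve_avg (primes_between 0 z) (thinned_prob r k) {1..M} - P\<bar>
      \<le> 2 * \<epsilon> * P + 2 * exp (- (\<delta>\<^sup>2 * (mertens_prod M)\<^sup>2 * real w / 64))"
    unfolding P_def \<epsilon>_def
  proof (rule sieve_model_estimate[where m = m])
    show "(real k + l) * (7 * \<delta>) + r * real k + (real k)\<^sup>2 * r / l + 4 * r * l \<le> 1"
    proof -
      have "1 / (8 * u ^ 10) \<le> 1" using u10 by (simp add: divide_le_eq)
      then show ?thesis using \<epsilon> unfolding \<epsilon>_def by linarith
    qed
  qed (use w wM Mz \<delta> small1 small2 brun r l0 kX lo hi in \<open>auto simp: X_def\<close>)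
  also have "2 * exp (- (\<delta>\<^sup>2 * (mertens_prod M)\<^sup>2 * real w / 64)) \<le> P / (8 * u ^ 10)"
    unfolding \<delta>_def using regimes(3) u hg(1) T(4) P w(3) Mb(7) by (rule deviation_bound)
  also have "2 * \<epsilon> * P \<le> 2 * (1 / (8 * u ^ 10)) * P" using \<epsilon> P0 by (intro mult_right_mono) auto
  finally show "\<bar>sieve_avg (primes_between 0 z) (thinned_prob r k) {1..M} - P\<bar> \<le> P * (3 / (8 * u ^ 10))"
    by (simp add: field_simps)
qed

subsection \<open>The Poisson law\<close>

lemma num_intervals_poisson:
  fixes x u q h l y T :: real and k :: nat and A :: "nat set"
  assumes regimes: "brun_regime u" "size_regime u" "error_regime u" and u: "3 \<le> u"
    and q: "1 / 2 \<le> q\<^sup>2" "0.7 \<le> q" "q \<le> 1" and h: "h = q * log_gauge u"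
    and T: "1 \<le> T" "real k \<le> T" "l \<le> T" "T \<le> exp (0.378 * h)"
    and l: "exp (- (u / 2)) \<le> l" "l \<le> exp (0.378 * log_gauge u)"
    and y: "y = l * exp u" "exp (q\<^sup>2 * u) \<le> y"
    and x: "0 < x" "ln x = exp u"
  defines "P \<equiv> exp (- l) * l ^ k / fact k"
  assumes P: "exp (- 2 * T) \<le> P"
    and HL: "\<And>H. H \<subseteq> {1..nat \<lfloor>y\<rfloor>} \<Longrightarrow> real (card H) \<le> exp (log_gauge u) \<Longrightarrow>
      \<bar>real (tuple_count A x H) - singular_series (int ` H) * integral {2..x} (\<lambda>t. 1 / ln t ^ card H)\<bar>
      \<le> x * exp (- exp (log_gauge u) * u)"
  shows "\<bar>real (num_intervals A x y k) - x * P\<bar> \<le> x * P / u ^ 10"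
proof -
  define g where "g = log_gauge u"
  define M where "M = nat \<lfloor>y\<rfloor>"
  define z where "z = nat \<lceil>exp (exp (u / 32))\<rceil>"
  \<comment> \<open>\<open>K\<close> must be far above \<open>T\<close> for the factorial to win,
    yet below the admissible size of tuples. The quarter gives
    \<open>(2 * M) ^ K \<le> exp (u * exp g / 2)\<close>, half of the exponent that \<open>E\<close>
    saves.\<close>
  define K where "K = nat \<lfloor>exp g / 4\<rfloor>"
  \<comment> \<open>On \<open>{a..x}\<close> the logarithm varies by \<open>exp (u / 2)\<close> out
    of \<open>exp u\<close>, while \<open>a / x\<close> is small enough to beat both the alternating
    sums and the Poisson weights.\<close>
  define a where "a = x * exp (- exp (u / 2))"
  define U where "U = real M / mertens_prod M"
  define E where "E = exp (- exp g * u)"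
  define R where "R = x * P / (8 * u ^ 10)"
  define c where "c = exp (- 2 * exp (0.378 * g)) / (8 * u ^ 10)"
  let ?\<theta> = "small_mertens u"
  have u0: "0 \<le> u" using u by simp
  have g0: "0 \<le> g" using log_gauge_identities[OF u] by (simp add: g_def)
  have hg: "h \<le> g" using g0 q by (simp add: h g_def[symmetric] mult_left_le_one_le)
  have l0: "0 < l" using l(1) exp_gt_zero[of "- (u / 2)"] by linarith
  have u10: "0 < u ^ 10" using u by simp
  note size = regimes(2)[unfolded size_regime_def, folded g_def]
  note err = regimes(3)[unfolded error_regime_def, folded g_def, folded c_def]
  note Mb = window_length_bounds[OF regimes(2) u q(1) l(2) y, folded M_def g_def]
  note zb = sieve_limit_bounds[OF u0, folded z_def]
  have \<theta>: "0 < ?\<theta>" using mertens_rates_pos u0 by simp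
  have P0: "0 < P" using l0 by (simp add: P_def)
  have Tg: "T \<le> exp (0.378 * g)"
  proof -
    have "exp (0.378 * h) \<le> exp (0.378 * g)" using hg by simp
    then show ?thesis using T(4) by linarith
  qed
  have cP: "x * c \<le> R"
  proof -
    have "exp (- 2 * exp (0.378 * g)) \<le> exp (- 2 * T)" using Tg by simp
    then have "exp (- 2 * exp (0.378 * g)) \<le> P" using P by linarith
    then have "c \<le> P / (8 * u ^ 10)" unfolding c_def using u10 by (intro divide_right_mono) auto
    then have "x * c \<le> x * (P / (8 * u ^ 10))" using x by (intro mult_left_mono) auto
    then show ?thesis by (simp add: R_def)
  qed
  have e2: "exp u / 2 \<le> exp u - exp (u / 2)" using size by blast
  have lna: "ln a = exp u - exp (u / 2)" using x by (simp add: a_def ln_mult_pos)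
  have a0: "0 < a" using x by (simp add: a_def)
  have ax: "a \<le> x" using x by (simp add: a_def mult_left_le)
  have lna1: "1 \<le> ln a"
  proof -
    have "1 + u \<le> exp u" by (rule exp_ge_add_one_self)
    then show ?thesis using e2 u unfolding lna by linarith
  qed
  have K: "real K \<le> exp g / 4" "exp g / 4 - 1 \<le> real K" by (auto simp: K_def) linarith
  have kK: "k \<le> K"
  proof -
    have "real k \<le> real K" using T(2) Tg K(2) size by linarith
    then show ?thesis by simp
  qed
  have eg: "1 \<le> exp g / 4" using size exp_gt_zero[of "0.378 * g"] by linarith
  have K1: "real K + 1 \<le> exp g" "real K \<le> exp g" using K eg by linarith+
  have main: "\<bar>real (num_intervals A x y k) - x * P\<bar> \<le> x * (P * (3 / (8 * u ^ 10))) + a * \<bar>P\<bar>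
    + 3 * x * (2 * U / ln a) ^ K / fact K + (real K + 1) * a * (4 * U) ^ K
    + x * (2 * real K ^ 3 * (2 * U) ^ K / real z) + x * ((real K + 1) * (2 * real M) ^ K * E)"
    unfolding U_def M_def
  proof (rule num_intervals_transfer)
    show "0 \<le> y" using Mb(8) exp_gt_zero[of "u / 2"] by linarith
    show "k \<le> K" by (rule kK)
    show "1 \<le> nat \<lfloor>y\<rfloor>" using Mb(6) by (simp add: M_def)
    have "real M \<le> real z" using Mb(5) size zb(2) by linarith
    then show "nat \<lfloor>y\<rfloor> \<le> z" by (simp add: M_def)
    have "(real K)\<^sup>2 \<le> (exp g)\<^sup>2" using K1 by (intro power_mono) auto
    also have "\<dots> = exp (2 * g)" by (simp add: exp_double)
    also have "\<dots> \<le> exp (exp (u / 32)) / 2" using size by blast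
    also have "\<dots> \<le> real z / 2" using zb(2) by simp
    finally show "(real K)\<^sup>2 / real z \<le> 1 / 2" using zb(1) by (simp add: pos_divide_le_eq)
    show "exp 1 \<le> a" using lna1 a0 by (simp add: ln_ge_iff)
    show "a \<le> x" by (rule ax)
    show "0 \<le> E" by (simp add: E_def)
    show "0 \<le> P * (3 / (8 * u ^ 10))" using P0 u10 by simp
  next
    fix H assume H: "H \<subseteq> {1..nat \<lfloor>y\<rfloor>}" "card H \<le> K"
    then have "real (card H) \<le> exp (log_gauge u)" using K1(2) by (simp add: g_def)
    then show "\<bar>real (tuple_count A x H) - singular_series (int ` H) * integral {2..x} (\<lambda>t. 1 / ln t ^ card H)\<bar> \<le> x * E"
      using HL[OF H(1)] by (simp add: E_def g_def)
  next
    fix t assume t: "a \<le> t" "t \<le> x"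
    have L: "exp u - exp (u / 2) \<le> ln t" "ln t \<le> exp u"
    proof -
      have "ln a \<le> ln t" "ln t \<le> ln x" using t a0 by simp_all
      then show "exp u - exp (u / 2) \<le> ln t" "ln t \<le> exp u" by (simp_all only: lna x(2))
    qed
    note mp = model_close_to_poisson[OF regimes u q h T l y L P[unfolded P_def], folded z_def P_def]
    show "1 / (mertens_prod z * ln t) \<le> 1" by (rule mp(1))
    show "\<bar>sieve_avg (primes_between 0 z) (thinned_prob (1 / (mertens_prod z * ln t)) k) {1..nat \<lfloor>y\<rfloor>} - P\<bar>
        \<le> P * (3 / (8 * u ^ 10))" by (rule mp(2))
  qed
  have U: "0 \<le> U" "U \<le> exp (u + 0.378 * g) / ?\<theta>"
  proof -
    show "0 \<le> U" unfolding U_def using mertens_prod_pos[of M] by simp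
    show "U \<le> exp (u + 0.378 * g) / ?\<theta>"
      unfolding U_def using Mb(5,7) \<theta> by (intro frac_le) auto
  qed
  have U4: "4 * U \<le> exp (3 * u)"
  proof -
    have "4 * U \<le> 4 * exp (u + 0.378 * g) / ?\<theta>" using U(2) by simp
    then show ?thesis using size by linarith
  qed
  have pow3: "b ^ K \<le> exp (3 * u * exp g)" if "0 \<le> b" "b \<le> exp (3 * u)" for b
  proof -
    have "b ^ K \<le> exp (3 * u) ^ K" using that by (intro power_mono) auto
    also have "\<dots> = exp (real K * (3 * u))" by (simp add: exp_of_nat_mult)
    also have "\<dots> \<le> exp (exp g * (3 * u))" using K1(2) u0 by (subst exp_le_cancel_iff) (intro mult_right_mono, auto)
    finally show ?thesis by (simp add: mult.commute)
  qed
  have term0: "a * \<bar>P\<bar> \<le> R"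
  proof -
    have "exp (- exp (u / 2)) * (x * P) \<le> 1 / (8 * u ^ 10) * (x * P)"
      using err P0 x by (intro mult_right_mono) auto
    then show ?thesis using P0 by (simp add: a_def R_def mult_ac)
  qed
  have term1: "3 * x * (2 * U / ln a) ^ K / fact K \<le> R"
  proof -
    define \<Lambda> where "\<Lambda> = 4 * exp (0.378 * g) / ?\<theta>"
    have "2 * U / ln a \<le> 2 * (exp (u + 0.378 * g) / ?\<theta>) / (exp u / 2)"
      using U e2 unfolding lna by (intro frac_le) auto
    also have "\<dots> = \<Lambda>" by (simp add: \<Lambda>_def exp_add)
    finally have le: "2 * U / ln a \<le> \<Lambda>" .
    have \<Lambda>0: "0 \<le> \<Lambda>" using \<theta> by (simp add: \<Lambda>_def)
    \<comment> \<open>In place of Stirling's formula: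
      \<open>v ^ K / fact K \<le> exp (exp 2 * v) / exp (2 * K)\<close>. Here \<open>2 * K\<close>
      is about \<open>exp g / 2\<close>, far beyond both \<open>exp 2 * \<Lambda>\<close> and
      \<open>2 * T\<close>.\<close>
    have "exp 2 ^ K * ((2 * U / ln a) ^ K / fact K) \<le> exp 2 ^ K * (\<Lambda> ^ K / fact K)"
      using le U lna1 by (intro mult_left_mono divide_right_mono power_mono) auto
    also have "\<dots> = (exp 2 * \<Lambda>) ^ K / fact K" by (simp add: power_mult_distrib)
    also have "\<dots> \<le> exp (exp 2 * \<Lambda>)" using \<Lambda>0 by (intro power_div_fact_le_exp) auto
    finally have "(2 * U / ln a) ^ K / fact K \<le> exp (exp 2 * \<Lambda>) / exp 2 ^ K"
      by (simp add: pos_le_divide_eq mult.commute)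
    also have "exp 2 ^ K = (exp (real K * 2) :: real)" by (simp add: exp_of_nat_mult)
    also have "exp (exp 2 * \<Lambda>) / exp (real K * 2) = exp (exp 2 * \<Lambda> - real K * 2)" by (rule exp_diff[symmetric])
    also have "\<dots> \<le> exp (exp 2 * \<Lambda> - 2 * (exp g / 4 - 1))" using K(2) by simp
    finally have "3 * ((2 * U / ln a) ^ K / fact K) \<le> 3 * exp (exp 2 * \<Lambda> - 2 * (exp g / 4 - 1))" by simp
    also have "\<dots> \<le> c" using err unfolding \<Lambda>_def by blast
    finally have "x * (3 * ((2 * U / ln a) ^ K / fact K)) \<le> x * c" using x by (intro mult_left_mono) auto
    then show ?thesis using cP by (simp add: mult_ac)
  qed
  have term2: "(real K + 1) * a * (4 * U) ^ K \<le> R"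
  proof -
    have "(real K + 1) * (4 * U) ^ K \<le> exp g * exp (3 * u * exp g)"
      using K1(1) pow3[OF _ U4] U by (intro mult_mono) auto
    then have "(real K + 1) * (4 * U) ^ K * exp (- exp (u / 2)) \<le> exp g * exp (3 * u * exp g) * exp (- exp (u / 2))"
      by (intro mult_right_mono) auto
    also have "\<dots> = exp (g + 3 * u * exp g - exp (u / 2))" by (simp only: exp_add[symmetric] diff_conv_add_uminus)
    also have "\<dots> \<le> c" using err by blast
    finally have "x * ((real K + 1) * (4 * U) ^ K * exp (- exp (u / 2))) \<le> x * c" using x by (intro mult_left_mono) auto
    then show ?thesis using cP by (simp add: a_def mult_ac)
  qed
  have term3: "x * (2 * real K ^ 3 * (2 * U) ^ K / real z) \<le> R"
  proof -
    have "real K ^ 3 \<le> exp g ^ 3" using K1(2) by (intro power_mono) auto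
    also have "\<dots> = exp (3 * g)" using exp_of_nat_mult[of 3 g] by simp
    finally have K3: "real K ^ 3 \<le> exp (3 * g)" .
    have "2 * real K ^ 3 * (2 * U) ^ K / real z \<le> 2 * exp (3 * g) * exp (3 * u * exp g) / exp (exp (u / 32))"
      using K3 U U4 zb(2) by (intro frac_le mult_mono pow3 mult_left_mono) auto
    also have "\<dots> = 2 * exp (3 * g + 3 * u * exp g - exp (u / 32))" by (simp add: exp_add exp_diff)
    also have "\<dots> \<le> c" using err by blast
    finally have "x * (2 * real K ^ 3 * (2 * U) ^ K / real z) \<le> x * c" using x by (intro mult_left_mono) auto
    then show ?thesis using cP by linarith
  qed
  have term4: "x * ((real K + 1) * (2 * real M) ^ K * E) \<le> R"
  proof -
    have "2 * real M \<le> exp (2 * u)"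
    proof -
      have "2 * real M \<le> 2 * exp (u + 0.378 * g)" using Mb(5) by simp
      then show ?thesis using size by linarith
    qed
    then have "(2 * real M) ^ K \<le> exp (2 * u) ^ K" by (intro power_mono) auto
    also have "\<dots> = exp (real K * (2 * u))" by (simp add: exp_of_nat_mult)
    also have "\<dots> \<le> exp (exp g / 4 * (2 * u))" using K(1) u0 by (subst exp_le_cancel_iff) (intro mult_right_mono, auto)
    also have "exp g / 4 * (2 * u) = u * exp g / 2" by simp
    finally have "(real K + 1) * (2 * real M) ^ K * E \<le> exp g * exp (u * exp g / 2) * E"
      using K1(1) by (intro mult_right_mono mult_mono) (auto simp: E_def)
    also have "\<dots> = exp (g + u * exp g / 2 - u * exp g)"
      by (simp add: E_def exp_add[symmetric] mult.commute)
    also have "\<dots> \<le> c" using err by blast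
    finally have "x * ((real K + 1) * (2 * real M) ^ K * E) \<le> x * c" using x by (intro mult_left_mono) auto
    then show ?thesis using cP by linarith
  qed
  have "x * (P * (3 / (8 * u ^ 10))) = 3 * R" "x * P / u ^ 10 = 8 * R" by (auto simp: R_def)
  moreover have "0 \<le> R" using x P0 u10 by (simp add: R_def)
  ultimately show ?thesis using main term0 term1 term2 term3 term4 by linarith
qed

text \<open>From \<open>fact k \<le> k ^ k\<close>. This is where the restriction on
  \<open>k * ln (k / l)\<close> acts: with \<open>l\<close> and that product at most
  \<open>T\<close>, the weight is at least \<open>exp (- 2 * T)\<close>.\<close>

lemma poisson_prob_ge:
  fixes l :: real
  assumes "0 < l"
  shows "exp (- (l + real k * ln (real k / l))) \<le> exp (- l) * l ^ k / fact k"
proof (cases "k = 0")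
  case False
  have "exp (- (real k * ln (real k / l))) = (l / real k) ^ k"
  proof -
    have "exp (- (real k * ln (real k / l))) = exp (real k * ln (l / real k))"
      using assms False by (simp add: ln_div algebra_simps)
    also have "\<dots> = (l / real k) ^ k" using assms False by (simp add: exp_of_nat_mult)
    finally show ?thesis .
  qed
  moreover have "(l / real k) ^ k \<le> l ^ k / fact k"
  proof -
    have "fact k \<le> real (k ^ k)" using fact_le_power[of k, where ?'a = real] by simp
    then show ?thesis using assms False by (simp add: power_divide frac_le)
  qed
  ultimately have "exp (- l) * exp (- (real k * ln (real k / l))) \<le> exp (- l) * (l ^ k / fact k)"
    by (intro mult_left_mono) auto
  then show ?thesis by (simp add: exp_add[symmetric])
qed simp

lemma HL_tuple_count:
  assumes "HL \<phi> \<psi> A"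
  obtains x0 where "\<And>x H M. x0 \<le> x \<Longrightarrow> H \<subseteq> {1..M} \<Longrightarrow> real M \<le> \<phi> x \<Longrightarrow> real (card H) \<le> \<psi> x \<Longrightarrow>
    \<bar>real (tuple_count A x H) - singular_series (int ` H) * integral {2..x} (\<lambda>t. 1 / ln t ^ card H)\<bar>
    \<le> x * exp (- \<psi> x * log_iter 2 x)"
proof -
  obtain x0 where x0: "\<forall>x\<ge>x0. \<forall>H :: int set. finite H \<longrightarrow> (\<forall>h\<in>H. 0 \<le> h \<and> real_of_int h \<le> \<phi> x) \<longrightarrow>
      real (card H) \<le> \<psi> x \<longrightarrow>
      \<bar>real (card {n :: nat. 1 \<le> n \<and> real n \<le> x \<and> (\<forall>h\<in>H. int n + h \<in> int ` A)})
           - singular_series H * integral {2..x} (\<lambda>t. 1 / ln t ^ card H)\<bar>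
        \<le> x * exp (- \<psi> x * log_iter 2 x)"
    using assms unfolding HL_def by (elim exE) (rule that)
  show ?thesis
  proof (rule that)
    fix x H and M :: nat
    assume x: "x0 \<le> x" and H: "H \<subseteq> {1..M}" "real M \<le> \<phi> x" "real (card H) \<le> \<psi> x"
    have fin: "finite (int ` H)" using H(1) finite_subset by blast
    have mem: "int n + int h \<in> int ` A \<longleftrightarrow> n + h \<in> A" for n h
      using inj_image_mem_iff[OF inj_of_nat[where ?'a = int], of "n + h" A]
      by (simp only: of_nat_add)
    have bounded: "\<forall>h\<in>int ` H. 0 \<le> h \<and> real_of_int h \<le> \<phi> x"
    proof safe
      fix h assume "h \<in> H"
      then have "real h \<le> real M" using H(1) by auto
      then show "real_of_int (int h) \<le> \<phi> x" using H(2) by simp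
    qed auto
    have card: "card (int ` H) = card H" by (rule card_image) simp
    show "\<bar>real (tuple_count A x H) - singular_series (int ` H) * integral {2..x} (\<lambda>t. 1 / ln t ^ card H)\<bar>
        \<le> x * exp (- \<psi> x * log_iter 2 x)"
      using x0[THEN spec, THEN mp, OF x, THEN spec, THEN mp, OF fin, THEN mp, OF bounded] H(3) by (simp add: tuple_count_def mem card)
  qed
qed

lemma log_iter_2_3:
  assumes "3 \<le> ln (ln x)" "1 \<le> ln x"
  shows "log_iter 2 x = ln (ln x)" "log_iter 3 x = ln (ln (ln x))"
  using assms by (auto simp: numeral_2_eq_2 numeral_3_eq_3 max_def)

theorem theorem1p6:
  shows "\<exists>C :: real. \<forall>A :: nat set.
    0 \<notin> A \<longrightarrow>
    HL (\<lambda>x. lambda_max x * ln x) (\<lambda>x. exp (sqrt (log_iter 2 x * log_iter 3 x))) A \<longrightarrow>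
    (\<exists>x0 :: real. \<forall>x\<ge>x0. \<forall>(l :: real) (k :: nat).
       1 / sqrt (ln x) \<le> l \<longrightarrow> l \<le> lambda_max x \<longrightarrow>
       max (real k) (real k * ln (real k / l))
         \<le> exp (1 / sqrt 15 * sqrt (log_iter 2 x * log_iter 3 x)) \<longrightarrow>
       (\<exists>\<theta> :: real. \<bar>\<theta>\<bar> \<le> C / log_iter 2 x ^ 10 \<and>
          real (num_intervals A x (l * ln x) k) = x * (exp (- l) * l ^ k / fact k) * (1 + \<theta>)))"
proof (rule exI[of _ 1], intro allI impI)
  fix A :: "nat set"
  assume "HL (\<lambda>x. lambda_max x * ln x) (\<lambda>x. exp (sqrt (log_iter 2 x * log_iter 3 x))) A"
  then obtain x1 where HL: "\<And>x H M. x1 \<le> x \<Longrightarrow> H \<subseteq> {1..M} \<Longrightarrow> real M \<le> lambda_max x * ln x \<Longrightarrow>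
    real (card H) \<le> exp (sqrt (log_iter 2 x * log_iter 3 x)) \<Longrightarrow>
    \<bar>real (tuple_count A x H) - singular_series (int ` H) * integral {2..x} (\<lambda>t. 1 / ln t ^ card H)\<bar>
    \<le> x * exp (- exp (sqrt (log_iter 2 x * log_iter 3 x)) * log_iter 2 x)"
    by (rule HL_tuple_count) blast
  have lim: "filterlim (\<lambda>x :: real. ln (ln x)) at_top at_top" by real_asymp
  have "eventually (\<lambda>x. brun_regime (ln (ln x)) \<and> size_regime (ln (ln x)) \<and> error_regime (ln (ln x))
      \<and> 3 \<le> ln (ln x) \<and> 1 \<le> ln x \<and> 1 \<le> x \<and> x1 \<le> x) at_top"
  proof (intro eventually_conj)
    show "eventually (\<lambda>x :: real. 3 \<le> ln (ln x)) at_top"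
      using lim by (auto simp: filterlim_at_top)
    show "eventually (\<lambda>x :: real. 1 \<le> ln x) at_top" by real_asymp
  qed (use eventually_compose_filterlim[OF eventually_brun_regime lim]
        eventually_compose_filterlim[OF eventually_size_regime lim]
        eventually_compose_filterlim[OF eventually_error_regime lim] eventually_ge_at_top in auto)
  then obtain x0 where x0: "\<And>x. x0 \<le> x \<Longrightarrow> brun_regime (ln (ln x)) \<and> size_regime (ln (ln x))
      \<and> error_regime (ln (ln x)) \<and> 3 \<le> ln (ln x) \<and> 1 \<le> ln x \<and> 1 \<le> x \<and> x1 \<le> x"
    unfolding eventually_at_top_linorder by blast
  show "\<exists>x0 :: real. \<forall>x\<ge>x0. \<forall>(l :: real) (k :: nat).
       1 / sqrt (ln x) \<le> l \<longrightarrow> l \<le> lambda_max x \<longrightarrow>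
       max (real k) (real k * ln (real k / l))
         \<le> exp (1 / sqrt 15 * sqrt (log_iter 2 x * log_iter 3 x)) \<longrightarrow>
       (\<exists>\<theta> :: real. \<bar>\<theta>\<bar> \<le> 1 / log_iter 2 x ^ 10 \<and>
          real (num_intervals A x (l * ln x) k) = x * (exp (- l) * l ^ k / fact k) * (1 + \<theta>))"
  proof (rule exI[of _ x0], intro allI impI)
    fix x l :: real and k :: nat
    assume "x0 \<le> x" and l1: "1 / sqrt (ln x) \<le> l" and l2: "l \<le> lambda_max x"
      and k: "max (real k) (real k * ln (real k / l)) \<le> exp (1 / sqrt 15 * sqrt (log_iter 2 x * log_iter 3 x))"
    define u where "u = ln (ln x)"
    define g where "g = log_gauge u"
    have regimes: "brun_regime u" "size_regime u" "error_regime u" and u: "3 \<le> u"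
      and lnx: "1 \<le> ln x" and x: "1 \<le> x" "x1 \<le> x" using x0[OF \<open>x0 \<le> x\<close>] by (auto simp: u_def)
    have lnu: "ln x = exp u" using lnx by (simp add: u_def)
    have li: "log_iter 2 x = u" "log_iter 3 x = ln u"
      using log_iter_2_3[of x] u lnx by (auto simp: u_def)
    have g_eq: "sqrt (log_iter 2 x * log_iter 3 x) = g" by (simp add: li g_def log_gauge_def)
    have g0: "0 \<le> g" using log_gauge_identities[OF u] by (simp add: g_def)
    \<comment> \<open>\<open>0.378\<close> exceeds \<open>1 / sqrt 7\<close> by less than
      \<open>0.0001\<close>, hence the four decimals of \<open>2.6456\<close>.\<close>
    have sq7: "1 / sqrt 7 * g \<le> 0.378 * g"
    proof (rule mult_right_mono[OF _ g0])
      have "2.6456 \<le> sqrt 7" by (rule real_le_rsqrt) (simp add: power2_eq_square)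
      then have "1 / sqrt 7 \<le> 1 / 2.6456" by (intro divide_left_mono) auto
      then show "1 / sqrt 7 \<le> 0.378" by simp
    qed
    \<comment> \<open>\<open>0.7\<close> is a rational lower bound for \<open>1 / sqrt 2\<close>,
      and \<open>0.378 * 0.7 = 0.2646\<close> is still above \<open>1 / sqrt 15\<close>.\<close>
    have sq15: "1 / sqrt 15 * g \<le> 0.378 * (0.7 * g)"
    proof -
      have "3.78 \<le> sqrt 15" by (rule real_le_rsqrt) (simp add: power2_eq_square)
      then have "1 / sqrt 15 \<le> 1 / 3.78" by (intro divide_left_mono) auto
      then have "1 / sqrt 15 \<le> 0.378 * 0.7" by simp
      from mult_right_mono[OF this g0] show ?thesis by simp
    qed
    have "(exp (u / 2))\<^sup>2 = exp u" using exp_double[of "u / 2"] by simp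
    then have "sqrt (exp u) = exp (u / 2)" by (intro real_sqrt_unique) simp_all
    then have lu: "exp (- (u / 2)) \<le> l" using l1 by (simp add: lnu exp_minus inverse_eq_divide)
    then have l0: "0 < l" using exp_gt_zero[of "- (u / 2)"] by linarith
    have l7: "l \<le> exp (1 / sqrt 7 * g)" using l2 by (simp add: lambda_max_def g_eq)
    then have lg: "l \<le> exp (0.378 * g)" using sq7 by (meson exp_le_cancel_iff order_trans)
    have k15: "real k \<le> exp (1 / sqrt 15 * g)" "real k * ln (real k / l) \<le> exp (1 / sqrt 15 * g)"
      using k by (auto simp: g_eq)
    define y where "y = l * ln x"
    define P where "P = exp (- l) * l ^ k / fact k"
    have P0: "0 < P" using l0 by (simp add: P_def)
    \<comment> \<open>If \<open>l\<close> may be as small as \<open>1 / sqrt (ln x)\<close>, only \<open>q\<^sup>2 = 1 / 2\<close> is available, and then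
      \<open>1 / sqrt 15 < 0.378 / sqrt 2\<close> is needed; otherwise \<open>k \<le> l\<close> and \<open>1 \<le> l\<close>, so \<open>q = 1\<close> works
      with \<open>T = l\<close>.\<close>
    have "\<exists>q T. 1 / 2 \<le> q\<^sup>2 \<and> 0.7 \<le> q \<and> q \<le> 1 \<and> 1 \<le> T \<and> real k \<le> T \<and> l \<le> T \<and> T \<le> exp (0.378 * (q * g))
        \<and> exp (q\<^sup>2 * u) \<le> y \<and> real k * ln (real k / l) \<le> T"
    proof (cases "real k \<le> l \<and> 1 \<le> l")
      case True
      have "real k * ln (real k / l) \<le> 0"
        using True l0 by (cases "k = 0") (auto intro!: mult_nonneg_nonpos simp: ln_le_zero_iff)
      then show ?thesis using True lg l0 by - (rule exI[of _ 1], rule exI[of _ l], auto simp: y_def lnu)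
    next
      case False
      define T where "T = max 1 (max (real k) (real k * ln (real k / l)))"
      define q where "q = 1 / sqrt 2"
      have q2: "q\<^sup>2 = 1 / 2" by (simp add: q_def power_divide)
      have "sqrt 2 \<le> 1 / 0.7" by (rule real_le_lsqrt) (simp_all add: power2_eq_square)
      then have q7: "0.7 \<le> q" by (simp add: q_def field_simps)
      have q1: "q \<le> 1" by (simp add: q_def)
      have "1 / sqrt 15 * g \<le> 0.378 * (q * g)"
        using order_trans[OF sq15 mult_left_mono[OF mult_right_mono[OF q7 g0]]] by simp
      then have le: "exp (1 / sqrt 15 * g) \<le> exp (0.378 * (q * g))" by (subst exp_le_cancel_iff)
      have "1 \<le> exp (0.378 * (q * g))" using g0 q7 by simp
      then have "T \<le> exp (0.378 * (q * g))"
        using order_trans[OF k15(1) le] order_trans[OF k15(2) le] by (simp only: T_def max.bounded_iff)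
      moreover have "exp (q\<^sup>2 * u) \<le> y"
      proof -
        have "exp (q\<^sup>2 * u) = exp (- (u / 2)) * exp u" by (simp add: q2 exp_add[symmetric])
        also have "\<dots> \<le> y" unfolding y_def lnu using lu by (intro mult_right_mono) auto
        finally show ?thesis .
      qed
      \<comment> \<open>Outside the first case \<open>l\<close> is less than \<open>k\<close> or
        less than 1, and \<open>T\<close> is at least both; this is why 1 is included in the
        maximum.\<close>
      moreover have "l \<le> T"
        using False by (auto simp: T_def)
      moreover have "1 \<le> T" "real k \<le> T" "real k * ln (real k / l) \<le> T" by (auto simp: T_def)
      ultimately show ?thesis using q7 q1
        by - (rule exI[of _ q], rule exI[of _ T], intro conjI; (assumption | simp add: q2))
    qed
    then obtain q T where q: "1 / 2 \<le> q\<^sup>2" "0.7 \<le> q" "q \<le> 1"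
      and T: "1 \<le> T" "real k \<le> T" "l \<le> T" "T \<le> exp (0.378 * (q * log_gauge u))"
      and y: "exp (q\<^sup>2 * u) \<le> y" and kT: "real k * ln (real k / l) \<le> T"
      by (auto simp: g_def)
    have "exp (- 2 * T) \<le> exp (- (l + real k * ln (real k / l)))" using T(3) kT by simp
    also have "\<dots> \<le> P" unfolding P_def using l0 by (rule poisson_prob_ge)
    finally have PT: "exp (- 2 * T) \<le> P" .
    have "\<bar>real (num_intervals A x y k) - x * P\<bar> \<le> x * P / u ^ 10"
      unfolding P_def
    proof (rule num_intervals_poisson[OF regimes u q refl T lu _ _ y])
      fix H assume H: "H \<subseteq> {1..nat \<lfloor>y\<rfloor>}" "real (card H) \<le> exp (log_gauge u)"
      have "0 \<le> y" using l0 lnx by (simp add: y_def)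
      then have "real (nat \<lfloor>y\<rfloor>) \<le> y" by simp
      also have "y \<le> lambda_max x * ln x" unfolding y_def using l2 lnx by (intro mult_right_mono) auto
      finally show "\<bar>real (tuple_count A x H) - singular_series (int ` H) * integral {2..x} (\<lambda>t. 1 / ln t ^ card H)\<bar>
          \<le> x * exp (- exp (log_gauge u) * u)"
        using HL[OF x(2) H(1)] H(2) unfolding g_eq unfolding li(1) g_def by blast
    qed (use lg lnu x PT in \<open>auto simp: g_def y_def P_def\<close>)
    then have bound: "\<bar>real (num_intervals A x y k) - x * P\<bar> / (x * P) \<le> (x * P / u ^ 10) / (x * P)"
      using x P0 by (intro divide_right_mono) auto
    have xP: "0 < x * P" using x P0 by simp
    have "real (num_intervals A x y k) / (x * P) - 1 = (real (num_intervals A x y k) - x * P) / (x * P)"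
      unfolding diff_divide_distrib using xP by (subst divide_self) auto
    also have "\<bar>\<dots>\<bar> = \<bar>real (num_intervals A x y k) - x * P\<bar> / (x * P)"
      by (rule abs_div_pos[OF xP, symmetric])
    also note bound
    also have "x * P / u ^ 10 / (x * P) = 1 / u ^ 10" using x(1) P0 by simp
    finally have "\<bar>real (num_intervals A x y k) / (x * P) - 1\<bar> \<le> 1 / u ^ 10" .
    moreover have "real (num_intervals A x y k) = x * P * (1 + (real (num_intervals A x y k) / (x * P) - 1))"
      using x P0 by simp
    ultimately show "\<exists>\<theta> :: real. \<bar>\<theta>\<bar> \<le> 1 / log_iter 2 x ^ 10 \<and>
          real (num_intervals A x (l * ln x) k) = x * (exp (- l) * l ^ k / fact k) * (1 + \<theta>)"
      unfolding li P_def y_def by blast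
  qed
qed

end
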